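(* Let $G$ be a group such that the graded Lie algebra $\mathrm{gr}_\Gamma(G)$ has trivial center. Then $$\begin{array}{ccccccccc} 0&\to&\mathrm{gr}_\Gamma(G)&\xrightarrow{\mathrm{gr}_\Gamma(\mathrm{Ad})}&\mathrm{gr}_\Gamma(\mathcal{T}_G)&\xrightarrow{\mathrm{gr}_\Gamma(\pi)}&\mathrm{gr}_\Gamma(\widetilde{\mathcal{T}}_G)&\to&0\\ &&\downarrow{=}&&\downarrow{\iota_F}&&\downarrow{\iota_{\widetilde F}}&&\\ 0&\to&\mathrm{gr}_\Gamma(G)&\xrightarrow{\ \overline{\mathrm{Ad}}\ }&\mathrm{gr}_F(\mathcal{T}_G)&\xrightarrow{\ \bar\pi\ }&\mathrm{gr}_{\widetilde F}(\widetilde{\mathcal{T}}_G)&\to&0 \end{array}$$ is a commuting diagram of graded Lie algebras with compatible $\mathcal{A}(G)$-module structures (all maps being $\mathcal{A}(G)$-equivariant morphisms of graded Lie algebras), and it has exact rows.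
   Context: For a group $G$, $(x,y)=xyx^{-1}y^{-1}$, $\Gamma^1(G)=G$, $\Gamma^{s+1}(G)=(\Gamma^s(G),G)$, and $\mathrm{gr}_\Gamma(G)=\bigoplus_{s\ge1}\Gamma^s(G)/\Gamma^{s+1}(G)$ is the associated graded Lie algebra (over $\mathbb{Z}$), with bracket induced by the commutator; $\mathrm{gr}_\Gamma$ is a functor. The Johnson filtration on $\mathrm{Aut}(G)$ (product = composition) is $F^s=\{\alpha\mid\alpha(x)x^{-1}\in\Gamma^{s+1}(G)\ \forall x\in G\}$, $s\ge0$; $(F^s,F^t)\subseteq F^{s+t}$. The Torelli group is $\mathcal{T}_G=F^1$, and $\mathrm{gr}_F(\mathcal{T}_G)=\bigoplus_{s\ge1}F^s/F^{s+1}$. Let $\pi\colon\mathrm{Aut}(G)\to\mathrm{Out}(G)=\mathrm{Aut}(G)/\mathrm{Inn}(G)$, $\widetilde F^s=\pi(F^s)$, $\widetilde{\mathcal{T}}_G=\widetilde F^1$, $\mathrm{gr}_{\widetilde F}(\widetilde{\mathcal{T}}_G)=\bigoplus_{s\ge1}\widetilde F^s/\widetilde F^{s+1}$. The map $\pi\colon\mathcal{T}_G\to\widetilde{\mathcal{T}}_G$ induces $\mathrm{gr}_\Gamma(\pi)$ on lower central series quotients and $\bar\pi$ on Johnson filtration quotients. The inclusions $\Gamma^s(\mathcal{T}_G)\subseteq F^s$ and $\Gamma^s(\widetilde{\mathcal{T}}_G)\subseteq\widetilde F^s$ induce $\iota_F$ and $\iota_{\widetilde F}$. The map $\mathrm{Ad}\colon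 G\to\mathcal{T}_G$ sends $x$ to $\mathrm{Ad}_x\colon y\mapsto xyx^{-1}$, and induces $\mathrm{gr}_\Gamma(\mathrm{Ad})$; since $\mathrm{Ad}_x\in F^s$ for $x\in\Gamma^s(G)$, it also induces $\overline{\mathrm{Ad}}\colon\mathrm{gr}_\Gamma^s(G)\to\mathrm{gr}_F^s(\mathcal{T}_G)$, $\bar x\mapsto\overline{\mathrm{Ad}_x}$. $\mathcal{A}(G)=F^0/F^1=\mathrm{im}(\mathrm{Aut}(G)\to\mathrm{Aut}(G_{\mathrm{ab}}))$. For $\bar\sigma\in\mathcal{A}(G)$ represented by $\sigma\in\mathrm{Aut}(G)$: $\bar\sigma$ acts on $\mathrm{gr}_\Gamma(G)$ by $\bar\sigma\cdot\bar x=\overline{\sigma(x)}$; on $\mathrm{gr}_\Gamma(\mathcal{T}_G)$ and $\mathrm{gr}_F(\mathcal{T}_G)$ by $\bar\sigma\cdot\bar\alpha=\overline{\sigma\alpha\sigma^{-1}}$; and on $\mathrm{gr}_\Gamma(\widetilde{\mathcal{T}}_G)$ and $\mathrm{gr}_{\widetilde F}(\widetilde{\mathcal{T}}_G)$ by conjugation by $\pi(\sigma)$. These are well-defined actions by graded Lie algebra automorphisms. *)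

theory Defs
  imports "HOL-Algebra.Algebra"
begin

section \<open>Graded Lie algebras over the integers\<close>

text \<open>
  The additive group of a graded Lie algebra over \<open>\<int>\<close> is written multiplicatively, as for
  \<^const>\<open>sum_group\<close> and \<^const>\<open>FactGroup\<close>; the \<open>\<int>\<close>-module structure is that of an
  abelian group. The field \<open>homog\<close> gives the homogeneous part of each degree; only the degrees
  \<open>\<ge> 1\<close> are meaningful.
\<close>

record 'a graded_lie = "'a monoid" +
  bracket :: "'a \<Rightarrow> 'a \<Rightarrow> 'a"
  homog :: "nat \<Rightarrow> 'a set"

locale graded_lie_algebra = comm_group L
  for L :: "('a, 'm) graded_lie_scheme" (structure) +
  assumes bracket_closed:
      "\<lbrakk>x \<in> carrier L; y \<in> carrier L\<rbrakk> \<Longrightarrow> bracket L x y \<in> carrier L"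
    and bracket_add_left:
      "\<lbrakk>x \<in> carrier L; y \<in> carrier L; z \<in> carrier L\<rbrakk> \<Longrightarrow>
        bracket L (x \<otimes> y) z = bracket L x z \<otimes> bracket L y z"
    and bracket_add_right:
      "\<lbrakk>x \<in> carrier L; y \<in> carrier L; z \<in> carrier L\<rbrakk> \<Longrightarrow>
        bracket L x (y \<otimes> z) = bracket L x y \<otimes> bracket L x z"
    and bracket_alternating:
      "x \<in> carrier L \<Longrightarrow> bracket L x x = \<one>"
    and jacobi:
      "\<lbrakk>x \<in> carrier L; y \<in> carrier L; z \<in> carrier L\<rbrakk> \<Longrightarrow>
        bracket L x (bracket L y z) \<otimes> bracket L y (bracket L z x) \<otimes> bracket L z (bracket L x y)
          = \<one>"
    and homog_subgroup: "1 \<le> s \<Longrightarrow> subgroup (homog L s) L"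
    \<comment> \<open>internal direct sum: the summation map out of the external direct sum is bijective\<close>
    and homog_direct_sum:
      "(\<lambda>x. finprod L x {s \<in> {1..}. x s \<noteq> \<one>})
        \<in> iso (sum_group {1..} (\<lambda>s. L\<lparr>carrier := homog L s\<rparr>)) L"
    and homog_bracket:
      "\<lbrakk>1 \<le> s; 1 \<le> t; x \<in> homog L s; y \<in> homog L t\<rbrakk> \<Longrightarrow> bracket L x y \<in> homog L (s + t)"

definition lie_center :: "('a, 'm) graded_lie_scheme \<Rightarrow> 'a set" where
  "lie_center L = {x \<in> carrier L. \<forall>y \<in> carrier L. bracket L x y = \<one>\<^bsub>L\<^esub>}"

definition graded_lie_hom ::
    "('a, 'm) graded_lie_scheme \<Rightarrow> ('b, 'n) graded_lie_scheme \<Rightarrow> ('a \<Rightarrow> 'b) set" where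
  "graded_lie_hom L M =
    {f \<in> hom L M.
      (\<forall>x \<in> carrier L. \<forall>y \<in> carrier L. f (bracket L x y) = bracket M (f x) (f y)) \<and>
      (\<forall>s \<ge> 1. f ` homog L s \<subseteq> homog M s)}"

definition graded_lie_action ::
    "('g, 'k) monoid_scheme \<Rightarrow> ('a, 'm) graded_lie_scheme \<Rightarrow> ('g \<Rightarrow> 'a \<Rightarrow> 'a) \<Rightarrow> bool" where
  "graded_lie_action A L \<phi> \<longleftrightarrow>
    graded_lie_algebra L \<and> group_action A (carrier L) \<phi> \<and>
    (\<forall>a \<in> carrier A. \<phi> a \<in> graded_lie_hom L L)"

definition equivariant_graded_lie_hom ::
    "('g, 'k) monoid_scheme \<Rightarrow> ('a, 'm) graded_lie_scheme \<Rightarrow> ('g \<Rightarrow> 'a \<Rightarrow> 'a) \<Rightarrow>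
      ('b, 'n) graded_lie_scheme \<Rightarrow> ('g \<Rightarrow> 'b \<Rightarrow> 'b) \<Rightarrow> ('a \<Rightarrow> 'b) set" where
  "equivariant_graded_lie_hom A L \<phi> M \<psi> =
    {f \<in> graded_lie_hom L M. \<forall>a \<in> carrier A. \<forall>x \<in> carrier L. f (\<phi> a x) = \<psi> a (f x)}"

text \<open>
  Exactness of \<open>0 \<rightarrow> K \<rightarrow> L \<rightarrow> M \<rightarrow> 0\<close>. The library's \<^const>\<open>short_exact_sequence\<close> requires the
  three groups to have the same element type.
\<close>

definition short_exact ::
    "('a, 'k) monoid_scheme \<Rightarrow> ('b, 'l) monoid_scheme \<Rightarrow> ('c, 'm) monoid_scheme \<Rightarrow>
      ('a \<Rightarrow> 'b) \<Rightarrow> ('b \<Rightarrow> 'c) \<Rightarrow> bool" where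
  "short_exact K L M f g \<longleftrightarrow> f \<in> mon K L \<and> f ` carrier K = kernel L M g \<and> g \<in> epi L M"


section \<open>The graded Lie algebra of a filtration\<close>

definition commutator :: "('a, 'm) monoid_scheme \<Rightarrow> 'a \<Rightarrow> 'a \<Rightarrow> 'a" where
  "commutator H x y = x \<otimes>\<^bsub>H\<^esub> y \<otimes>\<^bsub>H\<^esub> inv\<^bsub>H\<^esub> x \<otimes>\<^bsub>H\<^esub> inv\<^bsub>H\<^esub> y"

definition commutator_subgroup :: "('a, 'm) monoid_scheme \<Rightarrow> 'a set \<Rightarrow> 'a set \<Rightarrow> 'a set" where
  "commutator_subgroup H A B = generate H {commutator H x y | x y. x \<in> A \<and> y \<in> B}"

text \<open>The lower central series is indexed from 1; the value at 0 is a dummy.\<close>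

fun lcs :: "('a, 'm) monoid_scheme \<Rightarrow> nat \<Rightarrow> 'a set" where
  "lcs H 0 = carrier H"
| "lcs H (Suc 0) = carrier H"
| "lcs H (Suc (Suc s)) = commutator_subgroup H (lcs H (Suc s)) (carrier H)"

definition gr_piece :: "('a, 'm) monoid_scheme \<Rightarrow> (nat \<Rightarrow> 'a set) \<Rightarrow> nat \<Rightarrow> 'a set monoid" where
  "gr_piece H N s = H\<lparr>carrier := N s\<rparr> Mod N (Suc s)"

text \<open>
  Below, operations on cosets are given without choosing representatives: apply the operation to
  all representatives and saturate by the next filtration subgroup. The result is a coset
  precisely if the operation is well-defined on the cosets in question.
\<close>

definition gr_bracket ::
    "('a, 'm) monoid_scheme \<Rightarrow> (nat \<Rightarrow> 'a set) \<Rightarrow> nat \<Rightarrow> nat \<Rightarrow> 'a set \<Rightarrow> 'a set \<Rightarrow> 'a set" where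
  "gr_bracket H N s t C D = N (Suc (s + t)) <#>\<^bsub>H\<^esub> {commutator H x y | x y. x \<in> C \<and> y \<in> D}"

definition gr :: "('a, 'm) monoid_scheme \<Rightarrow> (nat \<Rightarrow> 'a set) \<Rightarrow> (nat \<Rightarrow> 'a set) graded_lie" where
  "gr H N =
    \<lparr>carrier = carrier (sum_group {1..} (gr_piece H N)),
     monoid.mult = monoid.mult (sum_group {1..} (gr_piece H N)),
     one = monoid.one (sum_group {1..} (gr_piece H N)),
     bracket = (\<lambda>x y. \<lambda>n \<in> {1..}.
       finprod (gr_piece H N n) (\<lambda>s. gr_bracket H N s (n - s) (x s) (y (n - s))) {1..<n}),
     homog = (\<lambda>s. {x \<in> carrier (sum_group {1..} (gr_piece H N)).
       \<forall>t \<ge> 1. t \<noteq> s \<longrightarrow> x t = \<one>\<^bsub>gr_piece H N t\<^esub>})\<rparr>"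

text \<open>The map on associated graded objects induced by \<open>f\<close>, into that of \<open>K\<close> filtered by \<open>M\<close>.\<close>

definition gr_map ::
    "('b, 'n) monoid_scheme \<Rightarrow> (nat \<Rightarrow> 'b set) \<Rightarrow> ('a \<Rightarrow> 'b) \<Rightarrow> (nat \<Rightarrow> 'a set) \<Rightarrow> nat \<Rightarrow> 'b set" where
  "gr_map K M f x = (\<lambda>s \<in> {1..}. M (Suc s) <#>\<^bsub>K\<^esub> f ` x s)"

text \<open>
  The action on \<^term>\<open>gr H N\<close> induced by the maps \<open>\<phi> \<sigma> : H \<rightarrow> H\<close>, for group elements \<open>a\<close> that are
  themselves cosets of elements \<open>\<sigma>\<close>.
\<close>

definition gr_action ::
    "('a, 'm) monoid_scheme \<Rightarrow> (nat \<Rightarrow> 'a set) \<Rightarrow> ('s \<Rightarrow> 'a \<Rightarrow> 'a) \<Rightarrow>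
      's set \<Rightarrow> (nat \<Rightarrow> 'a set) \<Rightarrow> (nat \<Rightarrow> 'a set)" where
  "gr_action H N \<phi> a =
    (\<lambda>x \<in> carrier (gr H N). \<lambda>s \<in> {1..}. N (Suc s) <#>\<^bsub>H\<^esub> {\<phi> \<sigma> h | \<sigma> h. \<sigma> \<in> a \<and> h \<in> x s})"


section \<open>Johnson filtrations and Torelli groups\<close>

definition johnson :: "('a, 'm) monoid_scheme \<Rightarrow> nat \<Rightarrow> ('a \<Rightarrow> 'a) set" where
  "johnson G s = {\<alpha> \<in> carrier (AutoGroup G).
    \<forall>x \<in> carrier G. \<alpha> x \<otimes>\<^bsub>G\<^esub> inv\<^bsub>G\<^esub> x \<in> lcs G (Suc s)}"

definition torelli :: "('a, 'm) monoid_scheme \<Rightarrow> ('a \<Rightarrow> 'a) monoid" where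
  "torelli G = (AutoGroup G)\<lparr>carrier := johnson G 1\<rparr>"

definition Ad :: "('a, 'm) monoid_scheme \<Rightarrow> 'a \<Rightarrow> 'a \<Rightarrow> 'a" where
  "Ad G x = (\<lambda>y \<in> carrier G. x \<otimes>\<^bsub>G\<^esub> y \<otimes>\<^bsub>G\<^esub> inv\<^bsub>G\<^esub> x)"

definition Inn :: "('a, 'm) monoid_scheme \<Rightarrow> ('a \<Rightarrow> 'a) set" where
  "Inn G = Ad G ` carrier G"

definition Out :: "('a, 'm) monoid_scheme \<Rightarrow> ('a \<Rightarrow> 'a) set monoid" where
  "Out G = AutoGroup G Mod Inn G"

definition out_proj :: "('a, 'm) monoid_scheme \<Rightarrow> ('a \<Rightarrow> 'a) \<Rightarrow> ('a \<Rightarrow> 'a) set" where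
  "out_proj G \<alpha> = Inn G #>\<^bsub>AutoGroup G\<^esub> \<alpha>"

definition outer_johnson :: "('a, 'm) monoid_scheme \<Rightarrow> nat \<Rightarrow> ('a \<Rightarrow> 'a) set set" where
  "outer_johnson G s = out_proj G ` johnson G s"

definition outer_torelli :: "('a, 'm) monoid_scheme \<Rightarrow> ('a \<Rightarrow> 'a) set monoid" where
  "outer_torelli G = (Out G)\<lparr>carrier := outer_johnson G 1\<rparr>"

text \<open>The group \<open>\<A>(G) = F\<^sup>0 / F\<^sup>1\<close>.\<close>

definition autA :: "('a, 'm) monoid_scheme \<Rightarrow> ('a \<Rightarrow> 'a) set monoid" where
  "autA G = gr_piece (AutoGroup G) (johnson G) 0"

definition conj_aut ::
    "('a, 'm) monoid_scheme \<Rightarrow> ('a \<Rightarrow> 'a) \<Rightarrow> ('a \<Rightarrow> 'a) \<Rightarrow> ('a \<Rightarrow> 'a)" where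
  "conj_aut G \<sigma> \<alpha> = \<sigma> \<otimes>\<^bsub>AutoGroup G\<^esub> \<alpha> \<otimes>\<^bsub>AutoGroup G\<^esub> inv\<^bsub>AutoGroup G\<^esub> \<sigma>"

definition conj_out ::
    "('a, 'm) monoid_scheme \<Rightarrow> ('a \<Rightarrow> 'a) \<Rightarrow> ('a \<Rightarrow> 'a) set \<Rightarrow> ('a \<Rightarrow> 'a) set" where
  "conj_out G \<sigma> \<beta> = out_proj G \<sigma> \<otimes>\<^bsub>Out G\<^esub> \<beta> \<otimes>\<^bsub>Out G\<^esub> inv\<^bsub>Out G\<^esub> (out_proj G \<sigma>)"

end

theory Submission
  imports Defs
begin

text \<open>
  All five graded objects come from filtrations \<open>N\<close> with \<open>[N\<^sub>s, N\<^sub>t] \<subseteq> N\<^sub>s\<^sub>+\<^sub>t\<close>, for which the graded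
  quotient is a Lie algebra (Jacobi is the Hall--Witt identity) and is functorial in filtered
  homomorphisms; automorphisms in \<open>F\<^sup>1\<close> act trivially on each quotient. For the Johnson filtration
  the point is that \<open>\<alpha> \<in> F\<^sup>s\<close> moves \<open>\<Gamma>\<^sup>k\<close> only by elements of \<open>\<Gamma>\<^sup>s\<^sup>+\<^sup>k\<close>.

  Exactness of both rows rests on one fact: \<open>Ad\<^sub>x \<in> F\<^sup>s\<close> implies \<open>x \<in> \<Gamma>\<^sup>s\<close>. Indeed, if \<open>x \<in> \<Gamma>\<^sup>t\<close> and
  \<open>Ad\<^sub>x \<in> F\<^sup>t\<^sup>+\<^sup>1\<close>, then the class of \<open>x\<close> in degree \<open>t\<close> is central, hence zero, so \<open>x \<in> \<Gamma>\<^sup>t\<^sup>+\<^sup>1\<close>. This gives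
  injectivity, and it gives exactness in the middle because an \<open>\<alpha> = Ad\<^sub>x \<beta>\<close> of degree \<open>s\<close> with \<open>\<beta>\<close> of
  degree \<open>s + 1\<close> has \<open>Ad\<^sub>x \<in> F\<^sup>s\<close>.
\<close>

section \<open>Commutator calculus\<close>

text \<open>The operations in the statement are defined by saturating sets of representatives, so
  well-definedness is part of what has to be proved: each operation is first shown to return a
  single coset (\<open>set_mult_eq_gr_class\<close>) and is then evaluated on chosen
  representatives. Neither row is deduced from the other, since nothing is known about injectivity
  of \<open>\<iota>\<close>. What the rows share is that both filtrations of the Torelli group lie
  inside the Johnson filtration and receive \<open>lcs G\<close> under \<open>Ad G\<close>; so one
  test, recovering the degree of \<open>x\<close> from the Johnson degree of \<open>Ad G x\<close>,
  serves both. The two outer filtrations are images under \<open>out_proj G\<close> of the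
  filtrations upstairs (for the lower central series because the projection is onto), and inherit
  strong centrality, the action and surjectivity from them. The center hypothesis concerns the whole
  direct sum, so a class must be tested against homogeneous elements of every degree. This is why
  the displacement estimate is needed on every \<open>lcs G k\<close>, whereas the definition of
  \<open>johnson\<close> gives it on \<open>lcs G 1\<close> only.\<close>

context group
begin

text \<open>Together with \<open>m_assoc\<close>, \<open>inv_mult_group\<close> and the basic rules
  for inverses, these rules reduce words freely. The commutator identities below hold in free groups
  and are verified by reducing both sides.\<close>

lemma mult_inv_cancel_left [simp]:
  "\<lbrakk>x \<in> carrier G; y \<in> carrier G\<rbrakk> \<Longrightarrow> x \<otimes> (inv x \<otimes> y) = y"
  "\<lbrakk>x \<in> carrier G; y \<in> carrier G\<rbrakk> \<Longrightarrow> inv x \<otimes> (x \<otimes> y) = y"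
  by (simp_all flip: m_assoc)

lemma commutator_closed [simp, intro]:
  "\<lbrakk>x \<in> carrier G; y \<in> carrier G\<rbrakk> \<Longrightarrow> commutator G x y \<in> carrier G"
  by (simp add: commutator_def)

lemma inv_commutator:
  "\<lbrakk>x \<in> carrier G; y \<in> carrier G\<rbrakk> \<Longrightarrow> inv (commutator G x y) = commutator G y x"
  by (simp add: commutator_def inv_mult_group m_assoc)

lemma commutator_self: "x \<in> carrier G \<Longrightarrow> commutator G x x = \<one>"
  by (simp add: commutator_def m_assoc)

lemma commutator_one [simp]:
  "x \<in> carrier G \<Longrightarrow> commutator G x \<one> = \<one>"
  "x \<in> carrier G \<Longrightarrow> commutator G \<one> x = \<one>"
  by (simp_all add: commutator_def)

lemma conjugate_eq_commutator:
  "\<lbrakk>x \<in> carrier G; y \<in> carrier G\<rbrakk> \<Longrightarrow> x \<otimes> y \<otimes> inv x = commutator G x y \<otimes> y"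
  by (simp add: commutator_def m_assoc)

text \<open>The conjugate of \<open>commutator G y z\<close> by \<open>x\<close> that usually
  appears here is split into a nested commutator and a commutator. Every factor then has a definite
  filtration degree, and the nested one disappears in the graded quotient.\<close>

lemma commutator_mult_left:
  "\<lbrakk>x \<in> carrier G; y \<in> carrier G; z \<in> carrier G\<rbrakk> \<Longrightarrow>
    commutator G (x \<otimes> y) z
      = commutator G x (commutator G y z) \<otimes> commutator G y z \<otimes> commutator G x z"
  by (simp add: commutator_def inv_mult_group m_assoc)

lemma commutator_mult_right:
  "\<lbrakk>x \<in> carrier G; y \<in> carrier G; z \<in> carrier G\<rbrakk> \<Longrightarrow>
    commutator G x (y \<otimes> z)
      = commutator G x y \<otimes> commutator G y (commutator G x z) \<otimes> commutator G x z"
  by (simp add: commutator_def inv_mult_group m_assoc)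

lemma commutator_inv_right:
  "\<lbrakk>x \<in> carrier G; y \<in> carrier G\<rbrakk> \<Longrightarrow>
    commutator G x (inv y) = inv y \<otimes> inv (commutator G x y) \<otimes> inv (inv y)"
  by (simp add: commutator_def inv_mult_group m_assoc)

text \<open>In a graded piece the conjugates in the second entries may be replaced by the bare
  elements, which turns this into the Jacobi identity. \<open>lcs_commutator\<close> uses the exact
  form.\<close>

lemma hall_witt:
  "\<lbrakk>x \<in> carrier G; y \<in> carrier G; z \<in> carrier G\<rbrakk> \<Longrightarrow>
    commutator G (commutator G x y) (y \<otimes> z \<otimes> inv y)
      \<otimes> commutator G (commutator G y z) (z \<otimes> x \<otimes> inv z)
      \<otimes> commutator G (commutator G z x) (x \<otimes> y \<otimes> inv x) = \<one>"
  by (simp add: commutator_def inv_mult_group m_assoc)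

lemma commutator_consistent:
  "\<lbrakk>subgroup K G; x \<in> K; y \<in> K\<rbrakk> \<Longrightarrow> commutator (G\<lparr>carrier := K\<rparr>) x y = commutator G x y"
  by (simp add: commutator_def)

lemma commutator_hom:
  "\<lbrakk>group K; f \<in> hom G K; x \<in> carrier G; y \<in> carrier G\<rbrakk> \<Longrightarrow>
    f (commutator G x y) = commutator K (f x) (f y)"
  using group_hom.hom_inv[of G K f]
  by (simp add: commutator_def hom_mult group_hom_def group_hom_axioms_def)

end


section \<open>Strongly central filtrations and their graded pieces\<close>

text \<open>Index 0 carries no condition. This lets \<open>johnson G\<close> itself be such a
  filtration of \<open>torelli G\<close>, although its term 0 is all of
  \<open>auto G\<close>.\<close>

locale central_filtration = group H for H (structure) +
  fixes N :: "nat \<Rightarrow> 'a set"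
  assumes N_one: "N 1 = carrier H"
    and N_subgroup: "1 \<le> s \<Longrightarrow> subgroup (N s) H"
    and N_Suc_subset: "1 \<le> s \<Longrightarrow> N (Suc s) \<subseteq> N s"
    and N_commutator:
      "\<lbrakk>1 \<le> s; 1 \<le> t; x \<in> N s; y \<in> N t\<rbrakk> \<Longrightarrow> commutator H x y \<in> N (s + t)"

definition gr_class :: "('a, 'm) monoid_scheme \<Rightarrow> (nat \<Rightarrow> 'a set) \<Rightarrow> nat \<Rightarrow> 'a \<Rightarrow> 'a set" where
  "gr_class H N s x = N (Suc s) #>\<^bsub>H\<^esub> x"

lemma carrier_gr_piece: "carrier (gr_piece H N s) = gr_class H N s ` N s"
  by (simp add: gr_piece_def carrier_FactGroup gr_class_def[abs_def])

lemma one_gr_piece: "\<one>\<^bsub>gr_piece H N s\<^esub> = N (Suc s)"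
  by (simp add: gr_piece_def)

lemma mult_gr_piece: "C \<otimes>\<^bsub>gr_piece H N s\<^esub> D = C <#>\<^bsub>H\<^esub> D"
  by (simp add: gr_piece_def)

context central_filtration
begin

lemma N_closed: "\<lbrakk>1 \<le> s; x \<in> N s\<rbrakk> \<Longrightarrow> x \<in> carrier H"
  using subgroup.mem_carrier[OF N_subgroup] .

lemma N_antimono:
  assumes "1 \<le> s" "s \<le> t"
  shows "N t \<subseteq> N s"
  using assms(2)
proof (induction t rule: dec_induct)
  case (step n)
  then show ?case
    using N_Suc_subset[of n] assms(1) by auto
qed simp

lemma N_one_mem: "1 \<le> s \<Longrightarrow> \<one> \<in> N s"
  and N_mult: "\<lbrakk>1 \<le> s; x \<in> N s; y \<in> N s\<rbrakk> \<Longrightarrow> x \<otimes> y \<in> N s"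
  and N_inv: "\<lbrakk>1 \<le> s; x \<in> N s\<rbrakk> \<Longrightarrow> inv x \<in> N s"
  using N_subgroup[of s]
  by (simp_all add: subgroup.one_closed subgroup.m_closed subgroup.m_inv_closed)

text \<open>Normality comes from the commutator condition with one entry in degree 1, because
  \<open>N 1\<close> is the whole group.\<close>

lemma N_conjugate:
  assumes "1 \<le> s" "x \<in> carrier H" "y \<in> N s"
  shows "x \<otimes> y \<otimes> inv x \<in> N s"
proof -
  have "commutator H x y \<in> N s"
    using N_commutator[of 1 s x y] N_antimono[of s "1 + s"] assms N_one by auto
  then show ?thesis
    using assms by (simp add: conjugate_eq_commutator N_closed N_mult)
qed

lemma N_normal: "1 \<le> s \<Longrightarrow> N s \<lhd> H"
  by (simp add: normal_inv_iff N_subgroup N_conjugate)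

lemma N_normal_piece:
  assumes "1 \<le> s"
  shows "N (Suc s) \<lhd> H\<lparr>carrier := N s\<rparr>"
  using normal_Int_subgroup[OF N_subgroup[OF assms] N_normal[of "Suc s"]] N_Suc_subset[OF assms]
  by (simp add: Int_absorb1 Int_absorb2)

section \<open>Computing with cosets in a single graded piece\<close>

lemma gr_class_eq_iff:
  assumes "1 \<le> s" "x \<in> carrier H" "y \<in> carrier H"
  shows "gr_class H N s x = gr_class H N s y \<longleftrightarrow> x \<otimes> inv y \<in> N (Suc s)"
proof -
  interpret S: subgroup "N (Suc s)" H by (simp add: N_subgroup)
  show ?thesis
    using S.rcos_module[OF is_group assms(3,2)] rcos_self[OF assms(2) S.subgroup_axioms]
      repr_independence[of x "N (Suc s)" y] assms
    by (auto simp: gr_class_def S.subgroup_axioms)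
qed

lemma gr_class_eq_one_iff:
  assumes "1 \<le> s" "x \<in> carrier H"
  shows "gr_class H N s x = \<one>\<^bsub>gr_piece H N s\<^esub> \<longleftrightarrow> x \<in> N (Suc s)"
  using gr_class_eq_iff[OF assms one_closed] N_subgroup[of "Suc s"] assms(2)
  by (simp add: one_gr_piece gr_class_def coset_mult_one subgroup.subset)

lemma gr_class_trivial:
  "\<lbrakk>1 \<le> s; x \<in> N (Suc s)\<rbrakk> \<Longrightarrow> gr_class H N s x = \<one>\<^bsub>gr_piece H N s\<^esub>"
  using gr_class_eq_one_iff N_closed[of "Suc s"] by simp

lemma gr_class_one: "1 \<le> s \<Longrightarrow> gr_class H N s \<one> = \<one>\<^bsub>gr_piece H N s\<^esub>"
  by (simp add: gr_class_eq_one_iff N_one_mem)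

lemma mem_gr_class: "\<lbrakk>1 \<le> s; x \<in> carrier H\<rbrakk> \<Longrightarrow> x \<in> gr_class H N s x"
  by (simp add: gr_class_def rcos_self N_subgroup)

lemma mem_gr_classE:
  assumes "y \<in> gr_class H N s x"
  obtains n where "n \<in> N (Suc s)" "y = n \<otimes> x"
  using assms by (auto simp: gr_class_def r_coset_def)

lemma gr_class_mult:
  "\<lbrakk>1 \<le> s; x \<in> carrier H; y \<in> carrier H\<rbrakk> \<Longrightarrow>
    gr_class H N s x \<otimes>\<^bsub>gr_piece H N s\<^esub> gr_class H N s y = gr_class H N s (x \<otimes> y)"
  using normal.rcos_sum[OF N_normal[of "Suc s"]] by (simp add: mult_gr_piece gr_class_def)

lemma group_gr_piece: "1 \<le> s \<Longrightarrow> group (gr_piece H N s)"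
  by (simp add: gr_piece_def normal.factorgroup_is_group N_normal_piece)

lemma comm_group_gr_piece:
  assumes "1 \<le> s"
  shows "comm_group (gr_piece H N s)"
proof (rule group.group_comm_groupI[OF group_gr_piece[OF assms]])
  fix C D
  assume "C \<in> carrier (gr_piece H N s)" "D \<in> carrier (gr_piece H N s)"
  then obtain x y where xy: "x \<in> N s" "C = gr_class H N s x" "y \<in> N s" "D = gr_class H N s y"
    by (auto simp: carrier_gr_piece)
  have "commutator H x y \<in> N (Suc s)"
    using N_commutator[OF assms assms xy(1,3)] N_antimono[of "Suc s" "s + s"] assms by auto
  moreover have "x \<otimes> y \<otimes> inv (y \<otimes> x) = commutator H x y"
    using N_closed[OF assms] xy by (simp add: commutator_def inv_mult_group m_assoc)
  ultimately show "C \<otimes>\<^bsub>gr_piece H N s\<^esub> D = D \<otimes>\<^bsub>gr_piece H N s\<^esub> C"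
    using N_closed[OF assms] xy assms by (simp add: gr_class_mult gr_class_eq_iff)
qed

lemma gr_class_inv:
  assumes "1 \<le> s" "x \<in> N s"
  shows "inv\<^bsub>gr_piece H N s\<^esub> (gr_class H N s x) = gr_class H N s (inv x)"
  using assms N_closed[OF assms]
  by (intro group.inv_equality[OF group_gr_piece])
    (simp_all add: gr_class_mult gr_class_one carrier_gr_piece N_inv)

text \<open>The common tool for the bracket, the induced maps and the action: well-definedness means
  that all results of an operation on representatives lie in one coset, and one known result then
  names that coset.\<close>

lemma set_mult_eq_gr_class:
  assumes "1 \<le> s" "x \<in> A" "A \<subseteq> gr_class H N s x" "x \<in> carrier H"
  shows "N (Suc s) <#> A = gr_class H N s x"
proof
  interpret S: subgroup "N (Suc s)" H by (simp add: N_subgroup)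
  show "N (Suc s) <#> A \<subseteq> gr_class H N s x"
  proof
    fix y assume "y \<in> N (Suc s) <#> A"
    then obtain n z where y: "n \<in> N (Suc s)" "z \<in> A" "y = n \<otimes> z"
      by (auto simp: set_mult_def)
    then obtain m where "m \<in> N (Suc s)" "z = m \<otimes> x"
      using assms(3) by (blast elim: mem_gr_classE)
    with y assms(4) have "y = (n \<otimes> m) \<otimes> x" "n \<otimes> m \<in> N (Suc s)"
      by (simp_all add: m_assoc)
    then show "y \<in> gr_class H N s x"
      by (auto simp: gr_class_def r_coset_def)
  qed
  show "gr_class H N s x \<subseteq> N (Suc s) <#> A"
    using assms(2) by (auto simp: gr_class_def r_coset_def set_mult_def)
qed

text \<open>Well-definedness of the bracket. Replacing \<open>x\<close> by
  \<open>n \<otimes> x\<close> and \<open>y\<close> by \<open>m \<otimes> y\<close> brings in the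
  factors \<open>[n, y']\<close> and \<open>[x, m]\<close> of degree s + t + 1 and nested
  commutators of degrees 2s + t + 1 and s + 2t + 1, all trivial in the piece of degree s +
  t.\<close>

lemma commutator_cong:
  assumes st: "1 \<le> s" "1 \<le> t" and xy: "x \<in> N s" "y \<in> N t"
    and x': "x' \<in> gr_class H N s x" and y': "y' \<in> gr_class H N t y"
  shows "gr_class H N (s + t) (commutator H x' y') = gr_class H N (s + t) (commutator H x y)"
proof -
  obtain n where n: "n \<in> N (Suc s)" "x' = n \<otimes> x" using x' by (blast elim: mem_gr_classE)
  obtain m where m: "m \<in> N (Suc t)" "y' = m \<otimes> y" using y' by (blast elim: mem_gr_classE)
  have c: "n \<in> carrier H" "m \<in> carrier H" "x \<in> carrier H" "y \<in> carrier H"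
    using n m xy st N_closed[of "Suc s"] N_closed[of "Suc t"] N_closed[of s] N_closed[of t] by auto
  have ns: "n \<in> N s" and mt: "m \<in> N t" using n m N_Suc_subset st by blast+
  have y'N: "y' \<in> N t" using m mt xy st by (simp add: N_mult)
  have 1: "commutator H n (commutator H x y') \<in> N (Suc (s + t))"
    using N_commutator[of "Suc s" "s + t" n "commutator H x y'"] N_commutator[of s t x y'] n xy y'N st
      N_antimono[of "Suc (s + t)" "Suc s + (s + t)"] by auto
  have 2: "commutator H n y' \<in> N (Suc (s + t))"
    using N_commutator[of "Suc s" t n y'] n y'N st by auto
  have 3: "commutator H x m \<in> N (Suc (s + t))"
    using N_commutator[of s "Suc t" x m] m xy st by auto
  have 4: "commutator H m (commutator H x y) \<in> N (Suc (s + t))"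
    using N_commutator[of "Suc t" "s + t" m "commutator H x y"] N_commutator[of s t x y] m xy st
      N_antimono[of "Suc (s + t)" "Suc t + (s + t)"] by auto
  have one: "gr_class H N (s + t) z = \<one>\<^bsub>gr_piece H N (s + t)\<^esub>" if "z \<in> N (Suc (s + t))" for z
    using that st by (simp add: gr_class_trivial)
  interpret P: group "gr_piece H N (s + t)" using st by (simp add: group_gr_piece)
  have carr: "gr_class H N (s + t) (commutator H a b) \<in> carrier (gr_piece H N (s + t))"
    if "a \<in> N s" "b \<in> N t" for a b
    using that N_commutator st by (auto simp: carrier_gr_piece)
  have y'c: "y' \<in> carrier H" using y'N st by (simp add: N_closed)
  have "gr_class H N (s + t) (commutator H x' y')
    = gr_class H N (s + t) (commutator H x y')"
    using st c n y'c one[OF 1] one[OF 2] carr[OF xy(1) y'N]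
    by (simp add: commutator_mult_left flip: gr_class_mult)
  also have "\<dots> = gr_class H N (s + t) (commutator H x y)"
    using st c m one[OF 3] one[OF 4] carr[OF xy]
    by (simp add: commutator_mult_right flip: gr_class_mult)
  finally show ?thesis .
qed

lemma gr_bracket_class:
  assumes st: "1 \<le> s" "1 \<le> t" and xy: "x \<in> N s" "y \<in> N t"
  shows "gr_bracket H N s t (gr_class H N s x) (gr_class H N t y)
    = gr_class H N (s + t) (commutator H x y)"
  unfolding gr_bracket_def
proof (rule set_mult_eq_gr_class)
  have c: "x \<in> carrier H" "y \<in> carrier H"
    using xy st N_closed by auto
  show "1 \<le> s + t" "commutator H x y \<in> carrier H" using st c by auto
  show "commutator H x y \<in> {commutator H x' y' |x' y'.
      x' \<in> gr_class H N s x \<and> y' \<in> gr_class H N t y}"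
    using mem_gr_class st c by blast
  have "commutator H x' y' \<in> gr_class H N (s + t) (commutator H x y)"
    if "x' \<in> gr_class H N s x" "y' \<in> gr_class H N t y" for x' y'
  proof -
    have "x' \<in> carrier H" "y' \<in> carrier H"
      using that c N_closed[of "Suc s"] N_closed[of "Suc t"] by (auto elim!: mem_gr_classE)
    then have "commutator H x' y' \<in> gr_class H N (s + t) (commutator H x' y')"
      using st by (simp add: mem_gr_class)
    then show ?thesis
      using commutator_cong[OF st xy that] by simp
  qed
  then show "{commutator H x' y' |x' y'. x' \<in> gr_class H N s x \<and> y' \<in> gr_class H N t y}
      \<subseteq> gr_class H N (s + t) (commutator H x y)"
    by blast
qed

section \<open>Lie identities for brackets of homogeneous classes\<close>

lemma gr_pieceE:
  assumes "C \<in> carrier (gr_piece H N s)"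
  obtains x where "x \<in> N s" "C = gr_class H N s x"
  using assms by (auto simp: carrier_gr_piece)

lemma gr_bracket_closed:
  assumes "1 \<le> s" "1 \<le> t" "C \<in> carrier (gr_piece H N s)" "D \<in> carrier (gr_piece H N t)"
  shows "gr_bracket H N s t C D \<in> carrier (gr_piece H N (s + t))"
  using assms N_commutator
  by (auto elim!: gr_pieceE simp: gr_bracket_class carrier_gr_piece)

lemma gr_bracket_add_left:
  assumes st: "1 \<le> s" "1 \<le> t" and C: "C \<in> carrier (gr_piece H N s)"
    and C': "C' \<in> carrier (gr_piece H N s)" and D: "D \<in> carrier (gr_piece H N t)"
  shows "gr_bracket H N s t (C \<otimes>\<^bsub>gr_piece H N s\<^esub> C') D
    = gr_bracket H N s t C D \<otimes>\<^bsub>gr_piece H N (s + t)\<^esub> gr_bracket H N s t C' D"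
proof -
  obtain x x' y where x: "x \<in> N s" "C = gr_class H N s x"
    and x': "x' \<in> N s" "C' = gr_class H N s x'" and y: "y \<in> N t" "D = gr_class H N t y"
    using C C' D by (metis gr_pieceE)
  have c: "x \<in> carrier H" "x' \<in> carrier H" "y \<in> carrier H"
    using x x' y st N_closed by auto
  interpret P: comm_group "gr_piece H N (s + t)" using st by (simp add: comm_group_gr_piece)
  have "commutator H x (commutator H x' y) \<in> N (Suc (s + t))"
    using N_commutator[of s "s + t" x "commutator H x' y"] N_commutator[of s t x' y] x x' y st
      N_antimono[of "Suc (s + t)" "s + (s + t)"] by auto
  then have one: "gr_class H N (s + t) (commutator H x (commutator H x' y))
      = \<one>\<^bsub>gr_piece H N (s + t)\<^esub>"
    using st by (simp add: gr_class_trivial)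
  have carr: "gr_class H N (s + t) (commutator H a y) \<in> carrier (gr_piece H N (s + t))"
    if "a \<in> N s" for a
    using that N_commutator st y by (auto simp: carrier_gr_piece)
  show ?thesis
    using st x x' y c one carr[OF x(1)] carr[OF x'(1)]
    by (simp add: gr_class_mult[of s] gr_bracket_class N_mult commutator_mult_left P.m_comm
        flip: gr_class_mult[of "s + t"])
qed

lemma gr_bracket_antisym:
  assumes st: "1 \<le> s" "1 \<le> t"
    and C: "C \<in> carrier (gr_piece H N s)" and D: "D \<in> carrier (gr_piece H N t)"
  shows "gr_bracket H N s t C D \<otimes>\<^bsub>gr_piece H N (s + t)\<^esub> gr_bracket H N t s D C
    = \<one>\<^bsub>gr_piece H N (s + t)\<^esub>"
proof -
  obtain x y where x: "x \<in> N s" "C = gr_class H N s x" and y: "y \<in> N t" "D = gr_class H N t y"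
    using C D by (metis gr_pieceE)
  have c: "x \<in> carrier H" "y \<in> carrier H"
    using x y st N_closed by auto
  have "commutator H x y \<otimes> commutator H y x = \<one>"
    using c inv_commutator[of y x] by (simp flip: inv_commutator[of x y])
  then show ?thesis
    using x y c st gr_bracket_class[OF st(2,1) y(1) x(1)]
    by (simp add: gr_bracket_class gr_class_mult gr_class_one add.commute[of t s])
qed

lemma gr_bracket_self:
  assumes "1 \<le> s" "C \<in> carrier (gr_piece H N s)"
  shows "gr_bracket H N s s C C = \<one>\<^bsub>gr_piece H N (s + s)\<^esub>"
  using assms by (elim gr_pieceE) (simp add: gr_bracket_class commutator_self N_closed gr_class_one)

text \<open>Antisymmetry turns this into additivity on the left: the bracket is the inverse of the
  swapped one, and inversion is a homomorphism because the piece is abelian.\<close>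

lemma gr_bracket_add_right:
  assumes st: "1 \<le> s" "1 \<le> t" and C: "C \<in> carrier (gr_piece H N s)"
    and D: "D \<in> carrier (gr_piece H N t)" and D': "D' \<in> carrier (gr_piece H N t)"
  shows "gr_bracket H N s t C (D \<otimes>\<^bsub>gr_piece H N t\<^esub> D')
    = gr_bracket H N s t C D \<otimes>\<^bsub>gr_piece H N (s + t)\<^esub> gr_bracket H N s t C D'"
proof -
  interpret P: comm_group "gr_piece H N (s + t)" using st by (simp add: comm_group_gr_piece)
  interpret Pt: comm_group "gr_piece H N t" using st by (simp add: comm_group_gr_piece)
  have carr: "gr_bracket H N t s E C \<in> carrier (gr_piece H N (s + t))"
    "gr_bracket H N s t C E \<in> carrier (gr_piece H N (s + t))"
    "gr_bracket H N s t C E = inv\<^bsub>gr_piece H N (s + t)\<^esub> gr_bracket H N t s E C"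
    if "E \<in> carrier (gr_piece H N t)" for E
  proof -
    show 1: "gr_bracket H N t s E C \<in> carrier (gr_piece H N (s + t))"
      using gr_bracket_closed[OF st(2,1) that C] by (simp add: add.commute)
    show 2: "gr_bracket H N s t C E \<in> carrier (gr_piece H N (s + t))"
      using gr_bracket_closed[OF st C that] .
    show "gr_bracket H N s t C E = inv\<^bsub>gr_piece H N (s + t)\<^esub> gr_bracket H N t s E C"
      using P.inv_equality[OF gr_bracket_antisym[OF st C that] 1 2] by simp
  qed
  have "gr_bracket H N t s (D \<otimes>\<^bsub>gr_piece H N t\<^esub> D') C
      = gr_bracket H N t s D C \<otimes>\<^bsub>gr_piece H N (s + t)\<^esub> gr_bracket H N t s D' C"
    using gr_bracket_add_left[OF st(2,1) D D' C] by (simp add: add.commute[of t s])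
  then show ?thesis
    using carr(1,3) D D' by (simp add: P.inv_mult)
qed

lemma gr_bracket_one_left:
  "\<lbrakk>1 \<le> s; 1 \<le> t; C \<in> carrier (gr_piece H N t)\<rbrakk> \<Longrightarrow>
    gr_bracket H N s t \<one>\<^bsub>gr_piece H N s\<^esub> C = \<one>\<^bsub>gr_piece H N (s + t)\<^esub>"
  by (elim gr_pieceE)
    (simp add: gr_class_one[symmetric] gr_bracket_class N_one_mem N_closed del: One_nat_def)

lemma gr_bracket_one_right:
  "\<lbrakk>1 \<le> s; 1 \<le> t; C \<in> carrier (gr_piece H N s)\<rbrakk> \<Longrightarrow>
    gr_bracket H N s t C \<one>\<^bsub>gr_piece H N t\<^esub> = \<one>\<^bsub>gr_piece H N (s + t)\<^esub>"
  by (elim gr_pieceE)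
    (simp add: gr_class_one[symmetric] gr_bracket_class N_one_mem N_closed del: One_nat_def)

text \<open>The Hall-Witt identity read modulo degree r + s + t + 1: each of its three factors
  represents the inverse of one Jacobi term.\<close>

lemma gr_bracket_jacobi:
  assumes r: "1 \<le> r" "1 \<le> s" "1 \<le> t" and C: "C \<in> carrier (gr_piece H N r)"
    and D: "D \<in> carrier (gr_piece H N s)" and E: "E \<in> carrier (gr_piece H N t)"
  shows "gr_bracket H N r (s + t) C (gr_bracket H N s t D E)
    \<otimes>\<^bsub>gr_piece H N (r + s + t)\<^esub> gr_bracket H N s (t + r) D (gr_bracket H N t r E C)
    \<otimes>\<^bsub>gr_piece H N (r + s + t)\<^esub> gr_bracket H N t (r + s) E (gr_bracket H N r s C D)
    = \<one>\<^bsub>gr_piece H N (r + s + t)\<^esub>"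
proof -
  obtain x y z where x: "x \<in> N r" "C = gr_class H N r x" and y: "y \<in> N s" "D = gr_class H N s y"
    and z: "z \<in> N t" "E = gr_class H N t z"
    using C D E by (metis gr_pieceE)
  let ?P = "gr_piece H N (r + s + t)"
  interpret P: comm_group ?P using r by (simp add: comm_group_gr_piece)
  \<comment> \<open>One Hall-Witt factor, for degrees and elements that will be rotated cyclically.
    The conjugate of \<open>c\<close> by \<open>b\<close> has the class of \<open>c\<close>, because
    \<open>[b, c]\<close> lies in degree j + k > k; swapping the two entries of the outer commutator
    produces the inverse.\<close>
  have key: "gr_class H N (r + s + t) (commutator H (commutator H a b) (b \<otimes> c \<otimes> inv b))
      = inv\<^bsub>?P\<^esub> gr_bracket H N k (i + j) (gr_class H N k c)
        (gr_bracket H N i j (gr_class H N i a) (gr_class H N j b))"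
    "gr_bracket H N k (i + j) (gr_class H N k c)
        (gr_bracket H N i j (gr_class H N i a) (gr_class H N j b)) \<in> carrier ?P"
    if ijk: "1 \<le> i" "1 \<le> j" "1 \<le> k" "i + j + k = r + s + t"
      and abc: "a \<in> N i" "b \<in> N j" "c \<in> N k" for i j k a b c
  proof -
    have carr: "a \<in> carrier H" "b \<in> carrier H" "c \<in> carrier H"
      using abc ijk N_closed by auto
    have ab: "commutator H a b \<in> N (i + j)" using abc ijk by (simp add: N_commutator)
    have bc: "commutator H b c \<in> N (Suc k)"
      using N_commutator[of j k b c] N_antimono[of "Suc k" "j + k"] abc ijk by auto
    have "b \<otimes> c \<otimes> inv b \<in> gr_class H N k c"
      using bc carr by (auto simp: conjugate_eq_commutator gr_class_def r_coset_def)
    then have "gr_class H N (i + j + k) (commutator H (commutator H a b) (b \<otimes> c \<otimes> inv b))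
        = gr_class H N (i + j + k) (commutator H (commutator H a b) c)"
      using commutator_cong[of "i + j" k "commutator H a b" c "commutator H a b"]
        mem_gr_class[of "i + j" "commutator H a b"] ab abc ijk carr by simp
    also have "\<dots> = gr_class H N (i + j + k) (inv (commutator H c (commutator H a b)))"
      using carr by (simp add: inv_commutator)
    also have "\<dots> = inv\<^bsub>?P\<^esub> gr_class H N (r + s + t) (commutator H c (commutator H a b))"
      using N_commutator[of k "i + j" c "commutator H a b"] ab abc ijk
      by (simp add: gr_class_inv add.commute[of k])
    finally show "gr_class H N (r + s + t) (commutator H (commutator H a b) (b \<otimes> c \<otimes> inv b))
      = inv\<^bsub>?P\<^esub> gr_bracket H N k (i + j) (gr_class H N k c)
        (gr_bracket H N i j (gr_class H N i a) (gr_class H N j b))"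
      using ijk abc ab by (simp add: gr_bracket_class add.commute[of k])
    show "gr_bracket H N k (i + j) (gr_class H N k c)
        (gr_bracket H N i j (gr_class H N i a) (gr_class H N j b)) \<in> carrier ?P"
      using N_commutator[of k "i + j" c "commutator H a b"] ijk abc ab
      by (simp add: gr_bracket_class carrier_gr_piece add.commute[of k])
  qed
  have c: "x \<in> carrier H" "y \<in> carrier H" "z \<in> carrier H"
    using x y z r N_closed by auto
  have "gr_class H N (r + s + t) (commutator H (commutator H x y) (y \<otimes> z \<otimes> inv y)
      \<otimes> commutator H (commutator H y z) (z \<otimes> x \<otimes> inv z)
      \<otimes> commutator H (commutator H z x) (x \<otimes> y \<otimes> inv x)) = \<one>\<^bsub>?P\<^esub>"
    using c r by (simp add: hall_witt gr_class_one)
  then have *: "inv\<^bsub>?P\<^esub> gr_bracket H N t (r + s) E (gr_bracket H N r s C D)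
    \<otimes>\<^bsub>?P\<^esub> inv\<^bsub>?P\<^esub> gr_bracket H N r (s + t) C (gr_bracket H N s t D E)
    \<otimes>\<^bsub>?P\<^esub> inv\<^bsub>?P\<^esub> gr_bracket H N s (t + r) D (gr_bracket H N t r E C) = \<one>\<^bsub>?P\<^esub>"
    using c r x y z key(1)[of r s t x y z] key(1)[of s t r y z x] key(1)[of t r s z x y]
    by (simp flip: gr_class_mult)
  have carr: "gr_bracket H N t (r + s) E (gr_bracket H N r s C D) \<in> carrier ?P"
    "gr_bracket H N r (s + t) C (gr_bracket H N s t D E) \<in> carrier ?P"
    "gr_bracket H N s (t + r) D (gr_bracket H N t r E C) \<in> carrier ?P"
    using r x y z key(2)[of r s t x y z] key(2)[of s t r y z x] key(2)[of t r s z x y]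
    by simp_all
  \<comment> \<open>The three inverse terms come out in the order in which Hall-Witt lists them;
    commutativity of the piece reorders them into the inverse of the Jacobi sum.\<close>
  have "inv\<^bsub>?P\<^esub> (gr_bracket H N r (s + t) C (gr_bracket H N s t D E)
    \<otimes>\<^bsub>?P\<^esub> gr_bracket H N s (t + r) D (gr_bracket H N t r E C)
    \<otimes>\<^bsub>?P\<^esub> gr_bracket H N t (r + s) E (gr_bracket H N r s C D)) = \<one>\<^bsub>?P\<^esub>"
    using * carr by (simp add: P.inv_mult P.m_ac)
  then show ?thesis
    using carr by (subst (asm) P.inv_eq_1_iff) simp_all
qed

end

section \<open>The graded Lie algebra of a strongly central filtration\<close>

lemma gr_simps:
  "\<one>\<^bsub>gr H N\<^esub> = (\<lambda>s\<in>{1..}. \<one>\<^bsub>gr_piece H N s\<^esub>)"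
  "x \<otimes>\<^bsub>gr H N\<^esub> y = (\<lambda>s\<in>{1..}. x s \<otimes>\<^bsub>gr_piece H N s\<^esub> y s)"
  by (simp_all add: gr_def)

lemma bracket_gr_apply:
  "1 \<le> n \<Longrightarrow> bracket (gr H N) x y n
    = finprod (gr_piece H N n) (\<lambda>s. gr_bracket H N s (n - s) (x s) (y (n - s))) {1..<n}"
  by (simp add: gr_def)

lemma homog_gr:
  "homog (gr H N) s
    = {x \<in> carrier (gr H N). \<forall>t\<ge>1. t \<noteq> s \<longrightarrow> x t = \<one>\<^bsub>gr_piece H N t\<^esub>}"
  by (simp add: gr_def)

declare One_nat_def [simp del]

text \<open>The inclusion of the piece of degree s into the direct sum. The restriction to positive
  degrees is there because the elements of \<open>sum_group\<close> are extensional
  functions.\<close>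

definition gr_homog ::
    "('a, 'm) monoid_scheme \<Rightarrow> (nat \<Rightarrow> 'a set) \<Rightarrow> nat \<Rightarrow> 'a set \<Rightarrow> nat \<Rightarrow> 'a set" where
  "gr_homog H N s C = (\<lambda>t\<in>{1..}. if t = s then C else \<one>\<^bsub>gr_piece H N t\<^esub>)"

context central_filtration
begin

section \<open>The direct sum as a group of finitely supported families\<close>

lemma gr_piece_one_closed: "1 \<le> s \<Longrightarrow> \<one>\<^bsub>gr_piece H N s\<^esub> \<in> carrier (gr_piece H N s)"
  by (simp add: group_gr_piece group.is_monoid)

lemma carrier_gr:
  "carrier (gr H N) = {x \<in> \<Pi>\<^sub>E s\<in>{1..}. carrier (gr_piece H N s).
    finite {s \<in> {1..}. x s \<noteq> \<one>\<^bsub>gr_piece H N s\<^esub>}}"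
proof -
  have "group (gr_piece H N s)" if "s \<in> {1..}" for s
    using that by (simp add: group_gr_piece)
  then show ?thesis
    unfolding gr_def by (simp only: carrier_sum_group partial_object.simps)
qed

lemma gr_mem: "\<lbrakk>x \<in> carrier (gr H N); 1 \<le> s\<rbrakk> \<Longrightarrow> x s \<in> carrier (gr_piece H N s)"
  by (auto simp: carrier_gr)

lemma gr_eqI:
  "\<lbrakk>x \<in> carrier (gr H N); y \<in> carrier (gr H N); \<And>s. 1 \<le> s \<Longrightarrow> x s = y s\<rbrakk> \<Longrightarrow> x = y"
  unfolding carrier_gr by (auto intro: PiE_ext)

lemma comm_group_gr: "comm_group (gr H N)"
proof (rule group.group_comm_groupI)
  have "group (sum_group {1..} (gr_piece H N))"
    by (rule sum_group) (simp add: group_gr_piece)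
  then show "group (gr H N)"
    by (simp add: gr_def group_def monoid_def group_axioms_def Units_def)
  show "x \<otimes>\<^bsub>gr H N\<^esub> y = y \<otimes>\<^bsub>gr H N\<^esub> x"
    if "x \<in> carrier (gr H N)" "y \<in> carrier (gr H N)" for x y
    unfolding gr_simps using gr_mem[OF that(1)] gr_mem[OF that(2)]
    by (intro restrict_ext comm_groupE(4)[OF comm_group_gr_piece]) simp_all
qed

interpretation gr: comm_group "gr H N"
  by (rule comm_group_gr)

lemma finprod_gr_apply:
  assumes "finite A" "f \<in> A \<rightarrow> carrier (gr H N)" "1 \<le> t"
  shows "finprod (gr H N) f A t = finprod (gr_piece H N t) (\<lambda>s. f s t) A"
proof -
  interpret P: comm_group "gr_piece H N t" by (simp add: comm_group_gr_piece assms)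
  show ?thesis
    using assms(1,2)
  proof (induction A rule: finite_induct)
    case empty
    then show ?case using assms(3) by (simp add: gr_simps)
  next
    case (insert a A)
    then have "f \<in> A \<rightarrow> carrier (gr H N)" "f a \<in> carrier (gr H N)" by auto
    moreover from this have "(\<lambda>s. f s t) \<in> A \<rightarrow> carrier (gr_piece H N t)"
      "f a t \<in> carrier (gr_piece H N t)"
      using gr_mem[OF _ assms(3)] by (auto simp: Pi_iff)
    ultimately show ?case
      using insert assms(3) by (simp add: gr_simps)
  qed
qed

lemma gr_homog_apply:
  "1 \<le> t \<Longrightarrow> gr_homog H N s C t = (if t = s then C else \<one>\<^bsub>gr_piece H N t\<^esub>)"
  by (simp add: gr_homog_def)

lemma gr_homog_mem:
  assumes "1 \<le> s" "C \<in> carrier (gr_piece H N s)"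
  shows "gr_homog H N s C \<in> homog (gr H N) s"
proof -
  have "{t \<in> {1..}. gr_homog H N s C t \<noteq> \<one>\<^bsub>gr_piece H N t\<^esub>} \<subseteq> {s}"
    by (auto simp: gr_homog_apply split: if_splits)
  then have "finite {t \<in> {1..}. gr_homog H N s C t \<noteq> \<one>\<^bsub>gr_piece H N t\<^esub>}"
    using finite_subset by blast
  then show ?thesis
    using assms gr_piece_one_closed by (auto simp: homog_gr carrier_gr gr_homog_def)
qed

lemma homog_closed: "x \<in> homog (gr H N) s \<Longrightarrow> x \<in> carrier (gr H N)"
  by (simp add: homog_gr)

lemma gr_homog_closed:
  "\<lbrakk>1 \<le> s; C \<in> carrier (gr_piece H N s)\<rbrakk> \<Longrightarrow> gr_homog H N s C \<in> carrier (gr H N)"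
  using gr_homog_mem homog_closed by blast

lemma homog_eq_gr_homog:
  assumes "1 \<le> s" "x \<in> homog (gr H N) s"
  shows "x = gr_homog H N s (x s)"
proof (rule gr_eqI)
  show x: "x \<in> carrier (gr H N)" using assms(2) by (rule homog_closed)
  show "gr_homog H N s (x s) \<in> carrier (gr H N)"
    using assms(1) gr_mem[OF x assms(1)] by (rule gr_homog_closed)
  show "x t = gr_homog H N s (x s) t" if "1 \<le> t" for t
    using that assms(2) by (simp add: gr_homog_apply homog_gr)
qed

lemma gr_homog_one: "gr_homog H N s \<one>\<^bsub>gr_piece H N s\<^esub> = \<one>\<^bsub>gr H N\<^esub>"
  unfolding gr_homog_def gr_simps by (rule restrict_ext) simp

lemma homog_subgroup_gr:
  assumes "1 \<le> s"
  shows "subgroup (homog (gr H N) s) (gr H N)"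
proof (rule gr.subgroupI)
  show "homog (gr H N) s \<subseteq> carrier (gr H N)" by (auto simp: homog_gr)
  show "homog (gr H N) s \<noteq> {}"
    using gr_homog_mem[OF assms gr_piece_one_closed[OF assms]] by auto
  fix x y assume x: "x \<in> homog (gr H N) s" and y: "y \<in> homog (gr H N) s"
  show "x \<otimes>\<^bsub>gr H N\<^esub> y \<in> homog (gr H N) s"
    using x y gr.m_closed[of x y] group.is_monoid[OF group_gr_piece]
    by (auto simp: homog_gr gr_simps monoid.l_one gr_piece_one_closed)
  have "(inv\<^bsub>gr H N\<^esub> x) t = \<one>\<^bsub>gr_piece H N t\<^esub>" if t: "1 \<le> t" "t \<noteq> s" for t
  proof -
    interpret P: comm_group "gr_piece H N t" by (simp add: comm_group_gr_piece t)
    have "(inv\<^bsub>gr H N\<^esub> x) t = (inv\<^bsub>gr H N\<^esub> x) t \<otimes>\<^bsub>gr_piece H N t\<^esub> x t"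
      using x t gr_mem[of "inv\<^bsub>gr H N\<^esub> x" t] by (simp add: homog_gr)
    also have "\<dots> = (inv\<^bsub>gr H N\<^esub> x \<otimes>\<^bsub>gr H N\<^esub> x) t"
      using t by (simp add: gr_simps)
    also have "\<dots> = \<one>\<^bsub>gr_piece H N t\<^esub>"
      using t x by (simp only: gr.l_inv homog_closed) (simp add: gr_simps)
    finally show ?thesis .
  qed
  then show "inv\<^bsub>gr H N\<^esub> x \<in> homog (gr H N) s"
    using x by (simp add: homog_gr)
qed

text \<open>Evaluation in degree t kills every summand except the one with index t. Assumption
  \<open>out\<close> covers t outside \<open>A\<close>, where both sides are trivial.\<close>

lemma finprod_homog_apply:
  assumes x: "\<And>s. 1 \<le> s \<Longrightarrow> x s \<in> homog (gr H N) s" and A: "finite A" "A \<subseteq> {1..}"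
    and out: "\<And>s. \<lbrakk>1 \<le> s; s \<notin> A\<rbrakk> \<Longrightarrow> x s = \<one>\<^bsub>gr H N\<^esub>" and t: "1 \<le> t"
  shows "finprod (gr H N) x A t = x t t"
proof -
  interpret P: comm_group "gr_piece H N t" by (simp add: comm_group_gr_piece t)
  have xA: "x \<in> A \<rightarrow> carrier (gr H N)" using x A homog_closed by blast
  have "finprod (gr H N) x A t = finprod (gr_piece H N t) (\<lambda>s. x s t) A"
    using finprod_gr_apply[OF A(1) xA t] .
  also have "\<dots> = finprod (gr_piece H N t) (\<lambda>s. if t = s then x s t else \<one>\<^bsub>gr_piece H N t\<^esub>) A"
    using A x t gr_mem[OF homog_closed[OF x] t]
    by (intro P.finprod_cong') (auto simp: homog_gr Pi_iff)
  also have "\<dots> = x t t"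
  proof (cases "t \<in> A")
    case True
    then show ?thesis
      using A gr_mem[OF homog_closed[OF x] t] by (intro P.finprod_singleton) auto
  next
    case False
    then have "finprod (gr_piece H N t) (\<lambda>s. if t = s then x s t else \<one>\<^bsub>gr_piece H N t\<^esub>) A
        = \<one>\<^bsub>gr_piece H N t\<^esub>"
      by (intro P.finprod_one_eqI) auto
    then show ?thesis using False out[OF t] t by (simp add: gr_simps)
  qed
  finally show ?thesis .
qed

lemma gr_eq_finprod:
  assumes x: "x \<in> carrier (gr H N)"
  defines "A \<equiv> {s \<in> {1..}. x s \<noteq> \<one>\<^bsub>gr_piece H N s\<^esub>}"
  shows "finite A" "x = finprod (gr H N) (\<lambda>s. gr_homog H N s (x s)) A"
proof -
  show fin: "finite A" using x by (simp add: A_def carrier_gr)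
  have A: "A \<subseteq> {1..}" by (auto simp: A_def)
  have "gr_homog H N s (x s) \<in> homog (gr H N) s" if "1 \<le> s" for s
    using that x by (simp add: gr_homog_mem gr_mem)
  then have "finprod (gr H N) (\<lambda>s. gr_homog H N s (x s)) A t = x t" if "1 \<le> t" for t
    using finprod_homog_apply[of "\<lambda>s. gr_homog H N s (x s)", OF _ fin A _ that] that
    by (auto simp: A_def gr_homog_one gr_homog_apply)
  moreover have "finprod (gr H N) (\<lambda>s. gr_homog H N s (x s)) A \<in> carrier (gr H N)"
    using x by (auto simp: A_def gr_homog_closed gr_mem)
  ultimately show "x = finprod (gr H N) (\<lambda>s. gr_homog H N s (x s)) A"
    using x by (intro gr_eqI) simp_all
qed

text \<open>Finite support makes homogeneous elements generate the direct sum, so a statement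
  additive in an argument can be checked for homogeneous values of it. Antisymmetry, the alternating
  law, the Jacobi identity and the later test for centrality are all reduced in this way.\<close>

lemma gr_induct [consumes 1, case_names one mult]:
  assumes x: "x \<in> carrier (gr H N)" and one: "P \<one>\<^bsub>gr H N\<^esub>"
    and mult: "\<And>x s C. \<lbrakk>x \<in> carrier (gr H N); 1 \<le> s; C \<in> carrier (gr_piece H N s); P x\<rbrakk> \<Longrightarrow>
      P (x \<otimes>\<^bsub>gr H N\<^esub> gr_homog H N s C)"
  shows "P x"
proof -
  let ?f = "\<lambda>s. gr_homog H N s (x s)"
  have "P (finprod (gr H N) ?f A)" if "finite A" "A \<subseteq> {1..}" for A
    using that
  proof (induction A rule: finite_induct)
    case empty
    then show ?case by (simp add: one)
  next
    case (insert a A)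
    then have f: "?f \<in> A \<rightarrow> carrier (gr H N)" "?f a \<in> carrier (gr H N)"
      using x by (auto simp: gr_homog_closed gr_mem)
    then show ?case
      using insert x by (simp add: gr.m_comm[of "?f a"] mult gr_mem)
  qed
  then show ?thesis
    using gr_eq_finprod[OF x] by (metis (no_types, lifting) mem_Collect_eq subsetI)
qed

text \<open>An element of the outer direct sum assigns to each degree t a family concentrated in
  degree t, so the degree t component of its sum is the diagonal entry \<open>x t t\<close>.
  Multiplicativity and bijectivity are read off from this formula; the preimage of \<open>y\<close>
  is its family of homogeneous parts.\<close>

lemma homog_direct_sum_gr:
  "(\<lambda>x. finprod (gr H N) x {s \<in> {1..}. x s \<noteq> \<one>\<^bsub>gr H N\<^esub>})
    \<in> iso (sum_group {1..} (\<lambda>s. (gr H N)\<lparr>carrier := homog (gr H N) s\<rparr>)) (gr H N)"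
proof -
  let ?S = "sum_group {1..} (\<lambda>s. (gr H N)\<lparr>carrier := homog (gr H N) s\<rparr>)"
  let ?f = "\<lambda>x. finprod (gr H N) x {s \<in> {1..}. x s \<noteq> \<one>\<^bsub>gr H N\<^esub>}"
  have grp: "group ((gr H N)\<lparr>carrier := homog (gr H N) s\<rparr>)" if "s \<in> {1..}" for s
    using subgroup.subgroup_is_group[OF homog_subgroup_gr gr.is_group] that by simp
  have carr: "carrier ?S = {x \<in> \<Pi>\<^sub>E s\<in>{1..}. homog (gr H N) s.
      finite {s \<in> {1..}. x s \<noteq> \<one>\<^bsub>gr H N\<^esub>}}"
    by (subst carrier_sum_group) (use grp in simp_all)
  have app: "?f x t = x t t" if "x \<in> carrier ?S" "1 \<le> t" for x t
    using that by (intro finprod_homog_apply) (auto simp: carr)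
  have clos: "?f x \<in> carrier (gr H N)" if "x \<in> carrier ?S" for x
    using that homog_closed by (auto simp: carr intro!: gr.finprod_closed)
  interpret S: group ?S by (rule sum_group) (rule grp)
  show ?thesis
  proof (rule isoI)
    show "?f \<in> hom ?S (gr H N)"
    proof (rule homI)
      fix x y assume xy: "x \<in> carrier ?S" "y \<in> carrier ?S"
      show "?f (x \<otimes>\<^bsub>?S\<^esub> y) = ?f x \<otimes>\<^bsub>gr H N\<^esub> ?f y"
      proof (rule gr_eqI)
        fix t :: nat assume t: "1 \<le> t"
        have "?f (x \<otimes>\<^bsub>?S\<^esub> y) t = (x \<otimes>\<^bsub>?S\<^esub> y) t t"
          using app S.m_closed[OF xy] t by blast
        also have "\<dots> = x t t \<otimes>\<^bsub>gr_piece H N t\<^esub> y t t"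
          using t by (simp add: gr_simps)
        also have "\<dots> = (?f x \<otimes>\<^bsub>gr H N\<^esub> ?f y) t"
          unfolding gr_simps(2) using t app[OF xy(1) t] app[OF xy(2) t] by simp
        finally show "?f (x \<otimes>\<^bsub>?S\<^esub> y) t = (?f x \<otimes>\<^bsub>gr H N\<^esub> ?f y) t" .
      qed (use clos xy S.m_closed in \<open>blast intro: gr.m_closed\<close>)+
    qed (rule clos)
    have "inj_on ?f (carrier ?S)"
    proof (rule inj_onI)
      fix x y assume x: "x \<in> carrier ?S" and y: "y \<in> carrier ?S" and eq: "?f x = ?f y"
      have "x t = y t" if "t \<in> {1..}" for t
      proof -
        have t: "1 \<le> t" using that by simp
        have "x t t = y t t" using app[OF x t] app[OF y t] eq by simp
        moreover have "x t = gr_homog H N t (x t t)" "y t = gr_homog H N t (y t t)"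
          using x y t homog_eq_gr_homog by (auto simp: carr)
        ultimately show ?thesis by simp
      qed
      then show "x = y"
        using x y unfolding carr by (auto intro: PiE_ext)
    qed
    moreover have "carrier (gr H N) \<subseteq> ?f ` carrier ?S"
    proof
      fix y assume y: "y \<in> carrier (gr H N)"
      define x where "x = (\<lambda>s\<in>{1..}. gr_homog H N s (y s))"
      have "{s \<in> {1..}. x s \<noteq> \<one>\<^bsub>gr H N\<^esub>} \<subseteq> {s \<in> {1..}. y s \<noteq> \<one>\<^bsub>gr_piece H N s\<^esub>}"
        by (auto simp: x_def gr_homog_one)
      then have "finite {s \<in> {1..}. x s \<noteq> \<one>\<^bsub>gr H N\<^esub>}"
        using gr_eq_finprod(1)[OF y] finite_subset by blast
      then have x: "x \<in> carrier ?S"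
        using y by (auto simp: carr x_def gr_homog_mem gr_mem)
      have "?f x = y"
        using app[OF x] by (intro gr_eqI clos x y) (simp add: x_def gr_homog_apply)
      then show "y \<in> ?f ` carrier ?S" using x by blast
    qed
    ultimately show "bij_betw ?f (carrier ?S) (carrier (gr H N))"
      using clos by (auto simp: bij_betw_def)
  qed
qed

section \<open>The bracket on the direct sum\<close>

lemma gr_bracket_summand_closed:
  assumes "x \<in> carrier (gr H N)" "y \<in> carrier (gr H N)" "s \<in> {1..<n}"
  shows "gr_bracket H N s (n - s) (x s) (y (n - s)) \<in> carrier (gr_piece H N n)"
proof -
  have "1 \<le> s" "1 \<le> n - s" "s + (n - s) = n" using assms(3) by auto
  then show ?thesis
    using gr_bracket_closed[of s "n - s" "x s" "y (n - s)"] assms(1,2) gr_mem by simp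
qed

text \<open>The point is finite support: a degree n in which the bracket is nontrivial must be the
  sum of a degree in the support of \<open>x\<close> and one in the support of \<open>y\<close>, so
  the support lies in the image of a finite product.\<close>

lemma bracket_gr_closed:
  assumes x: "x \<in> carrier (gr H N)" and y: "y \<in> carrier (gr H N)"
  shows "bracket (gr H N) x y \<in> carrier (gr H N)"
proof -
  let ?supp = "\<lambda>x. {s \<in> {1..}. x s \<noteq> \<one>\<^bsub>gr_piece H N s\<^esub>}"
  have "bracket (gr H N) x y n = \<one>\<^bsub>gr_piece H N n\<^esub>"
    if n: "1 \<le> n" "n \<notin> (\<lambda>(s, t). s + t) ` (?supp x \<times> ?supp y)" for n
  proof -
    interpret P: comm_group "gr_piece H N n" by (simp add: comm_group_gr_piece n)
    have "gr_bracket H N s (n - s) (x s) (y (n - s)) = \<one>\<^bsub>gr_piece H N n\<^esub>" if s: "s \<in> {1..<n}" for s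
    proof -
      have "s \<notin> ?supp x \<or> n - s \<notin> ?supp y"
      proof (rule ccontr)
        assume "\<not> ?thesis"
        then have "(s, n - s) \<in> ?supp x \<times> ?supp y" by blast
        then have "s + (n - s) \<in> (\<lambda>(s, t). s + t) ` (?supp x \<times> ?supp y)" by force
        with n(2) s show False by simp
      qed
      then show ?thesis
        using gr_bracket_one_left[of s "n - s" "y (n - s)"] gr_bracket_one_right[of s "n - s" "x s"]
          gr_mem[OF x] gr_mem[OF y] s by auto
    qed
    then show ?thesis unfolding bracket_gr_apply[OF n(1)] by (rule P.finprod_one_eqI)
  qed
  then have "?supp (bracket (gr H N) x y) \<subseteq> (\<lambda>(s, t). s + t) ` (?supp x \<times> ?supp y)"
    by auto
  then have "finite (?supp (bracket (gr H N) x y))"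
    by (rule finite_subset) (use x y in \<open>simp add: carrier_gr\<close>)
  moreover have "bracket (gr H N) x y \<in> extensional {1..}"
    by (simp add: gr_def)
  moreover have "bracket (gr H N) x y n \<in> carrier (gr_piece H N n)" if "1 \<le> n" for n
  proof -
    interpret P: comm_group "gr_piece H N n" by (simp add: comm_group_gr_piece that)
    show ?thesis
      unfolding bracket_gr_apply[OF that]
      using gr_bracket_summand_closed[OF x y] by (intro P.finprod_closed) simp
  qed
  ultimately show ?thesis by (auto simp: carrier_gr PiE_iff)
qed

lemma bracket_gr_add_left:
  assumes x: "x \<in> carrier (gr H N)" "x' \<in> carrier (gr H N)" and y: "y \<in> carrier (gr H N)"
  shows "bracket (gr H N) (x \<otimes>\<^bsub>gr H N\<^esub> x') y
    = bracket (gr H N) x y \<otimes>\<^bsub>gr H N\<^esub> bracket (gr H N) x' y"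
proof (rule gr_eqI)
  fix n :: nat assume n: "1 \<le> n"
  interpret P: comm_group "gr_piece H N n" by (simp add: comm_group_gr_piece n)
  have "gr_bracket H N s (n - s) ((x \<otimes>\<^bsub>gr H N\<^esub> x') s) (y (n - s))
      = gr_bracket H N s (n - s) (x s) (y (n - s))
        \<otimes>\<^bsub>gr_piece H N n\<^esub> gr_bracket H N s (n - s) (x' s) (y (n - s))"
    if "s \<in> {1..<n}" for s
  proof -
    have "1 \<le> s" "1 \<le> n - s" "s + (n - s) = n" using that by auto
    then show ?thesis
      using gr_bracket_add_left[of s "n - s" "x s" "x' s" "y (n - s)"]
        gr_mem[OF x(1)] gr_mem[OF x(2)] gr_mem[OF y] by (simp add: gr_simps)
  qed
  then have "bracket (gr H N) (x \<otimes>\<^bsub>gr H N\<^esub> x') y n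
    = finprod (gr_piece H N n) (\<lambda>s. gr_bracket H N s (n - s) (x s) (y (n - s))
        \<otimes>\<^bsub>gr_piece H N n\<^esub> gr_bracket H N s (n - s) (x' s) (y (n - s))) {1..<n}"
    unfolding bracket_gr_apply[OF n] using gr_bracket_summand_closed x y
    by (intro P.finprod_cong') (auto intro: P.m_closed)
  also have "\<dots> = (bracket (gr H N) x y \<otimes>\<^bsub>gr H N\<^esub> bracket (gr H N) x' y) n"
    using n gr_bracket_summand_closed x y
    by (subst P.finprod_multf) (auto simp: gr_simps bracket_gr_apply)
  finally show "bracket (gr H N) (x \<otimes>\<^bsub>gr H N\<^esub> x') y n
    = (bracket (gr H N) x y \<otimes>\<^bsub>gr H N\<^esub> bracket (gr H N) x' y) n" .
qed (simp_all add: bracket_gr_closed x y)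

lemma bracket_gr_add_right:
  assumes x: "x \<in> carrier (gr H N)" and y: "y \<in> carrier (gr H N)" "y' \<in> carrier (gr H N)"
  shows "bracket (gr H N) x (y \<otimes>\<^bsub>gr H N\<^esub> y')
    = bracket (gr H N) x y \<otimes>\<^bsub>gr H N\<^esub> bracket (gr H N) x y'"
proof (rule gr_eqI)
  fix n :: nat assume n: "1 \<le> n"
  interpret P: comm_group "gr_piece H N n" by (simp add: comm_group_gr_piece n)
  have "gr_bracket H N s (n - s) (x s) ((y \<otimes>\<^bsub>gr H N\<^esub> y') (n - s))
      = gr_bracket H N s (n - s) (x s) (y (n - s))
        \<otimes>\<^bsub>gr_piece H N n\<^esub> gr_bracket H N s (n - s) (x s) (y' (n - s))"
    if "s \<in> {1..<n}" for s
  proof -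
    have "1 \<le> s" "1 \<le> n - s" "s + (n - s) = n" using that by auto
    then show ?thesis
      using gr_bracket_add_right[of s "n - s" "x s" "y (n - s)" "y' (n - s)"]
        gr_mem[OF x] gr_mem[OF y(1)] gr_mem[OF y(2)] by (simp add: gr_simps)
  qed
  then have "bracket (gr H N) x (y \<otimes>\<^bsub>gr H N\<^esub> y') n
    = finprod (gr_piece H N n) (\<lambda>s. gr_bracket H N s (n - s) (x s) (y (n - s))
        \<otimes>\<^bsub>gr_piece H N n\<^esub> gr_bracket H N s (n - s) (x s) (y' (n - s))) {1..<n}"
    unfolding bracket_gr_apply[OF n] using gr_bracket_summand_closed x y
    by (intro P.finprod_cong') (auto intro: P.m_closed)
  also have "\<dots> = (bracket (gr H N) x y \<otimes>\<^bsub>gr H N\<^esub> bracket (gr H N) x y') n"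
    using n gr_bracket_summand_closed x y
    by (subst P.finprod_multf) (auto simp: gr_simps bracket_gr_apply)
  finally show "bracket (gr H N) x (y \<otimes>\<^bsub>gr H N\<^esub> y') n
    = (bracket (gr H N) x y \<otimes>\<^bsub>gr H N\<^esub> bracket (gr H N) x y') n" .
qed (simp_all add: bracket_gr_closed x y)

lemma bracket_gr_one:
  assumes "x \<in> carrier (gr H N)"
  shows "bracket (gr H N) \<one>\<^bsub>gr H N\<^esub> x = \<one>\<^bsub>gr H N\<^esub>" "bracket (gr H N) x \<one>\<^bsub>gr H N\<^esub> = \<one>\<^bsub>gr H N\<^esub>"
  using bracket_gr_add_left[of "\<one>\<^bsub>gr H N\<^esub>" "\<one>\<^bsub>gr H N\<^esub>" x]
    bracket_gr_add_right[of x "\<one>\<^bsub>gr H N\<^esub>" "\<one>\<^bsub>gr H N\<^esub>"] assms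
    bracket_gr_closed[of "\<one>\<^bsub>gr H N\<^esub>" x] bracket_gr_closed[of x "\<one>\<^bsub>gr H N\<^esub>"]
  by simp_all

lemma bracket_gr_homog:
  assumes s: "1 \<le> s" "1 \<le> t" and C: "C \<in> carrier (gr_piece H N s)" and D: "D \<in> carrier (gr_piece H N t)"
  shows "bracket (gr H N) (gr_homog H N s C) (gr_homog H N t D)
    = gr_homog H N (s + t) (gr_bracket H N s t C D)"
proof (rule gr_eqI)
  fix n :: nat assume n: "1 \<le> n"
  interpret P: comm_group "gr_piece H N n" by (simp add: comm_group_gr_piece n)
  \<comment> \<open>The expected value in degree n. Only the summand with index s can survive, and
    it is nontrivial at most when n - s = t. If s is not below n, that index does not occur, but
    then n is not s + t since t is positive, and \<open>B\<close> is trivial as well.\<close>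
  define B where "B = (if n = s + t then gr_bracket H N s t C D else \<one>\<^bsub>gr_piece H N n\<^esub>)"
  have B: "B \<in> carrier (gr_piece H N n)"
    unfolding B_def using gr_bracket_closed[OF s C D] by (cases "n = s + t") simp_all
  have eq: "gr_bracket H N i (n - i) (gr_homog H N s C i) (gr_homog H N t D (n - i))
    = (if s = i then B else \<one>\<^bsub>gr_piece H N n\<^esub>)"
    if "i \<in> {1..<n}" for i
  proof -
    have i: "1 \<le> i" "1 \<le> n - i" "i + (n - i) = n" using that by auto
    show ?thesis
    proof (cases "s = i")
      case False
      then show ?thesis
        using gr_bracket_one_left[OF i(1,2) gr_mem[OF gr_homog_closed[OF s(2) D] i(2)]] i
        by (simp add: gr_homog_apply)
    next
      case True
      have "gr_bracket H N s (n - s) C (gr_homog H N t D (n - s)) = B"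
      proof (cases "n - s = t")
        case t: True
        then have "n = s + t" using i True by auto
        then show ?thesis using s by (simp add: B_def gr_homog_apply)
      next
        case t: False
        then have "n \<noteq> s + t" using s by auto
        then have "B = \<one>\<^bsub>gr_piece H N n\<^esub>" by (simp add: B_def)
        then show ?thesis
          using gr_bracket_one_right[OF s(1) i(2)[folded True] C] i(2,3) t True
          by (simp add: gr_homog_apply)
      qed
      then show ?thesis using True i by (simp add: gr_homog_apply)
    qed
  qed
  have "bracket (gr H N) (gr_homog H N s C) (gr_homog H N t D) n
    = finprod (gr_piece H N n) (\<lambda>i. if s = i then B else \<one>\<^bsub>gr_piece H N n\<^esub>) {1..<n}"
    unfolding bracket_gr_apply[OF n] using eq B by (intro P.finprod_cong') auto
  also have "\<dots> = B"
  proof (cases "s < n")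
    case True
    then show ?thesis
      using P.finprod_singleton[of s "{1..<n}" "\<lambda>i. B"] s B by simp
  next
    case False
    then have "B = \<one>\<^bsub>gr_piece H N n\<^esub>" using s by (simp add: B_def)
    then show ?thesis by (simp cong del: if_weak_cong)
  qed
  also have "B = gr_homog H N (s + t) (gr_bracket H N s t C D) n"
    using n by (simp add: B_def gr_homog_apply)
  finally show "bracket (gr H N) (gr_homog H N s C) (gr_homog H N t D) n
    = gr_homog H N (s + t) (gr_bracket H N s t C D) n" .
qed (use assms in \<open>simp_all add: bracket_gr_closed gr_homog_closed gr_bracket_closed\<close>)

lemma gr_homog_mult:
  "\<lbrakk>1 \<le> s; C \<in> carrier (gr_piece H N s); D \<in> carrier (gr_piece H N s)\<rbrakk> \<Longrightarrow>
    gr_homog H N s C \<otimes>\<^bsub>gr H N\<^esub> gr_homog H N s D = gr_homog H N s (C \<otimes>\<^bsub>gr_piece H N s\<^esub> D)"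
  unfolding gr_simps gr_homog_def using group.is_monoid[OF group_gr_piece]
  by (intro restrict_ext) (simp add: monoid.l_one gr_piece_one_closed)

lemma bracket_gr_antisym:
  assumes x: "x \<in> carrier (gr H N)" and y: "y \<in> carrier (gr H N)"
  shows "bracket (gr H N) x y \<otimes>\<^bsub>gr H N\<^esub> bracket (gr H N) y x = \<one>\<^bsub>gr H N\<^esub>"
  using x
proof (induction x rule: gr_induct)
  case one
  then show ?case by (simp add: bracket_gr_one y)
next
  case (mult x s C)
  let ?h = "gr_homog H N s C"
  have h: "?h \<in> carrier (gr H N)" using mult by (simp add: gr_homog_closed)
  have "bracket (gr H N) ?h y \<otimes>\<^bsub>gr H N\<^esub> bracket (gr H N) y ?h = \<one>\<^bsub>gr H N\<^esub>"
    using y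
  proof (induction y rule: gr_induct)
    case one
    then show ?case by (simp add: bracket_gr_one h)
  next
    case (mult y t D)
    have "bracket (gr H N) ?h (gr_homog H N t D) \<otimes>\<^bsub>gr H N\<^esub> bracket (gr H N) (gr_homog H N t D) ?h
        = \<one>\<^bsub>gr H N\<^esub>"
      using gr_bracket_closed[of s t C D] gr_bracket_closed[of t s D C] gr_bracket_antisym[of s t C D]
        \<open>1 \<le> s\<close> \<open>1 \<le> t\<close> \<open>C \<in> _\<close> \<open>D \<in> _\<close>
      by (simp add: bracket_gr_homog add.commute[of t s] gr_homog_mult gr_homog_one)
    then show ?case
      using mult h gr_homog_closed[of t D]
        gr.m_assoc[of "bracket (gr H N) ?h y \<otimes>\<^bsub>gr H N\<^esub> bracket (gr H N) y ?h"
          "bracket (gr H N) ?h (gr_homog H N t D)" "bracket (gr H N) (gr_homog H N t D) ?h"]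
      by (simp add: bracket_gr_add_left bracket_gr_add_right bracket_gr_closed gr.m_ac)
  qed
  then show ?case
    using mult h y gr.m_assoc[of "bracket (gr H N) x y \<otimes>\<^bsub>gr H N\<^esub> bracket (gr H N) y x"
          "bracket (gr H N) ?h y" "bracket (gr H N) y ?h"]
    by (simp add: bracket_gr_add_left bracket_gr_add_right bracket_gr_closed gr.m_ac)
qed

text \<open>This law is quadratic, not additive: expanding the bracket of x + h with itself leaves
  the cross terms [x, h] + [h, x], which antisymmetry removes. Antisymmetry alone would give it only
  up to 2-torsion, so homogeneous elements are treated through
  \<open>gr_bracket_self\<close>.\<close>

lemma bracket_gr_self:
  assumes "x \<in> carrier (gr H N)"
  shows "bracket (gr H N) x x = \<one>\<^bsub>gr H N\<^esub>"
  using assms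
proof (induction x rule: gr_induct)
  case one
  then show ?case by (simp add: bracket_gr_one)
next
  case (mult x s C)
  let ?h = "gr_homog H N s C"
  have h: "?h \<in> carrier (gr H N)" using mult by (simp add: gr_homog_closed)
  have "bracket (gr H N) ?h ?h = \<one>\<^bsub>gr H N\<^esub>"
    using mult by (simp add: bracket_gr_homog gr_bracket_self gr_homog_one)
  then show ?case
    using mult h bracket_gr_antisym[OF mult(1) h]
    by (simp add: bracket_gr_add_left bracket_gr_add_right bracket_gr_closed gr.m_ac)
qed

lemma jacobi_gr:
  assumes x: "x \<in> carrier (gr H N)" and y: "y \<in> carrier (gr H N)" and z: "z \<in> carrier (gr H N)"
  shows "bracket (gr H N) x (bracket (gr H N) y z)
    \<otimes>\<^bsub>gr H N\<^esub> bracket (gr H N) y (bracket (gr H N) z x)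
    \<otimes>\<^bsub>gr H N\<^esub> bracket (gr H N) z (bracket (gr H N) x y) = \<one>\<^bsub>gr H N\<^esub>"
proof -
  define J where "J x y z = bracket (gr H N) x (bracket (gr H N) y z)
    \<otimes>\<^bsub>gr H N\<^esub> bracket (gr H N) y (bracket (gr H N) z x)
    \<otimes>\<^bsub>gr H N\<^esub> bracket (gr H N) z (bracket (gr H N) x y)" for x y z
  \<comment> \<open>Cyclic symmetry means that additivity and the reduction to homogeneous arguments
    are needed in the first slot only. The three slots are reduced in turn by rotating each of them
    to the front.\<close>
  have J_rot: "J x y z = J y z x"
    if "x \<in> carrier (gr H N)" "y \<in> carrier (gr H N)" "z \<in> carrier (gr H N)" for x y z
    using that by (simp add: J_def bracket_gr_closed gr.m_ac)
  have J_mult: "J (x \<otimes>\<^bsub>gr H N\<^esub> x') y z = J x y z \<otimes>\<^bsub>gr H N\<^esub> J x' y z"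
    if "x \<in> carrier (gr H N)" "x' \<in> carrier (gr H N)" "y \<in> carrier (gr H N)" "z \<in> carrier (gr H N)"
    for x x' y z
    using that
    by (simp add: J_def bracket_gr_add_left bracket_gr_add_right bracket_gr_closed gr.m_ac)
  have J_one: "J \<one>\<^bsub>gr H N\<^esub> y z = \<one>\<^bsub>gr H N\<^esub>" if "y \<in> carrier (gr H N)" "z \<in> carrier (gr H N)" for y z
    using that by (simp add: J_def bracket_gr_one bracket_gr_closed)
  have J_homog: "J (gr_homog H N r C) (gr_homog H N s D) (gr_homog H N t E) = \<one>\<^bsub>gr H N\<^esub>"
    if "1 \<le> r" "1 \<le> s" "1 \<le> t" "C \<in> carrier (gr_piece H N r)" "D \<in> carrier (gr_piece H N s)"
      "E \<in> carrier (gr_piece H N t)" for r s t C D E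
  proof -
    have sums: "s + (t + r) = r + s + t" "t + (r + s) = r + s + t" "r + (s + t) = r + s + t"
      by simp_all
    have "gr_bracket H N r (s + t) C (gr_bracket H N s t D E) \<in> carrier (gr_piece H N (r + s + t))"
      "gr_bracket H N s (t + r) D (gr_bracket H N t r E C) \<in> carrier (gr_piece H N (r + s + t))"
      "gr_bracket H N t (r + s) E (gr_bracket H N r s C D) \<in> carrier (gr_piece H N (r + s + t))"
      using that gr_bracket_closed[of r "s + t" C "gr_bracket H N s t D E"]
        gr_bracket_closed[of s "t + r" D "gr_bracket H N t r E C"]
        gr_bracket_closed[of t "r + s" E "gr_bracket H N r s C D"]
      unfolding sums by (simp_all only: gr_bracket_closed trans_le_add1)
    moreover have "monoid (gr_piece H N (r + s + t))"
      using that by (simp add: group_gr_piece group.is_monoid)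
    ultimately show ?thesis
      using that
      by (simp only: J_def bracket_gr_homog gr_bracket_closed gr_homog_mult monoid.m_closed
          sums trans_le_add1 gr_bracket_jacobi gr_homog_one)
  qed
  have reduce: "J x y z = \<one>\<^bsub>gr H N\<^esub>"
    if homog: "\<And>s C. \<lbrakk>1 \<le> s; C \<in> carrier (gr_piece H N s)\<rbrakk> \<Longrightarrow> J (gr_homog H N s C) y z = \<one>\<^bsub>gr H N\<^esub>"
      and "x \<in> carrier (gr H N)" and yz: "y \<in> carrier (gr H N)" "z \<in> carrier (gr H N)" for x y z
    using that(2)
    by (induction x rule: gr_induct) (simp_all add: J_one J_mult homog yz gr_homog_closed)
  have "J x y z = \<one>\<^bsub>gr H N\<^esub>"
  proof (rule reduce[OF _ x y z])
    fix r C assume r: "1 \<le> r" "C \<in> carrier (gr_piece H N r)"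
    have "J y z (gr_homog H N r C) = \<one>\<^bsub>gr H N\<^esub>"
    proof (rule reduce[OF _ y z gr_homog_closed[OF r]])
      fix s D assume s: "1 \<le> s" "D \<in> carrier (gr_piece H N s)"
      have "J z (gr_homog H N r C) (gr_homog H N s D) = \<one>\<^bsub>gr H N\<^esub>"
        by (rule reduce[OF J_homog z gr_homog_closed[OF r] gr_homog_closed[OF s]]) (use r s in auto)
      then show "J (gr_homog H N s D) z (gr_homog H N r C) = \<one>\<^bsub>gr H N\<^esub>"
        using r s z by (simp add: J_rot[of "gr_homog H N s D"] gr_homog_closed)
    qed
    then show "J (gr_homog H N r C) y z = \<one>\<^bsub>gr H N\<^esub>"
      using r y z by (simp add: J_rot[of "gr_homog H N r C"] gr_homog_closed)
  qed
  then show ?thesis by (simp add: J_def)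
qed

lemma homog_bracket_gr:
  assumes "1 \<le> s" "1 \<le> t" "x \<in> homog (gr H N) s" "y \<in> homog (gr H N) t"
  shows "bracket (gr H N) x y \<in> homog (gr H N) (s + t)"
proof -
  have C: "x s \<in> carrier (gr_piece H N s)" and D: "y t \<in> carrier (gr_piece H N t)"
    using assms by (simp_all add: gr_mem homog_closed)
  have "bracket (gr H N) x y = gr_homog H N (s + t) (gr_bracket H N s t (x s) (y t))"
    using bracket_gr_homog[OF assms(1,2) C D] homog_eq_gr_homog[OF assms(1,3)]
      homog_eq_gr_homog[OF assms(2,4)] by simp
  then show ?thesis
    using assms(1) gr_bracket_closed[OF assms(1,2) C D] by (simp add: gr_homog_mem)
qed

end

lemma (in central_filtration) graded_lie_algebra_gr: "graded_lie_algebra (gr H N)"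
  by (intro graded_lie_algebra.intro graded_lie_algebra_axioms.intro comm_group_gr
      bracket_gr_closed bracket_gr_add_left bracket_gr_add_right bracket_gr_self jacobi_gr
      homog_subgroup_gr homog_direct_sum_gr homog_bracket_gr)

section \<open>Functoriality\<close>

lemma (in group_hom) hom_finprod:
  assumes "comm_group G" "comm_group H" "finite A" "g \<in> A \<rightarrow> carrier G"
  shows "h (finprod G g A) = finprod H (\<lambda>a. h (g a)) A"
proof -
  interpret G': comm_group G by fact
  interpret H': comm_group H by fact
  show ?thesis
    using assms(3,4) by (induction A rule: finite_induct) (auto simp: Pi_iff)
qed

locale filtered_hom = dom: central_filtration H N + cod: central_filtration K M
  for H :: "('a, 'm) monoid_scheme" and N and K :: "('b, 'n) monoid_scheme" and M +
  fixes f
  assumes hom: "f \<in> hom H K"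
    and filtered: "\<lbrakk>1 \<le> s; x \<in> N s\<rbrakk> \<Longrightarrow> f x \<in> M s"
begin

sublocale group_hom H K f
  by unfold_locales (rule hom)

lemma set_mult_image_gr_class:
  assumes "1 \<le> s" "x \<in> N s"
  shows "M (Suc s) <#>\<^bsub>K\<^esub> f ` gr_class H N s x = gr_class K M s (f x)"
proof (rule cod.set_mult_eq_gr_class[OF assms(1)])
  have x: "x \<in> carrier H" using assms by (rule dom.N_closed)
  then show "f x \<in> f ` gr_class H N s x" "f x \<in> carrier K"
    using assms by (simp_all add: dom.mem_gr_class)
  show "f ` gr_class H N s x \<subseteq> gr_class K M s (f x)"
  proof
    fix y assume "y \<in> f ` gr_class H N s x"
    then obtain n where n: "n \<in> N (Suc s)" "y = f (n \<otimes>\<^bsub>H\<^esub> x)"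
      by (auto elim: dom.mem_gr_classE)
    have "n \<in> carrier H" using dom.N_closed[OF _ n(1)] by simp
    then have "y = f n \<otimes>\<^bsub>K\<^esub> f x" using n x by simp
    moreover have "f n \<in> M (Suc s)" using filtered[OF _ n(1)] by simp
    ultimately show "y \<in> gr_class K M s (f x)"
      by (auto simp: gr_class_def r_coset_def)
  qed
qed

lemma gr_map_apply: "1 \<le> s \<Longrightarrow> gr_map K M f x s = M (Suc s) <#>\<^bsub>K\<^esub> f ` x s"
  by (simp add: gr_map_def)

lemma gr_map_class:
  "\<lbrakk>1 \<le> s; a \<in> N s; x s = gr_class H N s a\<rbrakk> \<Longrightarrow> gr_map K M f x s = gr_class K M s (f a)"
  by (simp add: gr_map_apply set_mult_image_gr_class)

lemma gr_piece_hom: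
  assumes "1 \<le> s"
  shows "(\<lambda>C. M (Suc s) <#>\<^bsub>K\<^esub> f ` C) \<in> hom (gr_piece H N s) (gr_piece K M s)"
proof (rule homI)
  fix C assume "C \<in> carrier (gr_piece H N s)"
  then obtain x where x: "x \<in> N s" "C = gr_class H N s x" by (rule dom.gr_pieceE)
  then show "M (Suc s) <#>\<^bsub>K\<^esub> f ` C \<in> carrier (gr_piece K M s)"
    using assms filtered[OF assms x(1)] by (simp add: set_mult_image_gr_class carrier_gr_piece)
  fix D assume "D \<in> carrier (gr_piece H N s)"
  then obtain y where y: "y \<in> N s" "D = gr_class H N s y" by (rule dom.gr_pieceE)
  have "x \<in> carrier H" "y \<in> carrier H" using dom.N_closed[OF assms] x y by auto
  then show "M (Suc s) <#>\<^bsub>K\<^esub> f ` (C \<otimes>\<^bsub>gr_piece H N s\<^esub> D)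
    = (M (Suc s) <#>\<^bsub>K\<^esub> f ` C) \<otimes>\<^bsub>gr_piece K M s\<^esub> (M (Suc s) <#>\<^bsub>K\<^esub> f ` D)"
    using assms x y dom.N_mult[OF assms x(1) y(1)]
    by (simp add: set_mult_image_gr_class dom.gr_class_mult cod.gr_class_mult)
qed

lemma group_hom_gr_piece:
  "1 \<le> s \<Longrightarrow> group_hom (gr_piece H N s) (gr_piece K M s) (\<lambda>C. M (Suc s) <#>\<^bsub>K\<^esub> f ` C)"
  by (simp add: group_hom_def group_hom_axioms_def gr_piece_hom dom.group_gr_piece cod.group_gr_piece)

lemma gr_piece_hom_bracket:
  assumes st: "1 \<le> s" "1 \<le> t"
    and C: "C \<in> carrier (gr_piece H N s)" and D: "D \<in> carrier (gr_piece H N t)"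
  shows "M (Suc (s + t)) <#>\<^bsub>K\<^esub> f ` gr_bracket H N s t C D
    = gr_bracket K M s t (M (Suc s) <#>\<^bsub>K\<^esub> f ` C) (M (Suc t) <#>\<^bsub>K\<^esub> f ` D)"
proof -
  obtain x where x: "x \<in> N s" "C = gr_class H N s x" using C by (rule dom.gr_pieceE)
  obtain y where y: "y \<in> N t" "D = gr_class H N t y" using D by (rule dom.gr_pieceE)
  have "x \<in> carrier H" "y \<in> carrier H" using dom.N_closed st x y by auto
  then have "f (commutator H x y) = commutator K (f x) (f y)"
    by (intro dom.commutator_hom hom cod.is_group)
  moreover have "commutator H x y \<in> N (s + t)" using st x(1) y(1) by (rule dom.N_commutator)
  moreover have "1 \<le> s + t" using st by simp
  ultimately show ?thesis
    using st x y filtered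
    by (simp add: dom.gr_bracket_class cod.gr_bracket_class set_mult_image_gr_class)
qed

lemma gr_map_closed:
  assumes x: "x \<in> carrier (gr H N)"
  shows "gr_map K M f x \<in> carrier (gr K M)"
proof -
  have "gr_map K M f x s \<in> carrier (gr_piece K M s)" if "1 \<le> s" for s
    using hom_in_carrier[OF gr_piece_hom[OF that] dom.gr_mem[OF x that]] that
    by (simp add: gr_map_apply)
  moreover have "gr_map K M f x s = \<one>\<^bsub>gr_piece K M s\<^esub>"
    if "1 \<le> s" "x s = \<one>\<^bsub>gr_piece H N s\<^esub>" for s
    using group_hom.hom_one[OF group_hom_gr_piece[OF that(1)]] that by (simp add: gr_map_apply)
  then have "{s \<in> {1..}. gr_map K M f x s \<noteq> \<one>\<^bsub>gr_piece K M s\<^esub>}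
      \<subseteq> {s \<in> {1..}. x s \<noteq> \<one>\<^bsub>gr_piece H N s\<^esub>}"
    by auto
  then have "finite {s \<in> {1..}. gr_map K M f x s \<noteq> \<one>\<^bsub>gr_piece K M s\<^esub>}"
    by (rule finite_subset) (use dom.gr_eq_finprod(1)[OF x] in simp)
  ultimately show ?thesis
    by (auto simp: cod.carrier_gr gr_map_def)
qed

lemma gr_map_homog:
  assumes "1 \<le> s" "x \<in> homog (gr H N) s"
  shows "gr_map K M f x \<in> homog (gr K M) s"
proof -
  have "gr_map K M f x t = \<one>\<^bsub>gr_piece K M t\<^esub>" if "1 \<le> t" "t \<noteq> s" for t
    using group_hom.hom_one[OF group_hom_gr_piece[OF that(1)]] that assms(2)
    by (simp add: gr_map_apply homog_gr)
  moreover have "gr_map K M f x \<in> carrier (gr K M)"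
    using assms dom.homog_closed gr_map_closed by blast
  ultimately show ?thesis by (simp add: homog_gr)
qed

lemma gr_map_bracket:
  assumes x: "x \<in> carrier (gr H N)" and y: "y \<in> carrier (gr H N)"
  shows "gr_map K M f (bracket (gr H N) x y) = bracket (gr K M) (gr_map K M f x) (gr_map K M f y)"
proof (rule cod.gr_eqI)
  fix n :: nat assume n: "1 \<le> n"
  interpret P: group_hom "gr_piece H N n" "gr_piece K M n" "\<lambda>C. M (Suc n) <#>\<^bsub>K\<^esub> f ` C"
    using n by (rule group_hom_gr_piece)
  interpret Q: comm_group "gr_piece K M n" using n by (rule cod.comm_group_gr_piece)
  have summand: "M (Suc n) <#>\<^bsub>K\<^esub> f ` gr_bracket H N s (n - s) (x s) (y (n - s))
      = gr_bracket K M s (n - s) (gr_map K M f x s) (gr_map K M f y (n - s))"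
    if "s \<in> {1..<n}" for s
  proof -
    have s: "1 \<le> s" "1 \<le> n - s" "s + (n - s) = n" using that by auto
    then show ?thesis
      using gr_piece_hom_bracket[OF s(1,2) dom.gr_mem[OF x s(1)] dom.gr_mem[OF y s(2)]]
      by (simp add: gr_map_apply)
  qed
  have "gr_map K M f (bracket (gr H N) x y) n
    = M (Suc n) <#>\<^bsub>K\<^esub> f ` finprod (gr_piece H N n)
        (\<lambda>s. gr_bracket H N s (n - s) (x s) (y (n - s))) {1..<n}"
    using n by (simp add: gr_map_apply bracket_gr_apply)
  also have "\<dots> = finprod (gr_piece K M n)
      (\<lambda>s. M (Suc n) <#>\<^bsub>K\<^esub> f ` gr_bracket H N s (n - s) (x s) (y (n - s))) {1..<n}"
    using dom.gr_bracket_summand_closed[OF x y] n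
    by (intro P.hom_finprod dom.comm_group_gr_piece cod.comm_group_gr_piece) auto
  also have "\<dots> = bracket (gr K M) (gr_map K M f x) (gr_map K M f y) n"
    unfolding bracket_gr_apply[OF n] using summand
      cod.gr_bracket_summand_closed[OF gr_map_closed[OF x] gr_map_closed[OF y]]
    by (intro Q.finprod_cong') auto
  finally show "gr_map K M f (bracket (gr H N) x y) n
    = bracket (gr K M) (gr_map K M f x) (gr_map K M f y) n" .
qed (simp_all add: gr_map_closed dom.bracket_gr_closed cod.bracket_gr_closed x y)

lemma gr_map_hom: "gr_map K M f \<in> hom (gr H N) (gr K M)"
proof (rule homI)
  fix x y assume x: "x \<in> carrier (gr H N)" and y: "y \<in> carrier (gr H N)"
  show "gr_map K M f (x \<otimes>\<^bsub>gr H N\<^esub> y) = gr_map K M f x \<otimes>\<^bsub>gr K M\<^esub> gr_map K M f y"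
  proof (rule cod.gr_eqI)
    fix s :: nat assume s: "1 \<le> s"
    show "gr_map K M f (x \<otimes>\<^bsub>gr H N\<^esub> y) s = (gr_map K M f x \<otimes>\<^bsub>gr K M\<^esub> gr_map K M f y) s"
      using Group.hom_mult[OF gr_piece_hom[OF s] dom.gr_mem[OF x s] dom.gr_mem[OF y s]] s
      by (simp add: gr_map_apply gr_simps)
  next
    show "gr_map K M f (x \<otimes>\<^bsub>gr H N\<^esub> y) \<in> carrier (gr K M)"
      using x y by (intro gr_map_closed monoid.m_closed[OF group.is_monoid] comm_group.axioms(2)
          dom.comm_group_gr)
    show "gr_map K M f x \<otimes>\<^bsub>gr K M\<^esub> gr_map K M f y \<in> carrier (gr K M)"
      using x y by (intro gr_map_closed monoid.m_closed[OF group.is_monoid] comm_group.axioms(2)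
          cod.comm_group_gr)
  qed
qed (rule gr_map_closed)

lemma gr_map_graded_lie_hom: "gr_map K M f \<in> graded_lie_hom (gr H N) (gr K M)"
  using gr_map_hom gr_map_bracket gr_map_homog by (auto simp: graded_lie_hom_def)

text \<open>Representatives chosen degree by degree need not form a family of finite support. The
  last clause of \<open>?ok\<close> takes care of this: wherever \<open>y s\<close> is trivial, the
  chosen representative is one whose class is trivial too.\<close>

lemma gr_map_lift:
  assumes y: "y \<in> carrier (gr K M)"
    and lift: "\<And>s. 1 \<le> s \<Longrightarrow> \<exists>a\<in>N s. gr_class K M s (f a) = y s"
  shows "\<exists>x\<in>carrier (gr H N). gr_map K M f x = y"
proof -
  let ?ok = "\<lambda>s a. a \<in> N s \<and> gr_class K M s (f a) = y s \<and>
    (y s = \<one>\<^bsub>gr_piece K M s\<^esub> \<longrightarrow> gr_class H N s a = \<one>\<^bsub>gr_piece H N s\<^esub>)"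
  have "\<exists>a. ?ok s a" if s: "1 \<le> s" for s
  proof (cases "y s = \<one>\<^bsub>gr_piece K M s\<^esub>")
    case True
    then have "?ok s \<one>\<^bsub>H\<^esub>"
      using s by (simp add: dom.N_one_mem dom.gr_class_one cod.gr_class_one)
    then show ?thesis by blast
  next
    case False
    then show ?thesis using lift[OF s] by blast
  qed
  then obtain a where a: "\<And>s. 1 \<le> s \<Longrightarrow> ?ok s (a s)" by metis
  define x where "x = (\<lambda>s\<in>{1..}. gr_class H N s (a s))"
  have "{s \<in> {1..}. x s \<noteq> \<one>\<^bsub>gr_piece H N s\<^esub>} \<subseteq> {s \<in> {1..}. y s \<noteq> \<one>\<^bsub>gr_piece K M s\<^esub>}"
    using a by (auto simp: x_def)
  then have "finite {s \<in> {1..}. x s \<noteq> \<one>\<^bsub>gr_piece H N s\<^esub>}"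
    by (rule finite_subset) (use cod.gr_eq_finprod(1)[OF y] in simp)
  then have x: "x \<in> carrier (gr H N)"
    using a by (auto simp: dom.carrier_gr x_def carrier_gr_piece)
  have "gr_map K M f x = y"
  proof (rule cod.gr_eqI[OF gr_map_closed[OF x] y])
    fix s :: nat assume s: "1 \<le> s"
    show "gr_map K M f x s = y s"
      using gr_map_class[OF s, of "a s" x] a[OF s] s by (simp add: x_def)
  qed
  with x show ?thesis by blast
qed

end

text \<open>The composite is an arbitrary \<open>h\<close> that agrees with g after f on the
  carrier. Two factorizations of the same map can therefore be compared, which is how the commuting
  squares and equivariance are obtained.\<close>

lemma gr_map_comp:
  assumes "filtered_hom H N K M f" "filtered_hom K M Q P g"
    and comp: "\<And>x. x \<in> carrier H \<Longrightarrow> g (f x) = h x"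
    and x: "x \<in> carrier (gr H N)"
  shows "gr_map Q P g (gr_map K M f x) = gr_map Q P h x"
proof
  interpret f: filtered_hom H N K M f by fact
  interpret g: filtered_hom K M Q P g by fact
  have h: "h \<in> hom H Q"
    using comp f.dom.m_closed f.hom_closed g.hom_closed f.hom_mult g.hom_mult
    by (auto intro!: homI simp flip: comp)
  interpret h: filtered_hom H N Q P h
  proof
    show "h \<in> hom H Q" by fact
    show "h x \<in> P s" if "1 \<le> s" "x \<in> N s" for s x
      using g.filtered[OF that(1) f.filtered[OF that]] comp[OF f.dom.N_closed[OF that]] by simp
  qed
  fix s :: nat
  show "gr_map Q P g (gr_map K M f x) s = gr_map Q P h x s"
  proof (cases "1 \<le> s")
    case s: True
    obtain a where a: "a \<in> N s" "x s = gr_class H N s a"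
      using f.dom.gr_mem[OF x s] by (rule f.dom.gr_pieceE)
    have "gr_map K M f x s = gr_class K M s (f a)"
      using s a by (rule f.gr_map_class)
    then have "gr_map Q P g (gr_map K M f x) s = gr_class Q P s (g (f a))"
      by (rule g.gr_map_class[where x = "gr_map K M f x", OF s f.filtered[OF s a(1)]])
    then show ?thesis
      using h.gr_map_class[where x = x, OF s a] comp[OF f.dom.N_closed[OF s a(1)]] by simp
  qed (simp add: gr_map_def)
qed

lemma (in central_filtration) gr_map_id:
  assumes id: "\<And>x. x \<in> carrier H \<Longrightarrow> f x = x" and x: "x \<in> carrier (gr H N)"
  shows "gr_map H N f x = x"
proof -
  interpret f: filtered_hom H N H N f
    using id N_closed by unfold_locales (auto simp: hom_def)
  show ?thesis
  proof (rule gr_eqI[OF f.gr_map_closed[OF x] x])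
    fix s :: nat assume s: "1 \<le> s"
    obtain a where a: "a \<in> N s" "x s = gr_class H N s a"
      using gr_mem[OF x s] by (rule gr_pieceE)
    show "gr_map H N f x s = x s"
      using f.gr_map_class[where x = x, OF s a] id[OF N_closed[OF s a(1)]] a by simp
  qed
qed

text \<open>Since the maps act degree by degree, exactness can be checked in each degree on
  representatives. The hypotheses say this without cosets: \<open>inj\<close> forbids a gain of
  degree under \<open>f\<close>, \<open>mid\<close> corrects \<open>y\<close> by some
  \<open>f x\<close> of the same degree, and \<open>surj\<close> asks for preimages of the right
  degree. \<open>gr_map_lift\<close> reassembles the degrees.\<close>

lemma short_exact_gr:
  assumes "filtered_hom H N K M f" "filtered_hom K M Q P g"
    and inj: "\<And>s x. \<lbrakk>1 \<le> s; x \<in> N s; f x \<in> M (Suc s)\<rbrakk> \<Longrightarrow> x \<in> N (Suc s)"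
    and comp: "\<And>x. x \<in> carrier H \<Longrightarrow> g (f x) = \<one>\<^bsub>Q\<^esub>"
    and mid: "\<And>s y. \<lbrakk>1 \<le> s; y \<in> M s; g y \<in> P (Suc s)\<rbrakk> \<Longrightarrow>
      \<exists>x\<in>N s. y \<otimes>\<^bsub>K\<^esub> inv\<^bsub>K\<^esub> f x \<in> M (Suc s)"
    and surj: "\<And>s. 1 \<le> s \<Longrightarrow> P s \<subseteq> g ` M s"
  shows "short_exact (gr H N) (gr K M) (gr Q P) (gr_map K M f) (gr_map Q P g)"
proof -
  interpret f: filtered_hom H N K M f by fact
  interpret g: filtered_hom K M Q P g by fact
  have grp: "group (gr H N)" "group (gr K M)"
    using f.dom.comm_group_gr f.cod.comm_group_gr by (simp_all add: comm_group.axioms(2))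
  have one: "x = \<one>\<^bsub>gr H N\<^esub>"
    if x: "x \<in> carrier (gr H N)" and eq: "gr_map K M f x = \<one>\<^bsub>gr K M\<^esub>" for x
  proof (rule f.dom.gr_eqI[OF x])
    show "\<one>\<^bsub>gr H N\<^esub> \<in> carrier (gr H N)" using grp(1) by (simp add: group.is_monoid)
    fix s :: nat assume s: "1 \<le> s"
    obtain a where a: "a \<in> N s" "x s = gr_class H N s a"
      using f.dom.gr_mem[OF x s] by (rule f.dom.gr_pieceE)
    have "gr_class K M s (f a) = \<one>\<^bsub>gr_piece K M s\<^esub>"
      using f.gr_map_class[where x = x, OF s a] eq s by (simp add: gr_simps)
    then have "f a \<in> M (Suc s)"
      using s f.dom.N_closed[OF s a(1)] by (simp add: f.cod.gr_class_eq_one_iff)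
    then show "x s = \<one>\<^bsub>gr H N\<^esub> s"
      using a s inj[OF s a(1)] by (simp add: gr_simps f.dom.gr_class_trivial)
  qed
  have "gr_map K M f \<in> mon (gr H N) (gr K M)"
    using f.gr_map_hom one by (simp add: mon_iff_hom_one grp)
  moreover have "gr_map K M f ` carrier (gr H N) = kernel (gr K M) (gr Q P) (gr_map Q P g)"
  proof (intro equalityI subsetI)
    fix y assume "y \<in> gr_map K M f ` carrier (gr H N)"
    then obtain x where x: "x \<in> carrier (gr H N)" "y = gr_map K M f x" by blast
    have "gr_map Q P g y s = \<one>\<^bsub>gr Q P\<^esub> s" if s: "1 \<le> s" for s
    proof -
      obtain a where a: "a \<in> N s" "x s = gr_class H N s a"
        using f.dom.gr_mem[OF x(1) s] by (rule f.dom.gr_pieceE)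
      then have "y s = gr_class K M s (f a)" using f.gr_map_class[where x = x, OF s a] x by simp
      then show ?thesis
        using g.gr_map_class[where x = y, OF s f.filtered[OF s a(1)]] comp[OF f.dom.N_closed[OF s a(1)]] s
        by (simp add: gr_simps g.cod.gr_class_one)
    qed
    moreover have "y \<in> carrier (gr K M)" using x f.gr_map_closed by simp
    moreover have "\<one>\<^bsub>gr Q P\<^esub> \<in> carrier (gr Q P)"
      using g.cod.comm_group_gr by (simp add: comm_group.axioms(2) group.is_monoid)
    ultimately show "y \<in> kernel (gr K M) (gr Q P) (gr_map Q P g)"
      using g.cod.gr_eqI[OF g.gr_map_closed] by (simp add: kernel_def)
  next
    fix y assume "y \<in> kernel (gr K M) (gr Q P) (gr_map Q P g)"
    then have y: "y \<in> carrier (gr K M)" and eq: "gr_map Q P g y = \<one>\<^bsub>gr Q P\<^esub>"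
      by (auto simp: kernel_def)
    have "\<exists>a\<in>N s. gr_class K M s (f a) = y s" if s: "1 \<le> s" for s
    proof -
      obtain b where b: "b \<in> M s" "y s = gr_class K M s b"
        using f.cod.gr_mem[OF y s] by (rule f.cod.gr_pieceE)
      have "gr_class Q P s (g b) = \<one>\<^bsub>gr_piece Q P s\<^esub>"
        using g.gr_map_class[where x = y, OF s b] eq s by (simp add: gr_simps)
      then have "g b \<in> P (Suc s)"
        using s f.cod.N_closed[OF s b(1)] by (simp add: g.cod.gr_class_eq_one_iff)
      then obtain a where a: "a \<in> N s" "b \<otimes>\<^bsub>K\<^esub> inv\<^bsub>K\<^esub> f a \<in> M (Suc s)"
        using mid[OF s b(1)] by blast
      then have "gr_class K M s b = gr_class K M s (f a)"
        using s f.dom.N_closed[OF s a(1)] f.cod.N_closed[OF s b(1)]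
        by (simp add: f.cod.gr_class_eq_iff)
      with a b show ?thesis by auto
    qed
    then show "y \<in> gr_map K M f ` carrier (gr H N)"
      using f.gr_map_lift[OF y] by blast
  qed
  moreover have "gr_map Q P g \<in> epi (gr K M) (gr Q P)"
  proof -
    have "z \<in> gr_map Q P g ` carrier (gr K M)" if z: "z \<in> carrier (gr Q P)" for z
    proof -
      have "\<exists>b\<in>M s. gr_class Q P s (g b) = z s" if s: "1 \<le> s" for s
        using g.cod.gr_mem[OF z s] surj[OF s] by (force elim: g.cod.gr_pieceE)
      then show ?thesis using g.gr_map_lift[OF z] by blast
    qed
    then show ?thesis using g.gr_map_hom g.gr_map_closed by (auto simp: epi_def)
  qed
  ultimately show ?thesis by (simp add: short_exact_def)
qed


section \<open>Induced actions\<close>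

text \<open>\<open>action_trivial\<close> is what lets the action of \<open>B\<close> descend to
  \<open>B Mod F\<close>: elements of \<open>F\<close> do not move classes. For \<open>B\<close> the
  automorphism group and \<open>F\<close> the first Johnson term, the quotient is
  \<open>autA G\<close>.\<close>

locale filtered_action = central_filtration H N + acting: normal F B
  for H :: "('a, 'm) monoid_scheme" and N and F and B :: "('s, 'k) monoid_scheme" +
  fixes \<phi> :: "'s \<Rightarrow> 'a \<Rightarrow> 'a"
  assumes action_filtered_hom: "\<sigma> \<in> carrier B \<Longrightarrow> filtered_hom H N H N (\<phi> \<sigma>)"
    and action_one: "x \<in> carrier H \<Longrightarrow> \<phi> \<one>\<^bsub>B\<^esub> x = x"
    and action_mult: "\<lbrakk>\<sigma> \<in> carrier B; \<tau> \<in> carrier B; x \<in> carrier H\<rbrakk> \<Longrightarrow>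
      \<phi> (\<sigma> \<otimes>\<^bsub>B\<^esub> \<tau>) x = \<phi> \<sigma> (\<phi> \<tau> x)"
    and action_trivial: "\<lbrakk>\<tau> \<in> F; 1 \<le> s; x \<in> N s\<rbrakk> \<Longrightarrow> \<phi> \<tau> x \<otimes>\<^bsub>H\<^esub> inv\<^bsub>H\<^esub> x \<in> N (Suc s)"
begin

text \<open>Both the automorphism and the element vary over cosets. Passing from \<sigma> to
  \<tau>\<sigma> with \<tau> in \<open>F\<close> contributes a factor \<open>u\<close> of the next
  degree by \<open>action_trivial\<close>, and passing from \<open>a\<close> to \<open>n a\<close>
  contributes \<open>\<phi> \<sigma> n\<close>, also of the next degree.\<close>

lemma gr_action_coset:
  assumes \<sigma>: "\<sigma> \<in> carrier B" and x: "x \<in> carrier (gr H N)"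
  shows "gr_action H N \<phi> (F #>\<^bsub>B\<^esub> \<sigma>) x = gr_map H N (\<phi> \<sigma>) x"
proof
  fix s :: nat
  interpret \<sigma>: filtered_hom H N H N "\<phi> \<sigma>" using \<sigma> by (rule action_filtered_hom)
  show "gr_action H N \<phi> (F #>\<^bsub>B\<^esub> \<sigma>) x s = gr_map H N (\<phi> \<sigma>) x s"
  proof (cases "1 \<le> s")
    case s: True
    obtain a where a: "a \<in> N s" "x s = gr_class H N s a"
      using gr_mem[OF x s] by (rule gr_pieceE)
    have ac: "a \<in> carrier H" using s a(1) by (rule N_closed)
    have "N (Suc s) <#>\<^bsub>H\<^esub> {\<phi> \<sigma>' h |\<sigma>' h. \<sigma>' \<in> F #>\<^bsub>B\<^esub> \<sigma> \<and> h \<in> x s} = gr_class H N s (\<phi> \<sigma> a)"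
    proof (rule set_mult_eq_gr_class[OF s])
      show "\<phi> \<sigma> a \<in> carrier H" using ac by simp
      show "\<phi> \<sigma> a \<in> {\<phi> \<sigma>' h |\<sigma>' h. \<sigma>' \<in> F #>\<^bsub>B\<^esub> \<sigma> \<and> h \<in> x s}"
        using acting.rcos_self[OF \<sigma> acting.is_subgroup] mem_gr_class[OF s ac] a by auto
      show "{\<phi> \<sigma>' h |\<sigma>' h. \<sigma>' \<in> F #>\<^bsub>B\<^esub> \<sigma> \<and> h \<in> x s} \<subseteq> gr_class H N s (\<phi> \<sigma> a)"
      proof clarify
        fix \<sigma>' h assume \<sigma>': "\<sigma>' \<in> F #>\<^bsub>B\<^esub> \<sigma>" and h: "h \<in> x s"
        obtain \<tau> where \<tau>: "\<tau> \<in> F" "\<sigma>' = \<tau> \<otimes>\<^bsub>B\<^esub> \<sigma>" using \<sigma>' by (auto simp: r_coset_def)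
        obtain n where n: "n \<in> N (Suc s)" "h = n \<otimes>\<^bsub>H\<^esub> a" using h a by (auto elim: mem_gr_classE)
        have nc: "n \<in> carrier H" using N_closed[OF _ n(1)] by simp
        have hN: "h \<in> N s"
          using n a N_Suc_subset[OF s] by (auto intro: N_mult[OF s])
        define u where "u = \<phi> \<tau> (\<phi> \<sigma> h) \<otimes>\<^bsub>H\<^esub> inv\<^bsub>H\<^esub> \<phi> \<sigma> h"
        have u: "u \<in> N (Suc s)"
          unfolding u_def using \<tau>(1) s \<sigma>.filtered[OF s hN] by (rule action_trivial)
        have uc: "u \<in> carrier H" using N_closed[OF _ u] by simp
        have hc: "h \<in> carrier H" using s hN by (rule N_closed)
        have \<tau>c: "\<tau> \<in> carrier B" using \<tau> by simp
        interpret \<tau>: filtered_hom H N H N "\<phi> \<tau>" using \<tau>c by (rule action_filtered_hom)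
        have "\<phi> \<sigma>' h = \<phi> \<tau> (\<phi> \<sigma> h)" using \<tau> \<tau>c \<sigma> hc by (simp add: action_mult)
        also have "\<dots> = u \<otimes>\<^bsub>H\<^esub> \<phi> \<sigma> h" using hc by (simp add: u_def m_assoc)
        also have "\<dots> = (u \<otimes>\<^bsub>H\<^esub> \<phi> \<sigma> n) \<otimes>\<^bsub>H\<^esub> \<phi> \<sigma> a" using n nc ac uc by (simp add: m_assoc)
        finally show "\<phi> \<sigma>' h \<in> gr_class H N s (\<phi> \<sigma> a)"
          using N_mult[OF _ u \<sigma>.filtered[OF _ n(1)]] by (auto simp: gr_class_def r_coset_def)
      qed
    qed
    then show ?thesis
      using \<sigma>.gr_map_class[where x = x, OF s a] x s by (simp add: gr_action_def)
  qed (use x in \<open>simp add: gr_action_def gr_map_def\<close>)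
qed

lemma gr_action_extensional: "gr_action H N \<phi> a \<in> extensional (carrier (gr H N))"
  by (simp add: gr_action_def)

lemma gr_action_mult:
  assumes "\<sigma> \<in> carrier B" "\<tau> \<in> carrier B" "x \<in> carrier (gr H N)"
  shows "gr_action H N \<phi> (F #>\<^bsub>B\<^esub> (\<sigma> \<otimes>\<^bsub>B\<^esub> \<tau>)) x
    = gr_action H N \<phi> (F #>\<^bsub>B\<^esub> \<sigma>) (gr_action H N \<phi> (F #>\<^bsub>B\<^esub> \<tau>) x)"
  using assms filtered_hom.gr_map_closed[OF action_filtered_hom[OF assms(2)]]
    gr_map_comp[OF action_filtered_hom[OF assms(2)] action_filtered_hom[OF assms(1)]
      action_mult[OF assms(1,2), symmetric]]
  by (simp add: gr_action_coset)

lemma gr_action_closed: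
  assumes "\<sigma> \<in> carrier B" "x \<in> carrier (gr H N)"
  shows "gr_action H N \<phi> (F #>\<^bsub>B\<^esub> \<sigma>) x \<in> carrier (gr H N)"
  using assms filtered_hom.gr_map_closed[OF action_filtered_hom[OF assms(1)]]
  by (simp add: gr_action_coset)

lemma gr_action_inv:
  assumes "\<sigma> \<in> carrier B" "x \<in> carrier (gr H N)"
  shows "gr_action H N \<phi> (F #>\<^bsub>B\<^esub> inv\<^bsub>B\<^esub> \<sigma>) (gr_action H N \<phi> (F #>\<^bsub>B\<^esub> \<sigma>) x) = x"
  using gr_action_mult[of "inv\<^bsub>B\<^esub> \<sigma>" \<sigma> x] gr_action_coset[of "\<one>\<^bsub>B\<^esub>" x]
    gr_map_id[OF action_one assms(2)] assms by simp

lemma gr_action_Bij: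
  assumes \<sigma>: "\<sigma> \<in> carrier B"
  shows "gr_action H N \<phi> (F #>\<^bsub>B\<^esub> \<sigma>) \<in> Bij (carrier (gr H N))"
proof -
  have "bij_betw (gr_action H N \<phi> (F #>\<^bsub>B\<^esub> \<sigma>)) (carrier (gr H N)) (carrier (gr H N))"
    using gr_action_closed[OF \<sigma>] gr_action_closed[OF acting.inv_closed[OF \<sigma>]]
      gr_action_inv[OF \<sigma>] gr_action_inv[OF acting.inv_closed[OF \<sigma>]] \<sigma>
    by (intro bij_betwI[where g = "gr_action H N \<phi> (F #>\<^bsub>B\<^esub> inv\<^bsub>B\<^esub> \<sigma>)"]) auto
  then show ?thesis using gr_action_extensional by (simp add: Bij_def)
qed

lemma gr_action_graded_lie_hom:
  assumes \<sigma>: "\<sigma> \<in> carrier B"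
  shows "gr_action H N \<phi> (F #>\<^bsub>B\<^esub> \<sigma>) \<in> graded_lie_hom (gr H N) (gr H N)"
proof -
  interpret \<sigma>: filtered_hom H N H N "\<phi> \<sigma>" using \<sigma> by (rule action_filtered_hom)
  have closed: "x \<otimes>\<^bsub>gr H N\<^esub> y \<in> carrier (gr H N)"
    if "x \<in> carrier (gr H N)" "y \<in> carrier (gr H N)" for x y
    using that comm_group_gr by (simp add: comm_group_def group.is_monoid monoid.m_closed)
  show ?thesis
    using \<sigma>.gr_map_graded_lie_hom gr_action_coset[OF \<sigma>] closed bracket_gr_closed homog_closed
    by (simp add: graded_lie_hom_def hom_def Pi_iff image_subset_iff)
qed

lemma graded_lie_action_gr:
  "graded_lie_action (B Mod F) (gr H N) (gr_action H N \<phi>)"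
  unfolding graded_lie_action_def
proof (intro conjI ballI graded_lie_algebra_gr)
  have "group_hom (B Mod F) (BijGroup (carrier (gr H N))) (gr_action H N \<phi>)"
  proof (intro group_hom.intro group_hom_axioms.intro homI group_BijGroup acting.factorgroup_is_group)
    fix a assume "a \<in> carrier (B Mod F)"
    then obtain \<sigma> where \<sigma>: "\<sigma> \<in> carrier B" "a = F #>\<^bsub>B\<^esub> \<sigma>" by (auto simp: carrier_FactGroup)
    then show "gr_action H N \<phi> a \<in> carrier (BijGroup (carrier (gr H N)))"
      by (simp add: BijGroup_def gr_action_Bij)
    fix b assume "b \<in> carrier (B Mod F)"
    then obtain \<tau> where \<tau>: "\<tau> \<in> carrier B" "b = F #>\<^bsub>B\<^esub> \<tau>" by (auto simp: carrier_FactGroup)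
    have "gr_action H N \<phi> (F #>\<^bsub>B\<^esub> (\<sigma> \<otimes>\<^bsub>B\<^esub> \<tau>)) = compose (carrier (gr H N))
        (gr_action H N \<phi> (F #>\<^bsub>B\<^esub> \<sigma>)) (gr_action H N \<phi> (F #>\<^bsub>B\<^esub> \<tau>))"
      using gr_action_mult[OF \<sigma>(1) \<tau>(1)]
      by (intro extensionalityI[OF gr_action_extensional compose_extensional]) (simp add: compose_eq)
    then show "gr_action H N \<phi> (a \<otimes>\<^bsub>B Mod F\<^esub> b)
      = gr_action H N \<phi> a \<otimes>\<^bsub>BijGroup (carrier (gr H N))\<^esub> gr_action H N \<phi> b"
      using \<sigma> \<tau> by (simp add: BijGroup_def gr_action_Bij acting.rcos_sum)
  qed
  then show "group_action (B Mod F) (carrier (gr H N)) (gr_action H N \<phi>)"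
    by (rule group_action.intro)
  show "gr_action H N \<phi> a \<in> graded_lie_hom (gr H N) (gr H N)" if "a \<in> carrier (B Mod F)" for a
    using that gr_action_graded_lie_hom by (auto simp: carrier_FactGroup)
qed

end

text \<open>On a coset of \<sigma> both composites are maps induced by one map on group elements,
  once factored through the action on the source and once through the action on the target.\<close>

lemma gr_map_equivariant:
  assumes "filtered_action H N F B \<phi>" "filtered_action K M F B \<psi>" "filtered_hom H N K M f"
    and equivariant: "\<And>\<sigma> x. \<lbrakk>\<sigma> \<in> carrier B; x \<in> carrier H\<rbrakk> \<Longrightarrow> f (\<phi> \<sigma> x) = \<psi> \<sigma> (f x)"
  shows "gr_map K M f \<in> equivariant_graded_lie_hom (B Mod F)
    (gr H N) (gr_action H N \<phi>) (gr K M) (gr_action K M \<psi>)"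
proof -
  interpret H: filtered_action H N F B \<phi> by fact
  interpret K: filtered_action K M F B \<psi> by fact
  interpret f: filtered_hom H N K M f by fact
  have "gr_map K M f (gr_action H N \<phi> (F #>\<^bsub>B\<^esub> \<sigma>) x) = gr_action K M \<psi> (F #>\<^bsub>B\<^esub> \<sigma>) (gr_map K M f x)"
    if \<sigma>: "\<sigma> \<in> carrier B" and x: "x \<in> carrier (gr H N)" for \<sigma> x
  proof -
    have "gr_map K M f (gr_map H N (\<phi> \<sigma>) x) = gr_map K M (\<lambda>x. f (\<phi> \<sigma> x)) x"
      using x by (intro gr_map_comp[OF H.action_filtered_hom[OF \<sigma>] f.filtered_hom_axioms]) simp_all
    also have "\<dots> = gr_map K M (\<psi> \<sigma>) (gr_map K M f x)"
      using x \<sigma>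
      by (intro gr_map_comp[OF f.filtered_hom_axioms K.action_filtered_hom[OF \<sigma>], symmetric])
        (simp_all add: equivariant)
    finally show ?thesis
      using \<sigma> x by (simp add: H.gr_action_coset K.gr_action_coset f.gr_map_closed)
  qed
  then show ?thesis
    using f.gr_map_graded_lie_hom
    by (auto simp: equivariant_graded_lie_hom_def carrier_FactGroup)
qed

section \<open>The lower central series\<close>

lemma lcs_Suc: "1 \<le> s \<Longrightarrow> lcs H (Suc s) = commutator_subgroup H (lcs H s) (carrier H)"
  by (cases s) simp_all

lemma lcs_one: "lcs H 1 = carrier H"
  by (simp add: One_nat_def)

lemma (in group_hom) image_commutator_subgroup:
  assumes "A \<subseteq> carrier G" "B \<subseteq> carrier G"
  shows "h ` commutator_subgroup G A B = commutator_subgroup H (h ` A) (h ` B)"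
proof -
  have "{commutator G x y |x y. x \<in> A \<and> y \<in> B} \<subseteq> carrier G"
    using assms by auto
  moreover have "h ` {commutator G x y |x y. x \<in> A \<and> y \<in> B}
      = {commutator H x y |x y. x \<in> h ` A \<and> y \<in> h ` B}" (is "?L = ?R")
  proof -
    have eq: "h (commutator G x y) = commutator H (h x) (h y)" if "x \<in> A" "y \<in> B" for x y
      using that assms by (intro G.commutator_hom[OF H.is_group homh]) auto
    then have "?L \<subseteq> ?R" by auto
    moreover have "?R \<subseteq> ?L"
      using eq by (force simp flip: eq)
    ultimately show ?thesis by (rule equalityI)
  qed
  ultimately show ?thesis
    by (simp add: commutator_subgroup_def flip: generate_img)
qed

lemma commutator_subgroup_mono:
  assumes "group H" "A \<subseteq> A'" "B \<subseteq> B'" "A' \<subseteq> carrier H" "B' \<subseteq> carrier H"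
  shows "commutator_subgroup H A B \<subseteq> commutator_subgroup H A' B'"
proof -
  interpret group H by fact
  show ?thesis
    unfolding commutator_subgroup_def using assms by (intro mono_generate) auto
qed

context group
begin

text \<open>Solves a Hall-Witt product for its middle factor.\<close>

lemma eq_inv_mult_inv:
  assumes "a \<otimes> b \<otimes> c = \<one>" and "a \<in> carrier G" "b \<in> carrier G" "c \<in> carrier G"
  shows "b = inv a \<otimes> inv c"
proof -
  have "inv c = a \<otimes> b" using assms by (intro inv_equality) simp_all
  then show ?thesis using assms by simp
qed

lemma commutator_subgroup_subgroup:
  assumes "A \<subseteq> carrier G" "B \<subseteq> carrier G"
  shows "subgroup (commutator_subgroup G A B) G"
  unfolding commutator_subgroup_def using assms by (intro generate_is_subgroup) auto

lemma lcs_subgroup: "subgroup (lcs G s) G"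
proof (induction s)
  case (Suc s)
  then show ?case
    by (cases s) (simp_all add: subgroup_self commutator_subgroup_subgroup subgroup.subset)
qed (simp add: subgroup_self)

lemma lcs_subset: "lcs G s \<subseteq> carrier G"
  using lcs_subgroup by (rule subgroup.subset)

lemma lcs_hom:
  assumes "group K" "f \<in> hom G K"
  shows "f ` lcs G s \<subseteq> lcs K s"
proof -
  interpret f: group_hom G K f
    using assms by (simp add: group_hom_def group_hom_axioms_def)
  show ?thesis
  proof (induction s)
    case (Suc s)
    show ?case
    proof (cases "s = 0")
      case False
      then have "f ` lcs G (Suc s) = commutator_subgroup K (f ` lcs G s) (f ` carrier G)"
        using lcs_subset by (simp add: lcs_Suc f.image_commutator_subgroup)
      also have "\<dots> \<subseteq> commutator_subgroup K (lcs K s) (carrier K)"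
        using Suc group.lcs_subset[OF assms(1)] assms(1) by (intro commutator_subgroup_mono) auto
      finally show ?thesis using False by (simp add: lcs_Suc)
    qed auto
  qed auto
qed

text \<open>For a surjection the generating commutators of the target are exactly the images of
  those of the source. Applied to \<open>out_proj G\<close>, this exhibits the lower central series
  of the outer Torelli group as an image filtration.\<close>

lemma lcs_image:
  assumes "group K" "f \<in> hom G K" "f ` carrier G = carrier K"
  shows "f ` lcs G s = lcs K s"
proof -
  interpret f: group_hom G K f
    using assms by (simp add: group_hom_def group_hom_axioms_def)
  show ?thesis
  proof (induction s)
    case (Suc s)
    show ?case
    proof (cases "s = 0")
      case False
      then show ?thesis
        using lcs_subset Suc assms(3) by (simp add: lcs_Suc f.image_commutator_subgroup)
    qed (use assms(3) in auto)
  qed (use assms(3) in auto)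
qed

lemma conjugation_hom:
  assumes "x \<in> carrier G"
  shows "(\<lambda>y. x \<otimes> y \<otimes> inv x) \<in> hom G G"
  using assms by (intro homI) (simp_all add: m_assoc)

lemma lcs_conjugate:
  "\<lbrakk>x \<in> carrier G; y \<in> lcs G s\<rbrakk> \<Longrightarrow> x \<otimes> y \<otimes> inv x \<in> lcs G s"
  using lcs_hom[OF is_group conjugation_hom] by blast

lemma lcs_mult: "\<lbrakk>x \<in> lcs G s; y \<in> lcs G s\<rbrakk> \<Longrightarrow> x \<otimes> y \<in> lcs G s"
  and lcs_inv: "x \<in> lcs G s \<Longrightarrow> inv x \<in> lcs G s"
  using lcs_subgroup by (simp_all add: subgroup.m_closed subgroup.m_inv_closed)

lemma lcs_closed: "x \<in> lcs G s \<Longrightarrow> x \<in> carrier G"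
  using lcs_subset by blast

lemma commutator_mem_lcs_Suc:
  "\<lbrakk>1 \<le> s; x \<in> lcs G s; y \<in> carrier G\<rbrakk> \<Longrightarrow> commutator G x y \<in> lcs G (Suc s)"
  by (auto simp: lcs_Suc commutator_subgroup_def intro: generate.incl)

text \<open>The working principle for statements about all of \<open>lcs G (Suc s)\<close>: show
  that the elements with the desired property form a subgroup, then check single
  commutators.\<close>

lemma lcs_Suc_subset_subgroup:
  assumes "1 \<le> s" "subgroup K G"
    and "\<And>x y. \<lbrakk>x \<in> lcs G s; y \<in> carrier G\<rbrakk> \<Longrightarrow> commutator G x y \<in> K"
  shows "lcs G (Suc s) \<subseteq> K"
  unfolding lcs_Suc[OF assms(1)] commutator_subgroup_def
  using assms(2,3) by (intro generate_subgroup_incl) auto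

lemma lcs_Suc_subset: "1 \<le> s \<Longrightarrow> lcs G (Suc s) \<subseteq> lcs G s"
proof (rule lcs_Suc_subset_subgroup[OF _ lcs_subgroup])
  fix x y assume x: "x \<in> lcs G s" and y: "y \<in> carrier G"
  have "commutator G x y = x \<otimes> (y \<otimes> inv x \<otimes> inv y)"
    using x y lcs_closed by (simp add: commutator_def m_assoc)
  then show "commutator G x y \<in> lcs G s"
    using x y by (simp add: lcs_mult lcs_conjugate lcs_inv)
qed

text \<open>In the induction step the Hall--Witt identity writes \<open>[[y, z], x]\<close> in terms of
  \<open>[[u, y], _]\<close> and \<open>[[z, u], _]\<close>, where \<open>u\<close> is a conjugate of \<open>x\<close>.\<close>

lemma lcs_commutator:
  assumes "1 \<le> s" "1 \<le> t" "x \<in> lcs G s" "y \<in> lcs G t"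
  shows "commutator G x y \<in> lcs G (s + t)"
  using assms(2,1,3,4)
proof (induction t arbitrary: s x y rule: dec_induct)
  case base
  then show ?case using commutator_mem_lcs_Suc[of s x y] by (simp add: One_nat_def)
next
  case (step t)
  let ?K = "lcs G (s + Suc t)"
  have xc: "x \<in> carrier G" using step.prems(2) by (rule lcs_closed)
  \<comment> \<open>Closure under products and inverses reduces the claim to \<open>w\<close> a
    generating commutator \<open>[y, z]\<close> of \<open>lcs G (Suc t)\<close>. The conjugates that
    arise are absorbed because \<open>?K\<close> is normal.\<close>
  have "subgroup {w \<in> carrier G. commutator G x w \<in> ?K} G"
  proof (rule subgroupI)
    have "commutator G x \<one> \<in> ?K" using xc lcs_subgroup by (simp add: subgroup.one_closed)
    then show "{w \<in> carrier G. commutator G x w \<in> ?K} \<noteq> {}" by blast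
  next
    fix w assume w: "w \<in> {w \<in> carrier G. commutator G x w \<in> ?K}"
    then show "inv w \<in> {w \<in> carrier G. commutator G x w \<in> ?K}"
      using xc lcs_conjugate[of "inv w" "inv (commutator G x w)" "s + Suc t"]
      by (simp add: commutator_inv_right lcs_inv)
    fix v assume v: "v \<in> {w \<in> carrier G. commutator G x w \<in> ?K}"
    have "commutator G x (w \<otimes> v)
        = commutator G x w \<otimes> (commutator G w (commutator G x v) \<otimes> commutator G x v)"
      using w v xc by (simp add: commutator_mult_right m_assoc)
    also have "\<dots> = commutator G x w \<otimes> (w \<otimes> commutator G x v \<otimes> inv w)"
      using w v xc by (simp add: conjugate_eq_commutator)
    finally have "commutator G x (w \<otimes> v)
        = commutator G x w \<otimes> (w \<otimes> commutator G x v \<otimes> inv w)" .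
    then show "w \<otimes> v \<in> {w \<in> carrier G. commutator G x w \<in> ?K}"
      using w v lcs_mult[of _ "s + Suc t"] lcs_conjugate[of w "commutator G x v" "s + Suc t"] by simp
  qed auto
  moreover have "commutator G x (commutator G y z) \<in> ?K" if y: "y \<in> lcs G t" and z: "z \<in> carrier G" for y z
  proof -
    have yc: "y \<in> carrier G" using y by (rule lcs_closed)
    \<comment> \<open>Chosen so that the conjugate of \<open>u\<close> by \<open>z\<close>, the
      second entry of the middle Hall-Witt factor, is exactly \<open>x\<close>.\<close>
    define u where "u = inv z \<otimes> x \<otimes> z"
    have u: "u \<in> lcs G s" unfolding u_def using lcs_conjugate[of "inv z" x s] z step.prems by simp
    have uc: "u \<in> carrier G" using u by (rule lcs_closed)
    have x_eq: "z \<otimes> u \<otimes> inv z = x" using z xc by (simp add: u_def m_assoc)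
    let ?a = "commutator G (commutator G u y) (y \<otimes> z \<otimes> inv y)"
      and ?c = "commutator G (commutator G z u) (u \<otimes> y \<otimes> inv u)"
    have "commutator G u y \<in> lcs G (s + t)" using step.IH[OF step.prems(1) u y] .
    then have a: "?a \<in> ?K"
      using commutator_mem_lcs_Suc[of "s + t"] step.prems(1) z yc by simp
    have "commutator G z u \<in> lcs G (Suc s)"
      using commutator_mem_lcs_Suc[OF step.prems(1) u z] lcs_inv[of "commutator G u z"] uc z
      by (simp add: inv_commutator)
    \<comment> \<open>The first entry has degree s + 1, so the induction hypothesis is used at s + 1
      with the same t; this is why \<open>s\<close> is generalized.\<close>
    then have c: "?c \<in> ?K"
      using step.IH[of "Suc s" "commutator G z u" "u \<otimes> y \<otimes> inv u"] lcs_conjugate[OF uc y] by simp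
    have "?a \<otimes> commutator G (commutator G y z) x \<otimes> ?c = \<one>"
      using hall_witt[OF uc yc z] by (simp add: x_eq)
    then have "commutator G (commutator G y z) x = inv ?a \<otimes> inv ?c"
      using uc yc z xc by (intro eq_inv_mult_inv) simp_all
    then have "commutator G (commutator G y z) x \<in> ?K" using a c by (simp add: lcs_mult lcs_inv)
    then show ?thesis
      using lcs_inv[of "commutator G (commutator G y z) x"] xc yc z by (simp add: inv_commutator)
  qed
  ultimately have "lcs G (Suc t) \<subseteq> {w \<in> carrier G. commutator G x w \<in> ?K}"
    using step.hyps lcs_closed by (intro lcs_Suc_subset_subgroup) auto
  then show ?case using step.prems by blast
qed

lemma central_filtration_lcs: "central_filtration G (lcs G)"
  by (intro central_filtration.intro central_filtration_axioms.intro is_group)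
    (simp_all add: lcs_one lcs_subgroup lcs_Suc_subset lcs_commutator)

end

text \<open>Bracketing with \<open>N 1\<close>, the whole group, raises the degree by one, so the
  inclusion propagates from degree 1. It makes the identity maps underlying \<open>\<iota>\<close>
  and \<open>\<iota>'\<close> filtered.\<close>

lemma (in central_filtration) lcs_subset_filtration:
  assumes "1 \<le> s"
  shows "lcs H s \<subseteq> N s"
  using assms
proof (induction s rule: dec_induct)
  case base
  then show ?case using N_one by (simp add: lcs_one)
next
  case (step s)
  then show ?case
    using N_subgroup[of "Suc s"] N_commutator[of s 1] N_one
    by (intro lcs_Suc_subset_subgroup) (auto simp flip: Suc_eq_plus1)
qed

lemma filtered_hom_lcs:
  assumes "group H" "group K" "f \<in> hom H K"
  shows "filtered_hom H (lcs H) K (lcs K) f"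
proof -
  interpret dom: central_filtration H "lcs H" using assms(1) by (rule group.central_filtration_lcs)
  interpret cod: central_filtration K "lcs K" using assms(2) by (rule group.central_filtration_lcs)
  show ?thesis
    by (intro filtered_hom.intro filtered_hom_axioms.intro dom.central_filtration_axioms
        cod.central_filtration_axioms assms(3)) (use dom.lcs_hom[OF assms(2,3)] in auto)
qed


section \<open>Filtrations and actions on images and on normal subgroups\<close>

lemma filtered_hom_image:
  assumes "central_filtration H N" "group K" "p \<in> hom H K" "p ` carrier H = carrier K"
  shows "filtered_hom H N K (\<lambda>s. p ` N s) p"
proof -
  interpret central_filtration H N by fact
  interpret p: group_hom H K p
    using assms(2,3) by (simp add: group_hom_def group_hom_axioms_def)
  show ?thesis
  proof (intro filtered_hom.intro filtered_hom_axioms.intro central_filtration.intro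
      central_filtration_axioms.intro assms)
    show "p ` N 1 = carrier K" using assms(4) N_one by simp
    show "subgroup (p ` N s) K" if "1 \<le> s" for s
      using N_subgroup[OF that] by (rule p.subgroup_img_is_subgroup)
    show "p ` N (Suc s) \<subseteq> p ` N s" if "1 \<le> s" for s
      using N_Suc_subset[OF that] by blast
    fix s t x y assume st: "1 \<le> s" "1 \<le> t" and "x \<in> p ` N s" "y \<in> p ` N t"
    then obtain a b where "a \<in> N s" "x = p a" "b \<in> N t" "y = p b" by blast
    then show "commutator K x y \<in> p ` N (s + t)"
      using st N_commutator[of s t a b] N_closed commutator_hom[OF assms(2,3), of a b] by force
  qed (use assms in \<open>auto simp: central_filtration_def central_filtration_axioms_def\<close>)
qed

text \<open>As \<open>p\<close> is onto, \<psi> is determined on the target by \<phi>, and each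
  condition is the image under \<open>p\<close> of the corresponding one upstairs. The outer actions
  arise in this way.\<close>

lemma filtered_action_image:
  assumes "filtered_action H N F B \<phi>" "group K" "p \<in> hom H K" "p ` carrier H = carrier K"
    and \<psi>: "\<And>\<sigma> x. \<lbrakk>\<sigma> \<in> carrier B; x \<in> carrier H\<rbrakk> \<Longrightarrow> \<psi> \<sigma> (p x) = p (\<phi> \<sigma> x)"
  shows "filtered_action K (\<lambda>s. p ` N s) F B \<psi>"
proof -
  interpret H: filtered_action H N F B \<phi> by fact
  interpret p: filtered_hom H N K "\<lambda>s. p ` N s" p
    by (rule filtered_hom_image) (use assms in \<open>simp_all add: H.central_filtration_axioms\<close>)
  have \<phi>_closed: "\<phi> \<sigma> x \<in> carrier H" if "\<sigma> \<in> carrier B" "x \<in> carrier H" for \<sigma> x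
    using filtered_hom.hom[OF H.action_filtered_hom[OF that(1)]] that(2) by (rule hom_in_carrier)
  have lift: "\<exists>x\<in>carrier H. y = p x" if "y \<in> carrier K" for y
    using that assms(4) by blast
  show ?thesis
  proof (intro filtered_action.intro filtered_action_axioms.intro p.cod.central_filtration_axioms
      H.acting.normal_axioms)
    fix \<sigma> assume \<sigma>: "\<sigma> \<in> carrier B"
    interpret \<sigma>: filtered_hom H N H N "\<phi> \<sigma>" using \<sigma> by (rule H.action_filtered_hom)
    show "filtered_hom K (\<lambda>s. p ` N s) K (\<lambda>s. p ` N s) (\<psi> \<sigma>)"
    proof (intro filtered_hom.intro filtered_hom_axioms.intro p.cod.central_filtration_axioms)
      show "\<psi> \<sigma> \<in> hom K K"
        using \<psi>[OF \<sigma>] by (intro homI) (auto dest!: lift simp flip: p.hom_mult)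
      show "\<psi> \<sigma> y \<in> p ` N s" if "1 \<le> s" "y \<in> p ` N s" for s y
        using that \<psi>[OF \<sigma>] \<sigma>.filtered H.N_closed by auto
    qed
  next
    show "\<psi> \<one>\<^bsub>B\<^esub> y = y" if "y \<in> carrier K" for y
      using lift[OF that] \<psi>[of "\<one>\<^bsub>B\<^esub>"] by (auto simp: H.action_one)
    show "\<psi> (\<sigma> \<otimes>\<^bsub>B\<^esub> \<tau>) y = \<psi> \<sigma> (\<psi> \<tau> y)"
      if "\<sigma> \<in> carrier B" "\<tau> \<in> carrier B" "y \<in> carrier K" for \<sigma> \<tau> y
      using lift[OF that(3)] that(1,2) by (auto simp: \<psi> H.action_mult \<phi>_closed)
    show "\<psi> \<tau> y \<otimes>\<^bsub>K\<^esub> inv\<^bsub>K\<^esub> y \<in> p ` N (Suc s)" if "\<tau> \<in> F" "1 \<le> s" and y: "y \<in> p ` N s" for \<tau> s y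
    proof -
      obtain x where x: "x \<in> N s" "y = p x" using y by blast
      have c: "\<tau> \<in> carrier B" "x \<in> carrier H"
        using that(1) H.N_closed[OF that(2) x(1)] by simp_all
      then have "\<psi> \<tau> y \<otimes>\<^bsub>K\<^esub> inv\<^bsub>K\<^esub> y = p (\<phi> \<tau> x \<otimes>\<^bsub>H\<^esub> inv\<^bsub>H\<^esub> x)"
        by (simp add: x \<psi> \<phi>_closed)
      then show ?thesis using H.action_trivial[OF that(1,2) x(1)] by simp
    qed
  qed
qed

text \<open>Elements \<tau> of \<open>T\<close> act trivially on the graded pieces because they have
  degree 1: the displacement of \<open>x\<close> under conjugation by \<tau> is the commutator of
  \<tau> and \<open>x\<close>.\<close>

lemma filtered_action_conjugation:
  assumes "T \<lhd> B" "central_filtration (B\<lparr>carrier := T\<rparr>) N"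
    and inv: "\<And>\<sigma> s x. \<lbrakk>\<sigma> \<in> carrier B; 1 \<le> s; x \<in> N s\<rbrakk> \<Longrightarrow> \<sigma> \<otimes>\<^bsub>B\<^esub> x \<otimes>\<^bsub>B\<^esub> inv\<^bsub>B\<^esub> \<sigma> \<in> N s"
  shows "filtered_action (B\<lparr>carrier := T\<rparr>) N T B (\<lambda>\<sigma> x. \<sigma> \<otimes>\<^bsub>B\<^esub> x \<otimes>\<^bsub>B\<^esub> inv\<^bsub>B\<^esub> \<sigma>)"
proof -
  interpret T: normal T B by fact
  interpret N: central_filtration "B\<lparr>carrier := T\<rparr>" N by fact
  show ?thesis
  proof (intro filtered_action.intro filtered_action_axioms.intro assms(1,2))
    fix \<sigma> assume \<sigma>: "\<sigma> \<in> carrier B"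
    show "filtered_hom (B\<lparr>carrier := T\<rparr>) N (B\<lparr>carrier := T\<rparr>) N (\<lambda>x. \<sigma> \<otimes>\<^bsub>B\<^esub> x \<otimes>\<^bsub>B\<^esub> inv\<^bsub>B\<^esub> \<sigma>)"
    proof (intro filtered_hom.intro filtered_hom_axioms.intro assms(2))
      show "(\<lambda>x. \<sigma> \<otimes>\<^bsub>B\<^esub> x \<otimes>\<^bsub>B\<^esub> inv\<^bsub>B\<^esub> \<sigma>) \<in> hom (B\<lparr>carrier := T\<rparr>) (B\<lparr>carrier := T\<rparr>)"
      proof (rule homI)
        show "\<sigma> \<otimes>\<^bsub>B\<^esub> x \<otimes>\<^bsub>B\<^esub> inv\<^bsub>B\<^esub> \<sigma> \<in> carrier (B\<lparr>carrier := T\<rparr>)"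
          if "x \<in> carrier (B\<lparr>carrier := T\<rparr>)" for x
          using \<sigma> that by (simp add: T.inv_op_closed2)
      qed (use \<sigma> in \<open>simp add: T.m_assoc\<close>)
    qed (use \<sigma> inv in auto)
  next
    show "\<tau> \<otimes>\<^bsub>B\<^esub> x \<otimes>\<^bsub>B\<^esub> inv\<^bsub>B\<^esub> \<tau> \<otimes>\<^bsub>B\<lparr>carrier := T\<rparr>\<^esub> inv\<^bsub>B\<lparr>carrier := T\<rparr>\<^esub> x \<in> N (Suc s)"
      if "\<tau> \<in> T" "1 \<le> s" "x \<in> N s" for \<tau> s x
    proof -
      have "x \<in> T" using N.N_closed[OF that(2,3)] by simp
      then have "\<tau> \<otimes>\<^bsub>B\<^esub> x \<otimes>\<^bsub>B\<^esub> inv\<^bsub>B\<^esub> \<tau> \<otimes>\<^bsub>B\<lparr>carrier := T\<rparr>\<^esub> inv\<^bsub>B\<lparr>carrier := T\<rparr>\<^esub> x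
          = commutator (B\<lparr>carrier := T\<rparr>) \<tau> x"
        using that(1) by (simp add: commutator_def T.is_subgroup)
      then show ?thesis
        using N.N_commutator[of 1 s \<tau> x] that N.N_one by (simp flip: Suc_eq_plus1_left)
    qed
  qed (simp_all add: T.m_assoc T.inv_mult_group)
qed

section \<open>The Johnson filtration\<close>

context group
begin

section \<open>Automorphisms evaluated at elements\<close>

lemma auto_closed: "\<lbrakk>\<alpha> \<in> auto G; x \<in> carrier G\<rbrakk> \<Longrightarrow> \<alpha> x \<in> carrier G"
  by (auto simp: auto_def hom_def)

lemma auto_group_hom: "\<alpha> \<in> auto G \<Longrightarrow> group_hom G G \<alpha>"
  by (simp add: group_hom_def group_hom_axioms_def auto_def)

lemma auto_eqI:
  "\<lbrakk>\<alpha> \<in> auto G; \<beta> \<in> auto G; \<And>x. x \<in> carrier G \<Longrightarrow> \<alpha> x = \<beta> x\<rbrakk> \<Longrightarrow> \<alpha> = \<beta>"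
  by (auto simp: auto_def Bij_def intro: extensionalityI)

lemma carrier_AutoGroup: "carrier (AutoGroup G) = auto G"
  by (simp add: AutoGroup_def)

lemma AutoGroup_mult_apply:
  "\<lbrakk>\<alpha> \<in> auto G; \<beta> \<in> auto G; x \<in> carrier G\<rbrakk> \<Longrightarrow> (\<alpha> \<otimes>\<^bsub>AutoGroup G\<^esub> \<beta>) x = \<alpha> (\<beta> x)"
  by (simp add: AutoGroup_def BijGroup_def auto_def compose_eq)

lemma AutoGroup_one_apply: "x \<in> carrier G \<Longrightarrow> \<one>\<^bsub>AutoGroup G\<^esub> x = x"
  by (simp add: AutoGroup_def BijGroup_def)

lemma auto_mult: "\<lbrakk>\<alpha> \<in> auto G; \<beta> \<in> auto G\<rbrakk> \<Longrightarrow> \<alpha> \<otimes>\<^bsub>AutoGroup G\<^esub> \<beta> \<in> auto G"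
  and auto_inv: "\<alpha> \<in> auto G \<Longrightarrow> inv\<^bsub>AutoGroup G\<^esub> \<alpha> \<in> auto G"
  using monoid.m_closed[OF group.is_monoid[OF AutoGroup], of \<alpha> \<beta>] group.inv_closed[OF AutoGroup, of \<alpha>]
  by (simp_all add: carrier_AutoGroup)

lemma AutoGroup_inv_apply:
  assumes "\<alpha> \<in> auto G" "x \<in> carrier G"
  shows "\<alpha> ((inv\<^bsub>AutoGroup G\<^esub> \<alpha>) x) = x" "(inv\<^bsub>AutoGroup G\<^esub> \<alpha>) (\<alpha> x) = x"
  using group.r_inv[OF AutoGroup, of \<alpha>] group.l_inv[OF AutoGroup, of \<alpha>] assms
  by (simp_all add: carrier_AutoGroup auto_inv AutoGroup_one_apply flip: AutoGroup_mult_apply)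

lemma auto_lcs: "\<lbrakk>\<alpha> \<in> auto G; x \<in> lcs G s\<rbrakk> \<Longrightarrow> \<alpha> x \<in> lcs G s"
  using lcs_hom[OF is_group, of \<alpha>] by (auto simp: auto_def)

lemma johnson_auto: "\<alpha> \<in> johnson G s \<Longrightarrow> \<alpha> \<in> auto G"
  by (simp add: johnson_def carrier_AutoGroup)

lemma johnson_apply: "\<lbrakk>\<alpha> \<in> johnson G s; x \<in> carrier G\<rbrakk> \<Longrightarrow> \<alpha> x \<otimes> inv x \<in> lcs G (Suc s)"
  by (simp add: johnson_def)

lemma johnsonI:
  "\<lbrakk>\<alpha> \<in> auto G; \<And>x. x \<in> carrier G \<Longrightarrow> \<alpha> x \<otimes> inv x \<in> lcs G (Suc s)\<rbrakk> \<Longrightarrow> \<alpha> \<in> johnson G s"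
  by (simp add: johnson_def carrier_AutoGroup)

lemma johnson_zero: "johnson G 0 = auto G"
  by (auto simp: johnson_def carrier_AutoGroup auto_closed)

lemma johnson_subgroup: "subgroup (johnson G s) (AutoGroup G)"
proof (rule group.subgroupI[OF AutoGroup])
  show "johnson G s \<subseteq> carrier (AutoGroup G)"
    by (auto simp: carrier_AutoGroup johnson_auto)
  have "\<one>\<^bsub>AutoGroup G\<^esub> \<in> auto G"
    using group.is_monoid[OF AutoGroup] monoid.one_closed by (metis carrier_AutoGroup)
  then have "\<one>\<^bsub>AutoGroup G\<^esub> \<in> johnson G s"
    using subgroup.one_closed[OF lcs_subgroup] by (intro johnsonI) (simp_all add: AutoGroup_one_apply)
  then show "johnson G s \<noteq> {}" by blast
next
  fix \<alpha> assume \<alpha>: "\<alpha> \<in> johnson G s"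
  note \<alpha>a = johnson_auto[OF \<alpha>]
  show "inv\<^bsub>AutoGroup G\<^esub> \<alpha> \<in> johnson G s"
  proof (rule johnsonI)
    fix x assume x: "x \<in> carrier G"
    define z where "z = (inv\<^bsub>AutoGroup G\<^esub> \<alpha>) x"
    have z: "z \<in> carrier G" "\<alpha> z = x"
      using \<alpha>a x by (simp_all add: z_def auto_closed auto_inv AutoGroup_inv_apply)
    have "z \<otimes> inv x = inv (\<alpha> z \<otimes> inv z)" using z x by (simp add: inv_mult_group)
    then show "(inv\<^bsub>AutoGroup G\<^esub> \<alpha>) x \<otimes> inv x \<in> lcs G (Suc s)"
      using lcs_inv[OF johnson_apply[OF \<alpha> z(1)]] by (simp flip: z_def)
  qed (simp add: \<alpha>a auto_inv)
  fix \<beta> assume \<beta>: "\<beta> \<in> johnson G s"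
  note \<beta>a = johnson_auto[OF \<beta>]
  show "\<alpha> \<otimes>\<^bsub>AutoGroup G\<^esub> \<beta> \<in> johnson G s"
  proof (rule johnsonI)
    fix x assume x: "x \<in> carrier G"
    have c: "\<beta> x \<in> carrier G" "\<alpha> (\<beta> x) \<in> carrier G" using x \<alpha>a \<beta>a by (simp_all add: auto_closed)
    have "(\<alpha> \<otimes>\<^bsub>AutoGroup G\<^esub> \<beta>) x \<otimes> inv x = (\<alpha> (\<beta> x) \<otimes> inv (\<beta> x)) \<otimes> (\<beta> x \<otimes> inv x)"
      using x c \<alpha>a \<beta>a by (simp add: AutoGroup_mult_apply m_assoc)
    then show "(\<alpha> \<otimes>\<^bsub>AutoGroup G\<^esub> \<beta>) x \<otimes> inv x \<in> lcs G (Suc s)"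
      using lcs_mult[OF johnson_apply[OF \<alpha> c(1)] johnson_apply[OF \<beta> x]] by simp
  qed (simp add: \<alpha>a \<beta>a auto_mult)
qed

text \<open>At a point x = \<sigma>(y) the displacement under the conjugate is \<sigma> applied to
  the displacement of y under \<alpha>, and automorphisms preserve the lower central series.\<close>

lemma johnson_conjugate:
  assumes \<sigma>: "\<sigma> \<in> auto G" and \<alpha>: "\<alpha> \<in> johnson G s"
  shows "conj_aut G \<sigma> \<alpha> \<in> johnson G s"
proof (rule johnsonI)
  note \<alpha>a = johnson_auto[OF \<alpha>]
  show "conj_aut G \<sigma> \<alpha> \<in> auto G" by (simp add: conj_aut_def auto_mult auto_inv \<sigma> \<alpha>a)
  interpret \<sigma>: group_hom G G \<sigma> using \<sigma> by (rule auto_group_hom)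
  fix x assume x: "x \<in> carrier G"
  define y where "y = (inv\<^bsub>AutoGroup G\<^esub> \<sigma>) x"
  have y: "y \<in> carrier G" "x = \<sigma> y"
    using \<sigma> x by (simp_all add: y_def auto_closed auto_inv AutoGroup_inv_apply)
  have "conj_aut G \<sigma> \<alpha> x = \<sigma> (\<alpha> y)"
    using \<sigma> \<alpha>a x by (simp add: conj_aut_def AutoGroup_mult_apply auto_mult auto_inv auto_closed y_def)
  then have "conj_aut G \<sigma> \<alpha> x \<otimes> inv x = \<sigma> (\<alpha> y \<otimes> inv y)"
    using y \<alpha>a by (simp add: auto_closed)
  then show "conj_aut G \<sigma> \<alpha> x \<otimes> inv x \<in> lcs G (Suc s)"
    using auto_lcs[OF \<sigma> johnson_apply[OF \<alpha> y(1)]] by simp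
qed

lemma johnson_normal: "johnson G s \<lhd> AutoGroup G"
  using johnson_conjugate
  by (simp add: group.normal_inv_iff[OF AutoGroup] johnson_subgroup carrier_AutoGroup conj_aut_def)

lemma johnson_Suc_subset: "johnson G (Suc s) \<subseteq> johnson G s"
  using lcs_Suc_subset[of "Suc s"] by (auto simp: johnson_def)

lemma johnson_antimono: "s \<le> t \<Longrightarrow> johnson G t \<subseteq> johnson G s"
  using lift_Suc_antimono_le[of "johnson G"] johnson_Suc_subset by blast

lemma lcs_antimono: "\<lbrakk>1 \<le> s; s \<le> t; x \<in> lcs G t\<rbrakk> \<Longrightarrow> x \<in> lcs G s"
  using central_filtration.N_antimono[OF central_filtration_lcs] by blast

text \<open>The case k = 1 is the definition. The general case serves three purposes: strong
  centrality of the Johnson filtration, triviality of the action of \<open>johnson G 1\<close> on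
  the pieces of \<open>lcs G\<close>, and the centrality test for \<open>Ad\<close>.\<close>

lemma johnson_apply_lcs:
  assumes \<alpha>: "\<alpha> \<in> johnson G s" and "1 \<le> s" "1 \<le> k" "x \<in> lcs G k"
  shows "\<alpha> x \<otimes> inv x \<in> lcs G (s + k)"
  using assms(3,4)
proof (induction k arbitrary: x rule: dec_induct)
  case base
  then show ?case using johnson_apply[OF \<alpha>] by (simp add: lcs_one flip: Suc_eq_plus1)
next
  case (step k)
  note \<alpha>a = johnson_auto[OF \<alpha>]
  interpret \<alpha>: group_hom G G \<alpha> using \<alpha>a by (rule auto_group_hom)
  let ?K = "lcs G (s + Suc k)"
  \<comment> \<open>The displacement of a product z w is that of z times a conjugate of that of w,
    so normality of \<open>?K\<close> makes this a subgroup and only generating commutators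
    remain.\<close>
  have "subgroup {z \<in> carrier G. \<alpha> z \<otimes> inv z \<in> ?K} G"
  proof (rule subgroupI)
    have "\<one> \<in> ?K" using lcs_subgroup by (rule subgroup.one_closed)
    then show "{z \<in> carrier G. \<alpha> z \<otimes> inv z \<in> ?K} \<noteq> {}" by force
  next
    fix z assume z: "z \<in> {z \<in> carrier G. \<alpha> z \<otimes> inv z \<in> ?K}"
    have "\<alpha> (inv z) \<otimes> inv (inv z) = inv z \<otimes> inv (\<alpha> z \<otimes> inv z) \<otimes> inv (inv z)"
      using z by (simp add: inv_mult_group m_assoc)
    then show "inv z \<in> {z \<in> carrier G. \<alpha> z \<otimes> inv z \<in> ?K}"
      using z lcs_conjugate[of "inv z" "inv (\<alpha> z \<otimes> inv z)" "s + Suc k"] lcs_inv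
      by (simp del: inv_inv \<alpha>.hom_inv)
    fix w assume w: "w \<in> {z \<in> carrier G. \<alpha> z \<otimes> inv z \<in> ?K}"
    have "\<alpha> (z \<otimes> w) \<otimes> inv (z \<otimes> w) = (\<alpha> z \<otimes> inv z) \<otimes> (z \<otimes> (\<alpha> w \<otimes> inv w) \<otimes> inv z)"
      using z w by (simp add: inv_mult_group m_assoc)
    then show "z \<otimes> w \<in> {z \<in> carrier G. \<alpha> z \<otimes> inv z \<in> ?K}"
      using z w lcs_mult[of _ "s + Suc k"] lcs_conjugate[of z "\<alpha> w \<otimes> inv w" "s + Suc k"] by simp
  qed auto
  moreover have "\<alpha> (commutator G x y) \<otimes> inv (commutator G x y) \<in> ?K"
    if x: "x \<in> lcs G k" and y: "y \<in> carrier G" for x y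
  proof -
    have xc: "x \<in> carrier G" using x by (rule lcs_closed)
    define a where "a = \<alpha> x \<otimes> inv x"
    define b where "b = \<alpha> y \<otimes> inv y"
    have a: "a \<in> lcs G (s + k)" unfolding a_def using x by (rule step.IH)
    have b: "b \<in> lcs G (Suc s)" unfolding b_def using \<alpha> y by (rule johnson_apply)
    have c: "a \<in> carrier G" "b \<in> carrier G" using a b lcs_closed by auto
    have \<alpha>x: "\<alpha> x = a \<otimes> x" and \<alpha>y: "\<alpha> y = b \<otimes> y"
      using xc y by (simp_all add: a_def b_def m_assoc)
    let ?xy = "commutator G x y"
    have xy: "?xy \<in> lcs G (Suc k)" using step.hyps x y by (intro commutator_mem_lcs_Suc)
    \<comment> \<open>The factors other than \<open>[x, y]\<close> in the expansion of
      \<open>[a x, b y]\<close>. Here \<open>a\<close> has degree s + k and \<open>b\<close> degree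
      s + 1, so \<open>?p\<close> and \<open>?u\<close> gain a degree from \<open>a\<close>,
      \<open>?q\<close> pairs k with s + 1, and \<open>?r\<close> pairs s + 1 with k + 1; all reach
      degree s + k + 1.\<close>
    let ?p = "commutator G a (commutator G x (b \<otimes> y))" and ?q = "commutator G x b"
      and ?r = "commutator G b ?xy" and ?u = "commutator G a (b \<otimes> y)"
    have "\<alpha> ?xy = commutator G (a \<otimes> x) (b \<otimes> y)"
      using commutator_hom[OF is_group \<alpha>.homh xc y] by (simp add: \<alpha>x \<alpha>y)
    also have "\<dots> = ?p \<otimes> (?q \<otimes> ?r \<otimes> ?xy) \<otimes> ?u"
      using c xc y by (simp add: commutator_mult_left flip: commutator_mult_right)
    finally have "\<alpha> ?xy \<otimes> inv ?xy = ?p \<otimes> ?q \<otimes> ?r \<otimes> (?xy \<otimes> ?u \<otimes> inv ?xy)"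
      using c xc y by (simp add: m_assoc)
    moreover have "?p \<in> ?K" using commutator_mem_lcs_Suc[OF _ a] step.hyps c xc y by simp
    moreover have "?q \<in> ?K" using lcs_commutator[OF _ _ x b] step.hyps by (simp add: add.commute)
    moreover have "?r \<in> ?K"
      using lcs_commutator[OF _ _ b xy] lcs_antimono[of "s + Suc k" "Suc s + Suc k"] by simp
    moreover have "?u \<in> ?K" using commutator_mem_lcs_Suc[OF _ a] step.hyps c y by simp
    ultimately show ?thesis
      using xc y by (simp add: lcs_mult lcs_conjugate del: add_Suc_right)
  qed
  ultimately have "lcs G (Suc k) \<subseteq> {z \<in> carrier G. \<alpha> z \<otimes> inv z \<in> ?K}"
    using step.hyps lcs_closed by (intro lcs_Suc_subset_subgroup) auto
  then show ?case using step.prems by blast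
qed

lemma johnson_commutator:
  assumes "1 \<le> s" "1 \<le> t" and \<alpha>: "\<alpha> \<in> johnson G s" and \<beta>: "\<beta> \<in> johnson G t"
  shows "commutator (AutoGroup G) \<alpha> \<beta> \<in> johnson G (s + t)"
proof (rule johnsonI)
  note \<alpha>a = johnson_auto[OF \<alpha>] and \<beta>a = johnson_auto[OF \<beta>]
  interpret \<alpha>: group_hom G G \<alpha> using \<alpha>a by (rule auto_group_hom)
  interpret \<beta>: group_hom G G \<beta> using \<beta>a by (rule auto_group_hom)
  show "commutator (AutoGroup G) \<alpha> \<beta> \<in> auto G"
    by (simp add: commutator_def auto_mult auto_inv \<alpha>a \<beta>a)
  fix x assume x: "x \<in> carrier G"
  \<comment> \<open>Writing x = \<beta>(\<alpha>(y)) removes the inverse automorphisms: the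
    displacement of x becomes the quotient of \<alpha>(\<beta>(y)) by \<beta>(\<alpha>(y)).\<close>
  define y where "y = (inv\<^bsub>AutoGroup G\<^esub> \<alpha>) ((inv\<^bsub>AutoGroup G\<^esub> \<beta>) x)"
  have y: "y \<in> carrier G" "x = \<beta> (\<alpha> y)"
    using \<alpha>a \<beta>a x by (simp_all add: y_def auto_closed auto_inv AutoGroup_inv_apply)
  have eq: "commutator (AutoGroup G) \<alpha> \<beta> x = \<alpha> (\<beta> y)"
    using \<alpha>a \<beta>a x by (simp add: commutator_def AutoGroup_mult_apply auto_mult auto_inv auto_closed y_def)
  define a where "a = \<alpha> y \<otimes> inv y"
  define b where "b = \<beta> y \<otimes> inv y"
  have a: "a \<in> lcs G (Suc s)" unfolding a_def using \<alpha> y(1) by (rule johnson_apply)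
  have b: "b \<in> lcs G (Suc t)" unfolding b_def using \<beta> y(1) by (rule johnson_apply)
  have c: "a \<in> carrier G" "b \<in> carrier G" using a b lcs_closed by auto
  have \<alpha>y: "\<alpha> y = a \<otimes> y" and \<beta>y: "\<beta> y = b \<otimes> y"
    using y(1) by (simp_all add: a_def b_def m_assoc)
  have "\<alpha> (\<beta> y) \<otimes> inv (\<beta> (\<alpha> y)) = \<alpha> b \<otimes> (a \<otimes> y) \<otimes> inv (\<beta> a \<otimes> (b \<otimes> y))"
    using c y(1) by (simp add: \<alpha>y \<beta>y)
  \<comment> \<open>The point \<open>y\<close> cancels. Of the three factors, the outer ones are
    displacements of \<open>b\<close> under \<alpha> and of \<open>a\<close> under \<beta>, of
    degree s + t + 1 by \<open>johnson_apply_lcs\<close>; the commutator has degree s + t +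
    2.\<close>
  also have "\<dots> = (\<alpha> b \<otimes> inv b) \<otimes> commutator G b a \<otimes> inv (\<beta> a \<otimes> inv a)"
    using c y(1) by (simp add: commutator_def inv_mult_group m_assoc)
  finally have "commutator (AutoGroup G) \<alpha> \<beta> x \<otimes> inv x
    = (\<alpha> b \<otimes> inv b) \<otimes> commutator G b a \<otimes> inv (\<beta> a \<otimes> inv a)"
    by (simp only: eq flip: y(2))
  moreover have "\<alpha> b \<otimes> inv b \<in> lcs G (Suc (s + t))"
    using johnson_apply_lcs[OF \<alpha> assms(1) _ b] by simp
  moreover have "\<beta> a \<otimes> inv a \<in> lcs G (Suc (s + t))"
    using johnson_apply_lcs[OF \<beta> assms(2) _ a] by (simp add: add.commute)
  moreover have "commutator G b a \<in> lcs G (Suc (s + t))"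
    using lcs_commutator[OF _ _ b a] lcs_antimono[of "Suc (s + t)" "Suc t + Suc s"] by simp
  ultimately show "commutator (AutoGroup G) \<alpha> \<beta> x \<otimes> inv x \<in> lcs G (Suc (s + t))"
    by (simp add: lcs_mult lcs_inv)
qed

lemma torelli_group: "group (torelli G)"
  unfolding torelli_def using johnson_subgroup AutoGroup by (rule subgroup.subgroup_is_group)

lemma central_filtration_johnson: "central_filtration (torelli G) (johnson G)"
proof (intro central_filtration.intro central_filtration_axioms.intro torelli_group johnson_Suc_subset)
  show "johnson G 1 = carrier (torelli G)" by (simp add: torelli_def)
  have sub: "johnson G s \<subseteq> johnson G 1" if "1 \<le> s" for s
    using that by (rule johnson_antimono)
  show "subgroup (johnson G s) (torelli G)" if "1 \<le> s" for s
    unfolding torelli_def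
    using group.subgroup_incl[OF AutoGroup johnson_subgroup johnson_subgroup sub[OF that]] .
  show "commutator (torelli G) \<alpha> \<beta> \<in> johnson G (s + t)"
    if "1 \<le> s" "1 \<le> t" "\<alpha> \<in> johnson G s" "\<beta> \<in> johnson G t" for s t \<alpha> \<beta>
    using group.commutator_consistent[OF AutoGroup johnson_subgroup
        subsetD[OF sub[OF that(1)] that(3)] subsetD[OF sub[OF that(2)] that(4)]]
      johnson_commutator[OF that]
    by (simp add: torelli_def)
qed

lemma lcs_torelli_subset: "1 \<le> s \<Longrightarrow> lcs (torelli G) s \<subseteq> johnson G s"
  using central_filtration.lcs_subset_filtration[OF central_filtration_johnson] .


section \<open>Inner automorphisms and the outer Torelli group\<close>

lemma Ad_apply: "y \<in> carrier G \<Longrightarrow> Ad G x y = x \<otimes> y \<otimes> inv x"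
  by (simp add: Ad_def)

lemma Ad_auto:
  assumes x: "x \<in> carrier G"
  shows "Ad G x \<in> auto G"
proof -
  have "bij_betw (Ad G x) (carrier G) (carrier G)"
    using x by (intro bij_betwI[where g = "Ad G (inv x)"]) (auto simp: Ad_apply m_assoc)
  moreover have "Ad G x \<in> hom G G"
    using x by (intro homI) (simp_all add: Ad_apply m_assoc)
  ultimately show ?thesis by (simp add: auto_def Bij_def Ad_def)
qed

lemma Ad_mult:
  assumes "x \<in> carrier G" "y \<in> carrier G"
  shows "Ad G (x \<otimes> y) = Ad G x \<otimes>\<^bsub>AutoGroup G\<^esub> Ad G y"
  using assms
  by (intro auto_eqI) (simp_all add: Ad_auto auto_mult AutoGroup_mult_apply Ad_apply inv_mult_group m_assoc)

lemma Ad_group_hom: "group_hom G (AutoGroup G) (Ad G)"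
  by (simp add: group_hom_def group_hom_axioms_def AutoGroup hom_def carrier_AutoGroup Ad_auto Ad_mult)

lemma Ad_johnson:
  assumes "1 \<le> s" "x \<in> lcs G s"
  shows "Ad G x \<in> johnson G s"
proof (rule johnsonI)
  have x: "x \<in> carrier G" using assms(2) by (rule lcs_closed)
  then show "Ad G x \<in> auto G" by (rule Ad_auto)
  fix y assume "y \<in> carrier G"
  then show "Ad G x y \<otimes> inv y \<in> lcs G (Suc s)"
    using commutator_mem_lcs_Suc[OF assms] by (simp add: Ad_apply commutator_def)
qed

lemma Ad_conjugate:
  assumes \<sigma>: "\<sigma> \<in> auto G" and x: "x \<in> carrier G"
  shows "Ad G (\<sigma> x) = conj_aut G \<sigma> (Ad G x)"
proof (rule auto_eqI)
  interpret \<sigma>: group_hom G G \<sigma> using \<sigma> by (rule auto_group_hom)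
  show "Ad G (\<sigma> x) \<in> auto G" "conj_aut G \<sigma> (Ad G x) \<in> auto G"
    using \<sigma> x by (simp_all add: conj_aut_def Ad_auto auto_mult auto_inv)
  fix y assume y: "y \<in> carrier G"
  define z where "z = (inv\<^bsub>AutoGroup G\<^esub> \<sigma>) y"
  have z: "z \<in> carrier G" "y = \<sigma> z"
    using \<sigma> y by (simp_all add: z_def auto_closed auto_inv AutoGroup_inv_apply)
  have "conj_aut G \<sigma> (Ad G x) y = \<sigma> (Ad G x z)"
    using \<sigma> x y by (simp add: conj_aut_def AutoGroup_mult_apply auto_mult auto_inv Ad_auto auto_closed z_def)
  then show "Ad G (\<sigma> x) y = conj_aut G \<sigma> (Ad G x) y"
    using x z by (simp add: Ad_apply)
qed

lemma Inn_normal: "Inn G \<lhd> AutoGroup G"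
proof -
  have "subgroup (Inn G) (AutoGroup G)"
    unfolding Inn_def using group_hom.img_is_subgroup[OF Ad_group_hom] .
  moreover have "conj_aut G \<sigma> \<beta> \<in> Inn G" if "\<sigma> \<in> auto G" "\<beta> \<in> Inn G" for \<sigma> \<beta>
    using that by (auto simp: Inn_def auto_closed simp flip: Ad_conjugate)
  ultimately show ?thesis
    by (simp add: group.normal_inv_iff[OF AutoGroup] carrier_AutoGroup conj_aut_def)
qed

lemma Out_group: "group (Out G)"
  unfolding Out_def using Inn_normal by (rule normal.factorgroup_is_group)

lemma out_proj_group_hom: "group_hom (AutoGroup G) (Out G) (out_proj G)"
  using normal.r_coset_hom_Mod[OF Inn_normal]
  by (simp add: group_hom_def group_hom_axioms_def AutoGroup Out_group out_proj_def[abs_def] flip: Out_def)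

lemma out_proj_eqE:
  assumes "\<alpha> \<in> auto G" "\<beta> \<in> auto G" "out_proj G \<alpha> = out_proj G \<beta>"
  obtains x where "x \<in> carrier G" "\<alpha> = Ad G x \<otimes>\<^bsub>AutoGroup G\<^esub> \<beta>"
proof -
  have "\<alpha> \<in> Inn G #>\<^bsub>AutoGroup G\<^esub> \<beta>"
    using group.rcos_self[OF AutoGroup _ normal_imp_subgroup[OF Inn_normal], of \<alpha>] assms
    by (simp add: carrier_AutoGroup out_proj_def)
  then show thesis using that by (auto simp: r_coset_def Inn_def)
qed

lemma out_proj_Ad: "x \<in> carrier G \<Longrightarrow> out_proj G (Ad G x) = \<one>\<^bsub>Out G\<^esub>"
  using group.coset_join2[OF AutoGroup _ normal_imp_subgroup[OF Inn_normal], of "Ad G x"]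
  by (simp add: out_proj_def Out_def carrier_AutoGroup Ad_auto Inn_def)

lemma out_proj_conjugate:
  assumes "\<sigma> \<in> auto G" "\<alpha> \<in> auto G"
  shows "conj_out G \<sigma> (out_proj G \<alpha>) = out_proj G (conj_aut G \<sigma> \<alpha>)"
proof -
  interpret p: group_hom "AutoGroup G" "Out G" "out_proj G" by (rule out_proj_group_hom)
  show ?thesis
    using assms by (simp add: conj_out_def conj_aut_def carrier_AutoGroup auto_mult auto_inv)
qed

lemma outer_torelli_group: "group (outer_torelli G)"
  unfolding outer_torelli_def outer_johnson_def
  using group_hom.subgroup_img_is_subgroup[OF out_proj_group_hom johnson_subgroup] Out_group
  by (rule subgroup.subgroup_is_group)

lemma out_proj_torelli:
  "out_proj G \<in> hom (torelli G) (outer_torelli G)"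
  "out_proj G ` carrier (torelli G) = carrier (outer_torelli G)"
  using group_hom.hom_mult[OF out_proj_group_hom]
  by (auto simp: torelli_def outer_torelli_def outer_johnson_def carrier_AutoGroup johnson_auto
      intro!: homI)

lemma lcs_outer_torelli: "lcs (outer_torelli G) = (\<lambda>s. out_proj G ` lcs (torelli G) s)"
  using group.lcs_image[OF torelli_group outer_torelli_group out_proj_torelli] by auto

lemma outer_johnson_image: "outer_johnson G = (\<lambda>s. out_proj G ` johnson G s)"
  by (auto simp: outer_johnson_def)

lemma filtered_hom_out_proj:
  "central_filtration (torelli G) M \<Longrightarrow>
    filtered_hom (torelli G) M (outer_torelli G) (\<lambda>s. out_proj G ` M s) (out_proj G)"
  by (rule filtered_hom_image[OF _ outer_torelli_group out_proj_torelli])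


section \<open>Actions of the automorphism group\<close>

lemma filtered_action_lcs:
  "filtered_action G (lcs G) (johnson G 1) (AutoGroup G) (\<lambda>\<sigma>. \<sigma>)"
proof (intro filtered_action.intro filtered_action_axioms.intro central_filtration_lcs johnson_normal)
  show "filtered_hom G (lcs G) G (lcs G) \<sigma>" if "\<sigma> \<in> carrier (AutoGroup G)" for \<sigma>
    using that by (intro filtered_hom_lcs is_group) (simp add: carrier_AutoGroup auto_def)
  show "\<tau> x \<otimes> inv x \<in> lcs G (Suc s)" if "\<tau> \<in> johnson G 1" "1 \<le> s" "x \<in> lcs G s" for \<tau> s x
    using johnson_apply_lcs[OF that(1) _ that(2,3)] by (simp flip: Suc_eq_plus1_left)
qed (simp_all add: carrier_AutoGroup AutoGroup_one_apply AutoGroup_mult_apply)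

lemma conj_aut_eq: "conj_aut G = (\<lambda>\<sigma> \<alpha>. \<sigma> \<otimes>\<^bsub>AutoGroup G\<^esub> \<alpha> \<otimes>\<^bsub>AutoGroup G\<^esub> inv\<^bsub>AutoGroup G\<^esub> \<sigma>)"
  by (intro ext) (simp add: conj_aut_def)

text \<open>Normality of the terms inside the Torelli group would not give an action of all of
  \<open>auto G\<close>. The invariance asked for holds for \<open>johnson G\<close> by
  \<open>johnson_conjugate\<close>, and for the lower central series because homomorphisms preserve
  it.\<close>

lemma filtered_action_torelli:
  assumes "central_filtration (torelli G) M"
    and "\<And>\<sigma> s \<alpha>. \<lbrakk>\<sigma> \<in> auto G; 1 \<le> s; \<alpha> \<in> M s\<rbrakk> \<Longrightarrow> conj_aut G \<sigma> \<alpha> \<in> M s"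
  shows "filtered_action (torelli G) M (johnson G 1) (AutoGroup G) (conj_aut G)"
  unfolding torelli_def conj_aut_eq
  using assms by (intro filtered_action_conjugation johnson_normal)
    (simp_all add: torelli_def carrier_AutoGroup conj_aut_def)

lemma filtered_action_johnson:
  "filtered_action (torelli G) (johnson G) (johnson G 1) (AutoGroup G) (conj_aut G)"
  by (intro filtered_action_torelli central_filtration_johnson johnson_conjugate)

lemma conj_aut_hom_torelli:
  "\<sigma> \<in> auto G \<Longrightarrow> conj_aut G \<sigma> \<in> hom (torelli G) (torelli G)"
  by (rule filtered_hom.hom[OF filtered_action.action_filtered_hom[OF filtered_action_johnson]])
    (simp add: carrier_AutoGroup)

lemma filtered_action_lcs_torelli:
  "filtered_action (torelli G) (lcs (torelli G)) (johnson G 1) (AutoGroup G) (conj_aut G)"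
  using group.lcs_hom[OF torelli_group torelli_group conj_aut_hom_torelli]
  by (intro filtered_action_torelli group.central_filtration_lcs torelli_group) blast

lemma filtered_action_outer:
  assumes "filtered_action (torelli G) M (johnson G 1) (AutoGroup G) (conj_aut G)"
  shows "filtered_action (outer_torelli G) (\<lambda>s. out_proj G ` M s) (johnson G 1) (AutoGroup G) (conj_out G)"
  using assms outer_torelli_group out_proj_torelli
  by (rule filtered_action_image)
    (simp add: carrier_AutoGroup torelli_def out_proj_conjugate johnson_auto)

text \<open>Term 0 of the Johnson filtration is the full automorphism group, so restricting the
  carrier to it changes nothing.\<close>

lemma autA_eq: "autA G = AutoGroup G Mod johnson G 1"
  by (simp add: autA_def gr_piece_def johnson_zero AutoGroup_def One_nat_def)


section \<open>Exactness\<close>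

text \<open>The center hypothesis enters here; the later results reach it through this step of one
  degree.\<close>

lemma Ad_johnson_imp_lcs_Suc:
  assumes center: "lie_center (gr G (lcs G)) = {\<one>\<^bsub>gr G (lcs G)\<^esub>}"
    and s: "1 \<le> s" and x: "x \<in> lcs G s" and Ad: "Ad G x \<in> johnson G (Suc s)"
  shows "x \<in> lcs G (Suc s)"
proof -
  interpret L: central_filtration G "lcs G" by (rule central_filtration_lcs)
  interpret gr: comm_group "gr G (lcs G)" by (rule L.comm_group_gr)
  let ?h = "gr_homog G (lcs G) s (gr_class G (lcs G) s x)"
  have xc: "x \<in> carrier G" using x by (rule lcs_closed)
  have C: "gr_class G (lcs G) s x \<in> carrier (gr_piece G (lcs G) s)"
    using x by (simp add: carrier_gr_piece)
  have h: "?h \<in> carrier (gr G (lcs G))" using s C by (rule L.gr_homog_closed)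
  have "bracket (gr G (lcs G)) ?h y = \<one>\<^bsub>gr G (lcs G)\<^esub>" if "y \<in> carrier (gr G (lcs G))" for y
    using that
  proof (induction y rule: L.gr_induct)
    case one
    then show ?case using h by (rule L.bracket_gr_one(2))
  next
    case (mult y t D)
    obtain d where d: "d \<in> lcs G t" "D = gr_class G (lcs G) t d" using mult(3) by (rule L.gr_pieceE)
    have "commutator G x d = Ad G x d \<otimes> inv d"
      using lcs_closed[OF d(1)] by (simp add: Ad_apply commutator_def)
    \<comment> \<open>The commutator is the displacement of \<open>d\<close> under
      \<open>Ad G x\<close>. Since \<open>Ad G x\<close> has degree s + 1, it lies one degree deeper
      than the s + t expected from \<open>x\<close> and \<open>d\<close>, so the bracket of the two
      classes vanishes.\<close>
    then have "commutator G x d \<in> lcs G (Suc (s + t))"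
      using johnson_apply_lcs[OF Ad _ mult(2) d(1)] by simp
    then have "gr_bracket G (lcs G) s t (gr_class G (lcs G) s x) D = \<one>\<^bsub>gr_piece G (lcs G) (s + t)\<^esub>"
      using s mult(2) x d by (simp add: L.gr_bracket_class L.gr_class_trivial)
    then have "bracket (gr G (lcs G)) ?h (gr_homog G (lcs G) t D) = \<one>\<^bsub>gr G (lcs G)\<^esub>"
      using s mult(2,3) C by (simp add: L.bracket_gr_homog L.gr_homog_one)
    then show ?case
      using mult h by (simp add: L.bracket_gr_add_right L.gr_homog_closed)
  qed
  then have "?h = \<one>\<^bsub>gr G (lcs G)\<^esub>" using center h by (auto simp: lie_center_def)
  then have "?h s = \<one>\<^bsub>gr_piece G (lcs G) s\<^esub>" using s by (simp add: gr_simps)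
  then show ?thesis
    using s xc by (simp add: L.gr_homog_apply L.gr_class_eq_one_iff)
qed

text \<open>The degree is gained one step at a time from \<open>lcs G 1\<close>, the whole group.
  Each step is available because Johnson degree s + 1 includes Johnson degree s.\<close>

lemma Ad_johnson_imp_lcs:
  assumes center: "lie_center (gr G (lcs G)) = {\<one>\<^bsub>gr G (lcs G)\<^esub>}"
    and "1 \<le> s" "x \<in> carrier G" "Ad G x \<in> johnson G s"
  shows "x \<in> lcs G s"
  using assms(2,4)
proof (induction s rule: dec_induct)
  case base
  then show ?case using assms(3) by (simp add: lcs_one)
next
  case (step s)
  then show ?case using johnson_Suc_subset Ad_johnson_imp_lcs_Suc[OF center] by blast
qed

text \<open>Both rows at once, for \<open>M\<close> the lower central series of the Torelli group and for
  \<open>M\<close> its Johnson filtration.\<close>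

lemma short_exact_torelli:
  assumes center: "lie_center (gr G (lcs G)) = {\<one>\<^bsub>gr G (lcs G)\<^esub>}"
    and Ad: "filtered_hom G (lcs G) (torelli G) M (Ad G)"
    and M: "\<And>s. 1 \<le> s \<Longrightarrow> M s \<subseteq> johnson G s"
  shows "short_exact (gr G (lcs G)) (gr (torelli G) M) (gr (outer_torelli G) (\<lambda>s. out_proj G ` M s))
    (gr_map (torelli G) M (Ad G)) (gr_map (outer_torelli G) (\<lambda>s. out_proj G ` M s) (out_proj G))"
proof -
  interpret Ad: filtered_hom G "lcs G" "torelli G" M "Ad G" by fact
  show ?thesis
  proof (rule short_exact_gr[OF Ad filtered_hom_out_proj[OF Ad.cod.central_filtration_axioms]])
    show "x \<in> lcs G (Suc s)" if "1 \<le> s" "x \<in> lcs G s" "Ad G x \<in> M (Suc s)" for s x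
      using Ad_johnson_imp_lcs_Suc[OF center that(1,2)] M[of "Suc s"] that(3) by auto
    show "out_proj G (Ad G x) = \<one>\<^bsub>outer_torelli G\<^esub>" if "x \<in> carrier G" for x
      using out_proj_Ad[OF that] by (simp add: outer_torelli_def)
    fix s \<alpha> assume s: "1 \<le> s" and \<alpha>: "\<alpha> \<in> M s" and "out_proj G \<alpha> \<in> out_proj G ` M (Suc s)"
    then obtain \<beta> where \<beta>: "\<beta> \<in> M (Suc s)" "out_proj G \<alpha> = out_proj G \<beta>" by blast
    have J: "\<alpha> \<in> johnson G s" "\<beta> \<in> johnson G s"
      using subsetD[OF M[OF s] \<alpha>] subsetD[OF M[of "Suc s"] \<beta>(1)] subsetD[OF johnson_Suc_subset]
      by simp_all
    then obtain x where x: "x \<in> carrier G" "\<alpha> = Ad G x \<otimes>\<^bsub>AutoGroup G\<^esub> \<beta>"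
      using out_proj_eqE[OF johnson_auto johnson_auto \<beta>(2)] by blast
    interpret Aut: group "AutoGroup G" by (rule AutoGroup)
    \<comment> \<open>Equality of outer classes gives an \<open>x\<close> with no control on its
      degree. Since \<alpha> and \<beta> both lie in \<open>johnson G s\<close>, so does
      \<open>Ad G x\<close>, and this determines the degree of \<open>x\<close> in
      \<open>lcs G\<close> even when \<open>M\<close> is the lower central series.\<close>
    have "Ad G x = \<alpha> \<otimes>\<^bsub>AutoGroup G\<^esub> inv\<^bsub>AutoGroup G\<^esub> \<beta>"
      using x johnson_auto[OF J(2)] by (simp add: Aut.m_assoc carrier_AutoGroup Ad_auto auto_inv)
    then have "Ad G x \<in> johnson G s"
      using J by (simp add: subgroup.m_closed[OF johnson_subgroup] subgroup.m_inv_closed[OF johnson_subgroup])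
    then have xs: "x \<in> lcs G s" by (rule Ad_johnson_imp_lcs[OF center s x(1)])
    have "Ad G x \<in> carrier (torelli G)" "\<beta> \<in> carrier (torelli G)"
      using x(1) Ad.cod.N_closed[OF _ \<beta>(1)] by simp_all
    moreover have "\<alpha> = Ad G x \<otimes>\<^bsub>torelli G\<^esub> \<beta>" using x by (simp add: torelli_def)
    \<comment> \<open>As \<open>Ad G x\<close> stands to the left of \<beta>, the remainder is the
      conjugate of \<beta> by \<open>Ad G x\<close> and not \<beta> itself; it stays in
      \<open>M (Suc s)\<close> by normality.\<close>
    ultimately have "\<alpha> \<otimes>\<^bsub>torelli G\<^esub> inv\<^bsub>torelli G\<^esub> Ad G x \<in> M (Suc s)"
      using Ad.cod.N_conjugate[of "Suc s" "Ad G x" \<beta>] \<beta>(1) by simp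
    with xs show "\<exists>x\<in>lcs G s. \<alpha> \<otimes>\<^bsub>torelli G\<^esub> inv\<^bsub>torelli G\<^esub> Ad G x \<in> M (Suc s)" by blast
  qed simp
qed

end

theorem theorem3p5:
  fixes G :: "('a, 'm) monoid_scheme"
  assumes "group G"
    and "lie_center (gr G (lcs G)) = {\<one>\<^bsub>gr G (lcs G)\<^esub>}"
  defines "T \<equiv> torelli G" and "T' \<equiv> outer_torelli G"
    and "F \<equiv> johnson G" and "F' \<equiv> outer_johnson G"
    and "A \<equiv> autA G"
  defines "L \<equiv> gr G (lcs G)"
    and "M\<Gamma> \<equiv> gr T (lcs T)" and "M\<Gamma>' \<equiv> gr T' (lcs T')"
    and "MF \<equiv> gr T F" and "MF' \<equiv> gr T' F'"
  defines "actL \<equiv> gr_action G (lcs G) (\<lambda>\<sigma>. \<sigma>)"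
    and "act\<Gamma> \<equiv> gr_action T (lcs T) (conj_aut G)"
    and "act\<Gamma>' \<equiv> gr_action T' (lcs T') (conj_out G)"
    and "actF \<equiv> gr_action T F (conj_aut G)"
    and "actF' \<equiv> gr_action T' F' (conj_out G)"
  defines "Ad\<Gamma> \<equiv> gr_map T (lcs T) (Ad G)"
    and "\<pi>\<Gamma> \<equiv> gr_map T' (lcs T') (out_proj G)"
    and "AdF \<equiv> gr_map T F (Ad G)"
    and "\<pi>F \<equiv> gr_map T' F' (out_proj G)"
    and "\<iota> \<equiv> gr_map T F (\<lambda>\<alpha>. \<alpha>)"
    and "\<iota>' \<equiv> gr_map T' F' (\<lambda>\<beta>. \<beta>)"
  shows
    "graded_lie_action A L actL \<and>
     graded_lie_action A M\<Gamma> act\<Gamma> \<and>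
     graded_lie_action A M\<Gamma>' act\<Gamma>' \<and>
     graded_lie_action A MF actF \<and>
     graded_lie_action A MF' actF' \<and>
     Ad\<Gamma> \<in> equivariant_graded_lie_hom A L actL M\<Gamma> act\<Gamma> \<and>
     \<pi>\<Gamma> \<in> equivariant_graded_lie_hom A M\<Gamma> act\<Gamma> M\<Gamma>' act\<Gamma>' \<and>
     AdF \<in> equivariant_graded_lie_hom A L actL MF actF \<and>
     \<pi>F \<in> equivariant_graded_lie_hom A MF actF MF' actF' \<and>
     \<iota> \<in> equivariant_graded_lie_hom A M\<Gamma> act\<Gamma> MF actF \<and>
     \<iota>' \<in> equivariant_graded_lie_hom A M\<Gamma>' act\<Gamma>' MF' actF' \<and>
     (\<forall>x \<in> carrier L. \<iota> (Ad\<Gamma> x) = AdF x) \<and>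
     (\<forall>x \<in> carrier M\<Gamma>. \<iota>' (\<pi>\<Gamma> x) = \<pi>F (\<iota> x)) \<and>
     short_exact L M\<Gamma> M\<Gamma>' Ad\<Gamma> \<pi>\<Gamma> \<and>
     short_exact L MF MF' AdF \<pi>F"
proof -
  interpret group G by fact
  have T: "group T" "group T'"
    unfolding T_def T'_def by (rule torelli_group outer_torelli_group)+
  have A: "A = AutoGroup G Mod johnson G 1" unfolding A_def by (rule autA_eq)
  have Ad_hom: "Ad G \<in> hom G T"
    using Ad_johnson[of 1] group_hom.homh[OF Ad_group_hom]
    by (auto simp: T_def torelli_def hom_def lcs_one)
  \<comment> \<open>With both outer filtrations in image form, their strong centrality, their
    actions and the exactness of the rows are instances of the results for images under
    \<open>out_proj G\<close>.\<close>
  have F': "F' = (\<lambda>s. out_proj G ` F s)"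
    unfolding F'_def F_def by (rule outer_johnson_image)
  have lcsT': "lcs T' = (\<lambda>s. out_proj G ` lcs T s)"
    unfolding T'_def T_def by (rule lcs_outer_torelli)
  have actL: "filtered_action G (lcs G) (johnson G 1) (AutoGroup G) (\<lambda>\<sigma>. \<sigma>)"
    by (rule filtered_action_lcs)
  have act\<Gamma>: "filtered_action T (lcs T) (johnson G 1) (AutoGroup G) (conj_aut G)"
    unfolding T_def by (rule filtered_action_lcs_torelli)
  have actF: "filtered_action T F (johnson G 1) (AutoGroup G) (conj_aut G)"
    unfolding T_def F_def by (rule filtered_action_johnson)
  have act\<Gamma>': "filtered_action T' (lcs T') (johnson G 1) (AutoGroup G) (conj_out G)"
    unfolding lcsT' using act\<Gamma> unfolding T_def T'_def by (rule filtered_action_outer)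
  have actF': "filtered_action T' F' (johnson G 1) (AutoGroup G) (conj_out G)"
    unfolding F' using actF unfolding T_def T'_def by (rule filtered_action_outer)
  have cf: "central_filtration T (lcs T)" "central_filtration T F"
    "central_filtration T' (lcs T')" "central_filtration T' F'"
    using act\<Gamma> actF act\<Gamma>' actF' by (simp_all add: filtered_action_def)
  have Ad\<Gamma>: "filtered_hom G (lcs G) T (lcs T) (Ad G)"
    using is_group T(1) Ad_hom by (rule filtered_hom_lcs)
  have AdF: "filtered_hom G (lcs G) T F (Ad G)"
    using central_filtration_lcs cf(2) Ad_hom Ad_johnson
    by (intro filtered_hom.intro filtered_hom_axioms.intro) (simp_all add: F_def)
  have \<pi>\<Gamma>: "filtered_hom T (lcs T) T' (lcs T') (out_proj G)"
    unfolding lcsT' using cf(1) unfolding T_def T'_def by (rule filtered_hom_out_proj)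
  have \<pi>F: "filtered_hom T F T' F' (out_proj G)"
    unfolding F' using cf(2) unfolding T_def T'_def by (rule filtered_hom_out_proj)
  have \<iota>: "filtered_hom T (lcs T) T F (\<lambda>\<alpha>. \<alpha>)"
    using cf(1,2) central_filtration.lcs_subset_filtration[OF cf(2)]
    by (intro filtered_hom.intro filtered_hom_axioms.intro) (auto simp: hom_def)
  have \<iota>': "filtered_hom T' (lcs T') T' F' (\<lambda>\<beta>. \<beta>)"
    using cf(3,4) central_filtration.lcs_subset_filtration[OF cf(4)]
    by (intro filtered_hom.intro filtered_hom_axioms.intro) (auto simp: hom_def)
  have conj_Ad: "Ad G (\<sigma> x) = conj_aut G \<sigma> (Ad G x)"
    if "\<sigma> \<in> carrier (AutoGroup G)" "x \<in> carrier G" for \<sigma> x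
    using that by (intro Ad_conjugate) (simp_all add: carrier_AutoGroup)
  have conj_\<pi>: "out_proj G (conj_aut G \<sigma> \<alpha>) = conj_out G \<sigma> (out_proj G \<alpha>)"
    if "\<sigma> \<in> carrier (AutoGroup G)" "\<alpha> \<in> carrier T" for \<sigma> \<alpha>
    using that by (simp add: carrier_AutoGroup out_proj_conjugate T_def torelli_def johnson_auto)
  show ?thesis
  proof (intro conjI ballI)
    show "graded_lie_action A L actL"
      unfolding A L_def actL_def by (rule filtered_action.graded_lie_action_gr[OF actL])
    show "graded_lie_action A M\<Gamma> act\<Gamma>"
      unfolding A M\<Gamma>_def act\<Gamma>_def by (rule filtered_action.graded_lie_action_gr[OF act\<Gamma>])
    show "graded_lie_action A M\<Gamma>' act\<Gamma>'"
      unfolding A M\<Gamma>'_def act\<Gamma>'_def by (rule filtered_action.graded_lie_action_gr[OF act\<Gamma>'])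
    show "graded_lie_action A MF actF"
      unfolding A MF_def actF_def by (rule filtered_action.graded_lie_action_gr[OF actF])
    show "graded_lie_action A MF' actF'"
      unfolding A MF'_def actF'_def by (rule filtered_action.graded_lie_action_gr[OF actF'])
    show "Ad\<Gamma> \<in> equivariant_graded_lie_hom A L actL M\<Gamma> act\<Gamma>"
      unfolding A Ad\<Gamma>_def L_def actL_def M\<Gamma>_def act\<Gamma>_def
      by (rule gr_map_equivariant[OF actL act\<Gamma> Ad\<Gamma>]) (rule conj_Ad)
    show "\<pi>\<Gamma> \<in> equivariant_graded_lie_hom A M\<Gamma> act\<Gamma> M\<Gamma>' act\<Gamma>'"
      unfolding A \<pi>\<Gamma>_def M\<Gamma>_def act\<Gamma>_def M\<Gamma>'_def act\<Gamma>'_def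
      by (rule gr_map_equivariant[OF act\<Gamma> act\<Gamma>' \<pi>\<Gamma>]) (rule conj_\<pi>)
    show "AdF \<in> equivariant_graded_lie_hom A L actL MF actF"
      unfolding A AdF_def L_def actL_def MF_def actF_def
      by (rule gr_map_equivariant[OF actL actF AdF]) (rule conj_Ad)
    show "\<pi>F \<in> equivariant_graded_lie_hom A MF actF MF' actF'"
      unfolding A \<pi>F_def MF_def actF_def MF'_def actF'_def
      by (rule gr_map_equivariant[OF actF actF' \<pi>F]) (rule conj_\<pi>)
    show "\<iota> \<in> equivariant_graded_lie_hom A M\<Gamma> act\<Gamma> MF actF"
      unfolding A \<iota>_def M\<Gamma>_def act\<Gamma>_def MF_def actF_def
      by (rule gr_map_equivariant[OF act\<Gamma> actF \<iota>]) simp_all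
    show "\<iota>' \<in> equivariant_graded_lie_hom A M\<Gamma>' act\<Gamma>' MF' actF'"
      unfolding A \<iota>'_def M\<Gamma>'_def act\<Gamma>'_def MF'_def actF'_def
      by (rule gr_map_equivariant[OF act\<Gamma>' actF' \<iota>']) simp_all
    show "\<iota> (Ad\<Gamma> x) = AdF x" if "x \<in> carrier L" for x
      using that unfolding \<iota>_def Ad\<Gamma>_def AdF_def L_def
      by (rule gr_map_comp[OF Ad\<Gamma> \<iota> refl])
    show "\<iota>' (\<pi>\<Gamma> x) = \<pi>F (\<iota> x)" if "x \<in> carrier M\<Gamma>" for x
      using gr_map_comp[OF \<pi>\<Gamma> \<iota>' refl, of x] gr_map_comp[OF \<iota> \<pi>F refl, of x] that
      by (simp add: \<iota>_def \<iota>'_def \<pi>\<Gamma>_def \<pi>F_def M\<Gamma>_def)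
    show "short_exact L M\<Gamma> M\<Gamma>' Ad\<Gamma> \<pi>\<Gamma>"
      unfolding L_def M\<Gamma>_def M\<Gamma>'_def Ad\<Gamma>_def \<pi>\<Gamma>_def lcsT'
      using assms(2) Ad\<Gamma> lcs_torelli_subset unfolding T_def T'_def
      by (rule short_exact_torelli)
    show "short_exact L MF MF' AdF \<pi>F"
      unfolding L_def MF_def MF'_def AdF_def \<pi>F_def F'
      using assms(2) AdF order_refl unfolding T_def T'_def F_def
      by (rule short_exact_torelli)
  qed
qed

end
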